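(* Let $L$ be a nonsolvable Lie algebra of dimension $5$ over a finite field $k$ of characteristic $p=2$. Then $L$ is (up to isomorphism) one of the following. 1. $\operatorname{Der} W(1;\underline 2)^{(1)}$; 2. $W(1;\underline 2)\rtimes \operatorname{rad}(L)$, where $[W(1;\underline 2)^{(1)},\operatorname{rad}(L)]=\{0\}$ and $$\operatorname{rad}(L)=ku,\quad [x^{(3)}\partial,u]=\delta u,\qquad \delta\in\{0,1\};$$ 3. $W(1;\underline 2)^{(1)}\oplus \operatorname{rad}(L)$ is the direct sum of ideals, and $$\operatorname{rad}(L)=kh\oplus ku,\quad [h,u]=\delta u,\qquad \delta\in\{0,1\}.$$ The listed Lie algebras are mutually nonisomorphic.
   Context: Notation over a field $k$ of characteristic $2$: $\mathcal O(1;\underline 2)$ is the commutative associative unital $k$-algebra with basis $1=x^{(0)},\ x=x^{(1)},\ x^{(2)},x^{(3)}$ and product $x^{(r)}x^{(s)}=\binom{r+s}{r}x^{(r+s)}$ (read as $0$ if $r+s\ge 4$). The derivation $\partial$ of $\mathcal O(1;\underline 2)$ is given by $\partial(1)=0$, $\partial(x^{(r)})=x^{(r-1)}$ for $r\ge 1$. The Lie algebra $W(1;\underline 2)=\{f\partial\mid f\in\mathcal O(1;\underline 2)\}$ has bracket $[f\partial,g\partial]=(f\partial(g)-g\partial(f))\partial$ and basis $\partial,x\partial,x^{(2)}\partial,x^{(3)}\partial$; its derived algebra $W(1;\underline 2)^{(1)}=[W(1;\underline 2),W(1;\underline 2)]$ has basis $\partial,x\partial,x^{(2)}\partial$. $\operatorname{rad}(L)$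 is the solvable radical of $L$. $A\rtimes I$ denotes a semidirect sum: a Lie algebra which is the vector space direct sum of a subalgebra $A$ and an ideal $I$. *)

theory Defs
  imports Complex_Main "HOL-Library.Function_Algebras" "HOL-Library.Product_Plus"
begin

section \<open>Lie algebras over a field\<close>

text \<open>
  A Lie algebra is given by a carrier that is a subspace of an ambient vector space, so that
  subalgebras and ideals are Lie algebras on the same ambient type.
\<close>

record ('k, 'v) lie_data =
  carr :: "'v set"
  smul :: "'k \<Rightarrow> 'v \<Rightarrow> 'v"
  brk :: "'v \<Rightarrow> 'v \<Rightarrow> 'v"

locale lie_algebra = vector_space "smul L"
  for L :: "('k::field, 'v::ab_group_add) lie_data" +
  assumes subspace_carr: "subspace (carr L)"
    and brk_closed: "\<lbrakk>x \<in> carr L; y \<in> carr L\<rbrakk> \<Longrightarrow> brk L x y \<in> carr L"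
    and brk_add_left: "\<lbrakk>x \<in> carr L; y \<in> carr L; z \<in> carr L\<rbrakk>
          \<Longrightarrow> brk L (x + y) z = brk L x z + brk L y z"
    and brk_add_right: "\<lbrakk>x \<in> carr L; y \<in> carr L; z \<in> carr L\<rbrakk>
          \<Longrightarrow> brk L x (y + z) = brk L x y + brk L x z"
    and brk_smul_left: "\<lbrakk>x \<in> carr L; y \<in> carr L\<rbrakk>
          \<Longrightarrow> brk L (smul L c x) y = smul L c (brk L x y)"
    and brk_smul_right: "\<lbrakk>x \<in> carr L; y \<in> carr L\<rbrakk>
          \<Longrightarrow> brk L x (smul L c y) = smul L c (brk L x y)"
    and brk_self: "x \<in> carr L \<Longrightarrow> brk L x x = 0"
    and jacobi: "\<lbrakk>x \<in> carr L; y \<in> carr L; z \<in> carr L\<rbrakk>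
          \<Longrightarrow> brk L x (brk L y z) + brk L y (brk L z x) + brk L z (brk L x y) = 0"

definition lie_dim :: "('k::field, 'v::ab_group_add) lie_data \<Rightarrow> nat" where
  "lie_dim L = vector_space.dim (smul L) (carr L)"

abbreviation lie_span :: "('k::field, 'v::ab_group_add) lie_data \<Rightarrow> 'v set \<Rightarrow> 'v set" where
  "lie_span L \<equiv> module.span (smul L)"

definition restrict_to :: "('k, 'v) lie_data \<Rightarrow> 'v set \<Rightarrow> ('k, 'v) lie_data" where
  "restrict_to L S = L\<lparr>carr := S\<rparr>"

definition lie_subalgebra ::
    "'v set \<Rightarrow> ('k::field, 'v::ab_group_add) lie_data \<Rightarrow> bool" where
  "lie_subalgebra S L \<longleftrightarrow>
     S \<subseteq> carr L \<and> module.subspace (smul L) S \<and> (\<forall>x\<in>S. \<forall>y\<in>S. brk L x y \<in> S)"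

definition lie_ideal ::
    "'v set \<Rightarrow> ('k::field, 'v::ab_group_add) lie_data \<Rightarrow> bool" where
  "lie_ideal I L \<longleftrightarrow>
     I \<subseteq> carr L \<and> module.subspace (smul L) I \<and> (\<forall>x\<in>carr L. \<forall>y\<in>I. brk L x y \<in> I)"

definition derived_alg ::
    "('k::field, 'v::ab_group_add) lie_data \<Rightarrow> ('k, 'v) lie_data" where
  "derived_alg L = restrict_to L (lie_span L {brk L x y |x y. x \<in> carr L \<and> y \<in> carr L})"

definition solvable :: "('k::field, 'v::ab_group_add) lie_data \<Rightarrow> bool" where
  "solvable L \<longleftrightarrow> (\<exists>n. carr ((derived_alg ^^ n) L) = {0})"

text \<open>
  The sum of all solvable ideals; for finite-dimensional \<open>L\<close> this is the largest solvable ideal.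
\<close>

definition rad :: "('k::field, 'v::ab_group_add) lie_data \<Rightarrow> 'v set" where
  "rad L = lie_span L (\<Union>{I. lie_ideal I L \<and> solvable (restrict_to L I)})"

definition lie_iso :: "('v \<Rightarrow> 'w) \<Rightarrow> ('k::field, 'v::ab_group_add) lie_data
    \<Rightarrow> ('k, 'w::ab_group_add) lie_data \<Rightarrow> bool" where
  "lie_iso \<phi> L M \<longleftrightarrow>
     bij_betw \<phi> (carr L) (carr M) \<and>
     (\<forall>x\<in>carr L. \<forall>y\<in>carr L. \<phi> (x + y) = \<phi> x + \<phi> y) \<and>
     (\<forall>c. \<forall>x\<in>carr L. \<phi> (smul L c x) = smul M c (\<phi> x)) \<and>
     (\<forall>x\<in>carr L. \<forall>y\<in>carr L. \<phi> (brk L x y) = brk M (\<phi> x) (\<phi> y))"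

definition isomorphic :: "('k::field, 'v::ab_group_add) lie_data
    \<Rightarrow> ('k, 'w::ab_group_add) lie_data \<Rightarrow> bool" (infix "\<cong>\<^sub>L" 50) where
  "L \<cong>\<^sub>L M \<longleftrightarrow> (\<exists>\<phi>. lie_iso \<phi> L M)"

definition semidirect_sum ::
    "('k::field, 'v::ab_group_add) lie_data \<Rightarrow> 'v set \<Rightarrow> 'v set \<Rightarrow> bool" where
  "semidirect_sum L A I \<longleftrightarrow>
     lie_algebra L \<and> lie_subalgebra A L \<and> lie_ideal I L \<and>
     A \<inter> I = {0} \<and> carr L = {a + x |a x. a \<in> A \<and> x \<in> I}"

definition direct_sum_of_ideals ::
    "('k::field, 'v::ab_group_add) lie_data \<Rightarrow> 'v set \<Rightarrow> 'v set \<Rightarrow> bool" where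
  "direct_sum_of_ideals L A I \<longleftrightarrow> semidirect_sum L A I \<and> lie_ideal A L"

text \<open>
  Derivations of \<open>L\<close> are maps on \<open>carr L\<close>; as HOL functions on the ambient type they are
  normalised to vanish off \<open>carr L\<close>, so that each derivation has exactly one representative.
\<close>

definition Der ::
    "('k::field, 'v::ab_group_add) lie_data \<Rightarrow> ('k, 'v \<Rightarrow> 'v) lie_data" where
  "Der L = \<lparr>
     carr = {D. (\<forall>x. x \<notin> carr L \<longrightarrow> D x = 0) \<and> (\<forall>x\<in>carr L. D x \<in> carr L) \<and>
                (\<forall>x\<in>carr L. \<forall>y\<in>carr L. D (x + y) = D x + D y) \<and>
                (\<forall>c. \<forall>x\<in>carr L. D (smul L c x) = smul L c (D x)) \<and>
                (\<forall>x\<in>carr L. \<forall>y\<in>carr L. D (brk L x y) = brk L (D x) y + brk L x (D y))},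
     smul = (\<lambda>c D x. smul L c (D x)),
     brk = (\<lambda>D E x. D (E x) - E (D x))\<rparr>"


section \<open>The algebras \<open>O(1;2)\<close> and \<open>W(1;2)\<close>\<close>

text \<open>
  The element \<open>\<Sum>r<4. c\<^sub>r x\<^sup>(\<^sup>r\<^sup>)\<close> of \<open>O(1;2)\<close> is represented by its coefficient function \<open>c\<close>,
  extended by \<open>0\<close> to all natural numbers.  Addition is pointwise.  The product is the bilinear
  extension of \<open>x\<^sup>(\<^sup>r\<^sup>) x\<^sup>(\<^sup>s\<^sup>) = (r + s choose r) x\<^sup>(\<^sup>r\<^sup>+\<^sup>s\<^sup>)\<close>, with \<open>x\<^sup>(\<^sup>n\<^sup>) = 0\<close> for \<open>n \<ge> 4\<close>; it is not the
  pointwise product of functions.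
\<close>

definition O12 :: "(nat \<Rightarrow> 'k::field) set" where
  "O12 = {f. \<forall>r\<ge>4. f r = 0}"

definition dp :: "nat \<Rightarrow> nat \<Rightarrow> 'k::field" where
  "dp r = (\<lambda>i. if i = r then 1 else 0)"

definition dp_mult :: "(nat \<Rightarrow> 'k::field) \<Rightarrow> (nat \<Rightarrow> 'k) \<Rightarrow> nat \<Rightarrow> 'k" where
  "dp_mult f g = (\<lambda>n. if n < 4
     then \<Sum>r\<le>n. of_nat (n choose r) * f r * g (n - r) else 0)"

text \<open>The linear map with \<open>1 \<mapsto> 0\<close> and \<open>x\<^sup>(\<^sup>r\<^sup>) \<mapsto> x\<^sup>(\<^sup>r\<^sup>-\<^sup>1\<^sup>)\<close> for \<open>r \<ge> 1\<close>.\<close>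

definition dp_deriv :: "(nat \<Rightarrow> 'k::field) \<Rightarrow> nat \<Rightarrow> 'k" where
  "dp_deriv f = (\<lambda>n. f (Suc n))"

text \<open>
  The element \<open>f\<partial>\<close> of \<open>W(1;2)\<close> is represented by \<open>f\<close>; this is unambiguous, since
  \<open>(f\<partial>)(x) = f\<close>.  In particular \<open>dp 3\<close> represents \<open>x\<^sup>(\<^sup>3\<^sup>)\<partial>\<close>.
\<close>

definition W12 :: "('k::field, nat \<Rightarrow> 'k) lie_data" where
  "W12 = \<lparr>carr = O12, smul = (\<lambda>c f r. c * f r),
          brk = (\<lambda>f g. dp_mult f (dp_deriv g) - dp_mult g (dp_deriv f))\<rparr>"

abbreviation W12' :: "('k::field, nat \<Rightarrow> 'k) lie_data" where
  "W12' \<equiv> derived_alg W12"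


section \<open>The algebras with nonzero radical\<close>

text \<open>External semidirect sum, for an action \<open>act\<close> of \<open>A\<close> on \<open>I\<close> by derivations.\<close>

definition semidirect_by :: "('k::field, 'v::ab_group_add) lie_data \<Rightarrow> ('v \<Rightarrow> 'w \<Rightarrow> 'w)
    \<Rightarrow> ('k, 'w::ab_group_add) lie_data \<Rightarrow> ('k, 'v \<times> 'w) lie_data" where
  "semidirect_by A act I = \<lparr>
     carr = carr A \<times> carr I,
     smul = (\<lambda>c (a, x). (smul A c a, smul I c x)),
     brk = (\<lambda>(a, x) (b, y). (brk A a b, act a y - act b x + brk I x y))\<rparr>"

definition line_alg :: "('k::field, 'k) lie_data" where
  "line_alg = \<lparr>carr = UNIV, smul = (*), brk = (\<lambda>_ _. 0)\<rparr>"

text \<open>\<open>kh \<oplus> ku\<close> with \<open>h = (1, 0)\<close>, \<open>u = (0, 1)\<close> and \<open>[h, u] = \<delta>u\<close>.\<close>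

definition plane_alg :: "'k \<Rightarrow> ('k::field, 'k \<times> 'k) lie_data" where
  "plane_alg \<delta> = \<lparr>carr = UNIV, smul = (\<lambda>c (a, b). (c * a, c * b)),
     brk = (\<lambda>(a, b) (c, d). (0, \<delta> * (a * d - b * c)))\<rparr>"

text \<open>
  On \<open>ku\<close> the element \<open>f\<partial>\<close> acts as \<open>\<delta>\<close> times its \<open>x\<^sup>(\<^sup>3\<^sup>)\<partial>\<close>-coefficient: \<open>x\<^sup>(\<^sup>3\<^sup>)\<partial>\<close> acts as \<open>\<delta>\<close>,
  and \<open>\<partial>\<close>, \<open>x\<partial>\<close>, \<open>x\<^sup>(\<^sup>2\<^sup>)\<partial>\<close>, which span the derived algebra, act as \<open>0\<close>.
\<close>

definition W_line :: "'k \<Rightarrow> ('k::field, (nat \<Rightarrow> 'k) \<times> 'k) lie_data" where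
  "W_line \<delta> = semidirect_by W12 (\<lambda>f c. \<delta> * f 3 * c) line_alg"

definition W'_plane :: "'k \<Rightarrow> ('k::field, (nat \<Rightarrow> 'k) \<times> ('k \<times> 'k)) lie_data" where
  "W'_plane \<delta> = semidirect_by W12' (\<lambda>_ _. 0) (plane_alg \<delta>)"

text \<open>
  The internal descriptions: \<open>L = W(1;2) \<rtimes> rad L\<close> and \<open>L = W(1;2)\<^sup>(\<^sup>1\<^sup>) \<oplus> rad L\<close>, with the stated
  radical and brackets; \<open>\<phi>\<close> identifies \<open>W(1;2)\<close>, respectively \<open>W(1;2)\<^sup>(\<^sup>1\<^sup>)\<close>, with the
  complement \<open>A\<close> of the radical.
\<close>

definition is_W_semidirect_rad ::
    "'k \<Rightarrow> ('k::field, 'v::ab_group_add) lie_data \<Rightarrow> bool" where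
  "is_W_semidirect_rad \<delta> L \<longleftrightarrow> (\<exists>A \<phi> u.
     semidirect_sum L A (rad L) \<and> lie_iso \<phi> W12 (restrict_to L A) \<and>
     (\<forall>w\<in>carr W12'. \<forall>r\<in>rad L. brk L (\<phi> w) r = 0) \<and>
     u \<noteq> 0 \<and> rad L = lie_span L {u} \<and>
     brk L (\<phi> (dp 3)) u = smul L \<delta> u)"

definition is_W'_direct_rad ::
    "'k \<Rightarrow> ('k::field, 'v::ab_group_add) lie_data \<Rightarrow> bool" where
  "is_W'_direct_rad \<delta> L \<longleftrightarrow> (\<exists>A \<phi> h u.
     direct_sum_of_ideals L A (rad L) \<and> lie_iso \<phi> W12' (restrict_to L A) \<and>
     h \<noteq> u \<and> \<not> module.dependent (smul L) {h, u} \<and> rad L = lie_span L {h, u} \<and>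
     brk L h u = smul L \<delta> u)"

end

theory Submission
  imports Defs "HOL-Algebra.Algebraic_Closure_Type"
begin

text \<open>
  Let \<open>L\<close> be nonsolvable of dimension 5 over the finite field \<open>k\<close> of characteristic 2.  The derived
  series of \<open>L\<close> becomes stationary at a perfect ideal \<open>P \<noteq> 0\<close>.  Everything rests on the fact that
  \<open>P\<close> has dimension 3: perfect algebras of dimension 1 and 2 do not exist for trivial reasons, and
  those of dimension 4 and 5 do not exist by the argument below.

  A perfect algebra of dimension 3 over a perfect field of characteristic 2 has a basis \<open>e, f, h\<close>
  with \<open>[e, f] = h\<close>, \<open>[h, e] = e\<close>, \<open>[h, f] = f\<close> (\<open>perfect_dim_3\<close>); this is \<open>W(1;2)\<^sup>(\<^sup>1\<^sup>)\<close>, with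
  \<open>e = x\<^sup>(\<^sup>2\<^sup>)\<partial>\<close>, \<open>f = \<partial>\<close>, \<open>h = x\<partial>\<close>.  Modulo inner derivations its derivations are the maps with
  \<open>e \<mapsto> b f\<close>, \<open>f \<mapsto> a e\<close>, \<open>h \<mapsto> 0\<close> (\<open>W_triple_derivation\<close>).  So \<open>L\<close> is spanned by \<open>P\<close> and two elements
  that act on \<open>P\<close> by such maps, and the two pairs \<open>(b, a)\<close> form a 2 by 2 matrix.  If its rank is 2,
  then \<open>L\<close> acts faithfully on \<open>P\<close> and fills \<open>Der P\<close>.  If it is 1, then, after a change of the triple
  that uses square roots in \<open>k\<close>, one element acts like \<open>x\<^sup>(\<^sup>3\<^sup>)\<partial>\<close> and the other one spans the
  centraliser of \<open>P\<close>.  If it is 0, then \<open>L\<close> is the direct sum of \<open>P\<close> and its centraliser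
  (\<open>complement_cases\<close>).

  Now suppose that \<open>P\<close> is perfect of dimension 4 or 5.  By Engel's theorem some \<open>ad x\<close> is not
  nilpotent (\<open>engel_perfect\<close>).  In characteristic 2 the square of a derivation is a derivation, and
  \<open>P\<close> is finite; hence some \<open>T = (ad x)^(2^i) \<noteq> 0\<close> is a derivation with \<open>T^(2^m) = T\<close>, so that its
  eigenvalues lie in the field with \<open>2^m\<close> elements.  Over the algebraic closure the trace map
  of that field turns \<open>T\<close> into a nonzero derivation \<open>E\<close> with \<open>E E = E\<close>, which grades \<open>P\<close> by \<open>Z/2\<close>.
  Scalars are extended because the eigenvalues may be permuted by the Frobenius map of \<open>k\<close> in such a
  way that all their traces to \<open>k\<close> are zero, and then no combination over \<open>k\<close> of the maps \<open>T^(2^j)\<close> is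
  a nonzero idempotent.  Going through the possible
  dimensions of the two homogeneous parts shows that a perfect algebra of dimension 4 or 5 has no
  such grading (\<open>no_toral_derivation\<close>, \<open>not_perfect\<close>).

  The three families are told apart by the centraliser of the second derived algebra, which has
  dimension 0, 1 and 2 respectively, and \<open>\<delta>\<close> is detected by whether this centraliser is central.
  In the last two families this centraliser is also the radical, since an ideal that does not
  centralise the copy of \<open>W(1;2)\<^sup>(\<^sup>1\<^sup>)\<close> contains it (\<open>rad_eq_centraliser\<close>).
\<close>

section \<open>Linear algebra with small spanning sets\<close>

lemma (in vector_space) span_pair: "x \<in> span {a, b} \<longleftrightarrow> (\<exists>r s. x = scale r a + scale s b)"
  by (simp add: span_insert span_singleton image_iff diff_eq_eq ac_simps)

lemma (in vector_space) span_triple: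
  "x \<in> span {a, b, c} \<longleftrightarrow> (\<exists>r s t. x = scale r a + scale s b + scale t c)"
  unfolding span_insert[of a] by (simp add: span_pair diff_eq_eq ac_simps)

lemma (in vector_space) span_quad:
  "x \<in> span {a, b, c, d} \<longleftrightarrow> (\<exists>r s t u. x = scale r a + scale s b + scale t c + scale u d)"
  unfolding span_insert[of a] by (simp add: span_triple diff_eq_eq ac_simps)

lemma (in vector_space) span_quint:
  "x \<in> span {a, b, c, d, e} \<longleftrightarrow>
    (\<exists>r s t u v. x = scale r a + scale s b + scale t c + scale u d + scale v e)"
  unfolding span_insert[of a] by (simp add: span_quad diff_eq_eq ac_simps)

lemma (in vector_space) independent_pairD:
  assumes "independent {v, w}" "v \<noteq> w" "scale r v + scale s w = 0"
  shows "r = 0 \<and> s = 0"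
proof -
  have *: "r = 0" if "independent {v, w}" "v \<noteq> w" "scale r v + scale s w = 0" for v w r s
  proof (rule ccontr)
    assume "r \<noteq> 0"
    have "scale r v = scale (- s) w"
      using that(3) by (simp add: eq_neg_iff_add_eq_0)
    then have "scale (inverse r) (scale r v) = scale (inverse r) (scale (-s) w)" by simp
    then have "v = scale (inverse r * - s) w" using \<open>r \<noteq> 0\<close> by simp
    then have "v \<in> span {w}" by (metis span_scale span_base singletonI)
    then have "v \<in> span ({v, w} - {v})" using \<open>v \<noteq> w\<close> by (simp add: insert_Diff_if)
    then show False using that(1) by (auto simp: dependent_def)
  qed
  show ?thesis using *[OF assms] *[of w v s r] assms by (auto simp: insert_commute add.commute)
qed

lemma (in vector_space) independent_tripleD:
  assumes "independent {u, v, w}" "v \<noteq> w" "u \<noteq> v" "u \<noteq> w" "scale q u + scale r v + scale s w = 0"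
  shows "q = 0 \<and> r = 0 \<and> s = 0"
proof -
  have "q = 0"
  proof (rule ccontr)
    assume "q \<noteq> 0"
    have "scale q u = - (scale r v + scale s w)"
      using assms(5) by (metis add.assoc add_eq_0_iff2)
    then have "scale q u = scale (-r) v + scale (-s) w" by simp
    then have "scale (inverse q) (scale q u) \<in> span {v, w}"
      using span_scale span_pair by metis
    then have "u \<in> span ({u, v, w} - {u})" using \<open>q \<noteq> 0\<close> assms by (simp add: insert_Diff_if)
    then show False using assms(1) by (auto simp: dependent_def)
  qed
  moreover have "independent {v, w}" using assms(1) independent_mono by blast
  ultimately show ?thesis using independent_pairD[of v w r s] assms by simp
qed

text \<open>
  Ambient spaces may have infinite dimension, so dimension counts are made with spanning sets of
  the subspace at hand.
\<close>

lemma (in vector_space) independent_extend_card: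
  assumes "S \<subseteq> span T" "finite T" "A \<subseteq> S" "independent A"
  obtains B where "A \<subseteq> B" "B \<subseteq> S" "independent B" "S \<subseteq> span B" "finite B" "card B \<le> card T"
proof -
  obtain B where B: "A \<subseteq> B" "B \<subseteq> S" "independent B" "S \<subseteq> span B"
    using maximal_independent_subset_extend[OF assms(3,4)] by blast
  then have "finite B \<and> card B \<le> card T" using independent_span_bound[OF assms(2)] assms(1) by blast
  then show ?thesis using that B by blast
qed

lemma (in vector_space) span_if_independent_card:
  assumes "S \<subseteq> span T" "A \<subseteq> S" "independent A" "finite T" "card T \<le> card A"
  shows "S \<subseteq> span A"
proof -
  obtain B where B: "A \<subseteq> B" "B \<subseteq> S" "independent B" "S \<subseteq> span B" "finite B" "card B \<le> card T"
    using independent_extend_card assms by metis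
  then have "A = B" using assms(5) by (metis card_seteq le_trans)
  then show ?thesis using B by blast
qed

lemma subset_singleton_if_card_le_1:
  assumes "finite B" "B \<subseteq> S" "card B \<le> 1" "c \<in> S"
  shows "\<exists>d\<in>S. B \<subseteq> {d}"
proof (cases "B = {}")
  case False
  then obtain d where "B = {d}" using assms by (metis card_1_singletonE card_gt_0_iff le_antisym Suc_leI One_nat_def)
  then show ?thesis using assms by blast
qed (use assms in blast)

lemma (in vector_space) span_pair_extend:
  assumes "S \<subseteq> span {x, y}" "c \<in> S" "c \<noteq> 0"
  obtains d where "d \<in> S" "S \<subseteq> span {c, d}"
proof -
  have "{c} \<subseteq> S" "independent {c}" using assms(2,3) by auto
  then obtain B where B: "{c} \<subseteq> B" "B \<subseteq> S" "independent B" "S \<subseteq> span B" "finite B" "card B \<le> card {x, y}"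
    using independent_extend_card[OF assms(1)] by (metis finite.insertI finite.emptyI)
  have "card {x, y} \<le> 2" by (simp add: card_insert_if)
  then have "card (B - {c}) \<le> 1" using B by (simp add: card_Diff_singleton)
  then obtain d where "d \<in> S" "B - {c} \<subseteq> {d}"
    using subset_singleton_if_card_le_1[of "B - {c}" S c] B assms(2) by blast
  then have "B \<subseteq> {c, d}" by blast
  then show ?thesis using that \<open>d \<in> S\<close> B(4) span_mono by blast
qed

lemma (in vector_space) span_triple_extend:
  assumes "S \<subseteq> span {x, y, z}" "c \<in> S" "c \<noteq> 0"
  obtains d e where "d \<in> S" "e \<in> S" "S \<subseteq> span {c, d, e}"
proof -
  have "{c} \<subseteq> S" "independent {c}" using assms(2,3) by auto
  then obtain B where B: "{c} \<subseteq> B" "B \<subseteq> S" "independent B" "S \<subseteq> span B" "finite B" "card B \<le> card {x, y, z}"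
    using independent_extend_card[OF assms(1)] by (metis finite.insertI finite.emptyI)
  have "card {x, y, z} \<le> 3" by (simp add: card_insert_if)
  then have le2: "card (B - {c}) \<le> 2" using B by (simp add: card_Diff_singleton)
  have "\<exists>d\<in>S. \<exists>e\<in>S. B - {c} \<subseteq> {d, e}"
  proof (cases "B - {c} = {}")
    case True then show ?thesis using assms(2) by blast
  next
    case False
    then obtain d where d: "d \<in> B - {c}" by blast
    then have "card (B - {c} - {d}) \<le> 1" using le2 B(5) by (simp add: card_Diff_singleton)
    then have "\<exists>e\<in>S. B - {c} - {d} \<subseteq> {e}"
      using subset_singleton_if_card_le_1[of "B - {c} - {d}" S c] B assms(2) by blast
    then show ?thesis using d B by blast
  qed
  then obtain d e where de: "d \<in> S" "e \<in> S" "B \<subseteq> {c, d, e}" by blast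
  then show ?thesis using that[OF de(1,2)] B(4) span_mono[OF de(3)] by blast
qed

lemma (in vector_space) independent_if_spanning_card:
  assumes B: "independent B" "B \<subseteq> span S" and S: "finite S" "card S \<le> card B"
  shows "independent S \<and> card S = card B"
proof -
  obtain S' where S': "S' \<subseteq> S" "independent S'" "S \<subseteq> span S'"
    using maximal_independent_subset by blast
  have "B \<subseteq> span S'" using B(2) span_minimal[OF S'(3) subspace_span] by blast
  moreover have fS': "finite S'" using S'(1) S(1) finite_subset by blast
  ultimately have "card B \<le> card S'" using independent_span_bound[OF fS' B(1)] by blast
  then have "S' = S" using card_seteq[OF S(1) S'(1)] S(2) by linarith
  then show ?thesis using S'(2) \<open>card B \<le> card S'\<close> S(2) by simp
qed

lemma (in vector_space) independent_triple_cardD: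
  assumes "independent {u, v, w}" "card {u, v, w} = 3" "scale q u + scale r v + scale s w = 0"
  shows "q = 0 \<and> r = 0 \<and> s = 0"
proof -
  have "u \<noteq> v" "u \<noteq> w" "v \<noteq> w" using assms(2) by (auto simp: card_insert_if split: if_splits)
  then show ?thesis using independent_tripleD assms(1,3) by blast
qed

section \<open>Lie algebras in characteristic 2\<close>

text \<open>
  The rewrite rules of this locale replace subtraction by addition and cancel equal summands;
  together with the laws of associativity and commutativity they decide polynomial identities
  modulo 2.  The parameter serves only to fix the field.
\<close>

locale char2_field =
  fixes field_type :: "'k::field itself"
  assumes char_two: "(1::'k) + 1 = 0"
begin

lemma field_double [simp]: "(a::'k) + a = 0"
  by (metis distrib_left mult.right_neutral mult_zero_right char_two)

lemma field_double_assoc [simp]: "(a::'k) + (a + b) = b"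
  by (metis add.assoc add_0 field_double)

lemma field_minus [simp]: "- (a::'k) = a"
  by (metis field_double add_eq_0_iff)

lemma field_diff [simp]: "(a::'k) - b = a + b"
  by (metis field_minus diff_conv_add_uminus)

lemma field_add_eq_0: "(a::'k) + b = 0 \<longleftrightarrow> a = b"
  by (metis field_double add_left_cancel)

end

locale lie_char2 = lie_algebra L + char2_field "TYPE('k)"
  for L :: "('k::field, 'v::ab_group_add) lie_data"
begin

abbreviation bracket :: "'v \<Rightarrow> 'v \<Rightarrow> 'v" (infixl "\<bullet>" 70) where
  "x \<bullet> y \<equiv> brk L x y"

abbreviation scaled :: "'k \<Rightarrow> 'v \<Rightarrow> 'v" (infixr "*s" 75) where
  "c *s x \<equiv> smul L c x"

abbreviation V :: "'v set" where "V \<equiv> carr L"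

lemma double [simp]: "(x::'v) + x = 0"
proof -
  have "x + x = (1 + 1) *s x" by (simp only: scale_left_distrib scale_one)
  then show ?thesis by (simp only: char_two scale_zero_left)
qed

lemma double_assoc [simp]: "(x::'v) + (x + y) = y"
  by (metis add.assoc add_0 double)

lemma minus_self [simp]: "- (x::'v) = x"
  by (metis double add_eq_0_iff)

lemma diff_eq_add [simp]: "(x::'v) - y = x + y"
  by (metis minus_self diff_conv_add_uminus)

lemma add_eq_0: "(x::'v) + y = 0 \<longleftrightarrow> x = y"
  by (metis double add_left_cancel)

lemma zero_in [simp]: "0 \<in> V" using subspace_carr subspace_0 by blast
lemma add_in [simp]: "x \<in> V \<Longrightarrow> y \<in> V \<Longrightarrow> x + y \<in> V" using subspace_carr subspace_add by blast
lemma scale_in [simp]: "x \<in> V \<Longrightarrow> c *s x \<in> V" using subspace_carr subspace_scale by blast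

declare brk_closed [simp] brk_add_left [simp] brk_add_right [simp] brk_smul_left [simp] brk_smul_right [simp] brk_self [simp]

lemma brk_0_left [simp]: "x \<in> V \<Longrightarrow> 0 \<bullet> x = 0"
  by (metis brk_smul_left scale_zero_left)

lemma brk_0_right [simp]: "x \<in> V \<Longrightarrow> x \<bullet> 0 = 0"
  by (metis brk_smul_right scale_zero_left)

lemma brk_comm: 
  assumes "x \<in> V" "y \<in> V" shows "x \<bullet> y = y \<bullet> x"
proof -
  have "0 = (x + y) \<bullet> (x + y)" using assms by (simp del: brk_add_left brk_add_right)
  also have "\<dots> = (x \<bullet> x + y \<bullet> x) + (x \<bullet> y + y \<bullet> y)" using assms by (simp del: brk_self)
  also have "\<dots> = x \<bullet> y + y \<bullet> x" using assms by (simp add: add.commute)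
  finally show ?thesis using add_eq_0 by metis
qed

lemma jacobi_left:
  assumes "x \<in> V" "y \<in> V" "z \<in> V"
  shows "(x \<bullet> y) \<bullet> z = x \<bullet> (y \<bullet> z) + y \<bullet> (x \<bullet> z)"
proof -
  have "x \<bullet> (y \<bullet> z) + y \<bullet> (x \<bullet> z) + (x \<bullet> y) \<bullet> z = 0"
    using jacobi[OF assms] assms by (simp add: brk_comm[of z x] brk_comm[of z "x \<bullet> y"])
  then show ?thesis by (simp add: add_eq_0)
qed

lemma jacobi_right:
  assumes "x \<in> V" "y \<in> V" "z \<in> V"
  shows "x \<bullet> (y \<bullet> z) = (x \<bullet> y) \<bullet> z + y \<bullet> (x \<bullet> z)"
  using assms by (simp add: jacobi_left)

definition perfect :: bool where
  "perfect \<longleftrightarrow> V \<subseteq> span {x \<bullet> y |x y. x \<in> V \<and> y \<in> V}"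

text \<open>
  Perfectness is used through this principle: to place the whole algebra in a subspace, it is
  enough to look at brackets.
\<close>

lemma perfect_induct:
  assumes "perfect" "subspace U" "\<And>x y. x \<in> V \<Longrightarrow> y \<in> V \<Longrightarrow> x \<bullet> y \<in> U"
  shows "V \<subseteq> U"
proof -
  have "span {x \<bullet> y |x y. x \<in> V \<and> y \<in> V} \<subseteq> U"
    using assms by (intro span_minimal) auto
  then show ?thesis using assms(1) perfect_def by blast
qed

end

section \<open>Gradings of perfect algebras\<close>

text \<open>
  The eigenspaces \<open>V0\<close> and \<open>V1\<close> of an idempotent derivation form a grading by \<open>Z/2\<close>.  In a perfect
  algebra the grading forces \<open>V0 = [V0, V0] + [V1, V1]\<close> and \<open>V1 = [V0, V1]\<close>, which is how
  \<open>V0_subset\<close> and \<open>V1_subset\<close> below are to be read.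
\<close>

locale toral_derivation = lie_char2 L for L :: "('k::field, 'v::ab_group_add) lie_data" +
  fixes E :: "'v \<Rightarrow> 'v"
  assumes perfect: perfect
    and E_in [simp]: "x \<in> V \<Longrightarrow> E x \<in> V"
    and E_add [simp]: "x \<in> V \<Longrightarrow> y \<in> V \<Longrightarrow> E (x + y) = E x + E y"
    and E_scale [simp]: "x \<in> V \<Longrightarrow> E (c *s x) = c *s E x"
    and E_der: "x \<in> V \<Longrightarrow> y \<in> V \<Longrightarrow> E (x \<bullet> y) = E x \<bullet> y + x \<bullet> E y"
    and E_idem [simp]: "x \<in> V \<Longrightarrow> E (E x) = E x"
begin

definition V0 :: "'v set" where "V0 = {x \<in> V. E x = 0}"
definition V1 :: "'v set" where "V1 = {x \<in> V. E x = x}"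

lemma E_zero [simp]: "E 0 = 0"
  by (metis E_scale scale_zero_left zero_in)

lemma subspace_V1: "subspace V1" by (auto simp: subspace_def V1_def)

lemma V0_V1_brk:
  "x \<in> V0 \<Longrightarrow> y \<in> V0 \<Longrightarrow> x \<bullet> y \<in> V0"
  "x \<in> V0 \<Longrightarrow> y \<in> V1 \<Longrightarrow> x \<bullet> y \<in> V1"
  "x \<in> V1 \<Longrightarrow> y \<in> V0 \<Longrightarrow> x \<bullet> y \<in> V1"
  "x \<in> V1 \<Longrightarrow> y \<in> V1 \<Longrightarrow> x \<bullet> y \<in> V0"
  by (auto simp: V0_def V1_def E_der)

lemma V0_V: "x \<in> V0 \<Longrightarrow> x \<in> V" and V1_V: "x \<in> V1 \<Longrightarrow> x \<in> V" by (auto simp: V0_def V1_def)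

lemma V0_part: "x \<in> V \<Longrightarrow> x + E x \<in> V0" and V1_part: "x \<in> V \<Longrightarrow> E x \<in> V1"
  by (auto simp: V0_def V1_def)

lemma V0_subset:
  assumes U: "subspace U"
    and 00: "\<And>x y. x \<in> V0 \<Longrightarrow> y \<in> V0 \<Longrightarrow> x \<bullet> y \<in> U"
    and 11: "\<And>x y. x \<in> V1 \<Longrightarrow> y \<in> V1 \<Longrightarrow> x \<bullet> y \<in> U"
  shows "V0 \<subseteq> U"
proof -
  have "V \<subseteq> {z \<in> V. z + E z \<in> U}"
  proof (rule perfect_induct[OF perfect])
    have "0 + E 0 \<in> U" using subspace_0[OF U] by simp
    moreover have "x + y + (E x + E y) \<in> U" if "x + E x \<in> U" "y + E y \<in> U" for x y
      using subspace_add[OF U that] by (simp add: algebra_simps)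
    moreover have "c *s x + c *s E x \<in> U" if "x + E x \<in> U" for c x
      using subspace_scale[OF U that, of c] by (simp add: scale_right_distrib)
    ultimately show "subspace {z \<in> V. z + E z \<in> U}"
      by (auto simp: subspace_def)
    show "x \<bullet> y \<in> {z \<in> V. z + E z \<in> U}" if "x \<in> V" "y \<in> V" for x y
    proof -
      have "(x + E x) \<bullet> (y + E y) + E x \<bullet> E y \<in> U"
        using that by (intro subspace_add[OF U] 00 11 V0_part V1_part)
      moreover have "(x + E x) \<bullet> (y + E y) + E x \<bullet> E y = x \<bullet> y + E (x \<bullet> y)"
        using that by (simp add: E_der algebra_simps)
      ultimately show ?thesis using that by (simp del: brk_add_left brk_add_right)
    qed
  qed
  then show ?thesis unfolding V0_def by fastforce
qed

lemma V1_subset: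
  assumes U: "subspace U"
    and 01: "\<And>x y. x \<in> V0 \<Longrightarrow> y \<in> V1 \<Longrightarrow> x \<bullet> y \<in> U"
  shows "V1 \<subseteq> U"
proof -
  have "V \<subseteq> {z \<in> V. E z \<in> U}"
  proof (rule perfect_induct[OF perfect])
    show "subspace {z \<in> V. E z \<in> U}"
      using U by (auto simp: subspace_def)
    show "x \<bullet> y \<in> {z \<in> V. E z \<in> U}" if "x \<in> V" "y \<in> V" for x y
    proof -
      have "(x + E x) \<bullet> E y + (y + E y) \<bullet> E x \<in> U"
        using that by (intro subspace_add[OF U] 01 V0_part V1_part)
      moreover have "(x + E x) \<bullet> E y + (y + E y) \<bullet> E x = E (x \<bullet> y)"
        using that by (simp add: E_der brk_comm[of y "E x"] brk_comm[of "E y" "E x"] algebra_simps)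
      ultimately show ?thesis using that by simp
    qed
  qed
  then show ?thesis unfolding V1_def by fastforce
qed

text \<open>
  If \<open>V1 = k u\<close>, then \<open>[V1, V1] = 0\<close>, so \<open>V0\<close> is perfect and acts on \<open>k u\<close> through commuting
  scalars, that is, by zero.  But \<open>V1 = [V0, V1]\<close>.
\<close>

lemma V1_dim_1: 
  assumes "V1 \<subseteq> span {u}" "u \<in> V1"
  shows "V1 \<subseteq> {0}"
proof (rule V1_subset)
  have u: "u \<in> V" using assms V1_V by blast
  have mult: "\<exists>c. x = c *s u" if "x \<in> V1" for x using assms that by (auto simp: span_singleton)
  have "V0 \<subseteq> {x \<in> V. x \<bullet> u = 0}"
  proof (rule V0_subset)
    show "subspace {x \<in> V. x \<bullet> u = 0}" using u by (auto simp: subspace_def)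
    fix x y
    show "x \<bullet> y \<in> {x \<in> V. x \<bullet> u = 0}" if xy: "x \<in> V0" "y \<in> V0"
    proof -
      obtain c d where "x \<bullet> u = c *s u" "y \<bullet> u = d *s u"
        using mult xy assms V0_V1_brk by meson
      then show ?thesis using u V0_V xy by (simp add: jacobi_left mult.commute)
    qed
    show "x \<bullet> y \<in> {x \<in> V. x \<bullet> u = 0}" if xy: "x \<in> V1" "y \<in> V1"
      using mult[OF xy(1)] mult[OF xy(2)] u by auto
  qed
  then show "x \<bullet> y \<in> {0}" if "x \<in> V0" "y \<in> V1" for x y
    using mult[OF that(2)] that u V0_V by auto
qed (simp add: subspace_0)

text \<open>
  If \<open>[V1, V1] = 0\<close>, then \<open>V0\<close> is perfect, and it acts on \<open>V1\<close> through \<open>gl(2)\<close>.  In characteristic 2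
  the algebra \<open>gl(2)\<close> is solvable: commutators have trace 0, commutators of matrices of trace 0 are
  scalar, and commutators of scalars vanish.  Hence \<open>V0\<close> acts by zero.
\<close>

lemma V1_dim_2_abelian:
  assumes gen: "V1 \<subseteq> span {v, w}" and ind: "v \<noteq> w" "independent {v, w}" 
    and vw: "v \<in> V1" "w \<in> V1" and ab: "v \<bullet> w = 0"
  shows "V1 \<subseteq> {0}"
proof (rule V1_subset)
  have [simp]: "v \<in> V" "w \<in> V" using vw V1_V by auto
  have comb: "\<exists>r s. x = r *s v + s *s w" if "x \<in> V1" for x using gen that by (auto simp: span_pair)
  have [simp]: "r *s v + s *s w = r' *s v + s' *s w \<longleftrightarrow> r = r' \<and> s = s'" for r s r' s'
  proof
    assume "r *s v + s *s w = r' *s v + s' *s w"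
    then have "r *s v + s *s w + (r' *s v + s' *s w) = 0" by (simp add: add_eq_0)
    then have "(r + r') *s v + (s + s') *s w = 0" by (simp add: scale_left_distrib ac_simps)
    then show "r = r' \<and> s = s'" using independent_pairD[OF ind(2,1)] field_add_eq_0 by metis
  qed auto
  have 11: "x \<bullet> y = 0" if "x \<in> V1" "y \<in> V1" for x y
    using comb[OF that(1)] comb[OF that(2)] ab brk_comm[of w v] by auto
  \<comment> \<open>\<open>M x \<alpha> \<beta> \<gamma> \<delta>\<close> records the matrix by which \<open>x\<close> acts on the basis \<open>v, w\<close>.\<close>
  define M where "M x \<alpha> \<beta> \<gamma> \<delta> \<longleftrightarrow> x \<in> V \<and> x \<bullet> v = \<alpha> *s v + \<beta> *s w \<and> x \<bullet> w = \<gamma> *s v + \<delta> *s w" for x \<alpha> \<beta> \<gamma> \<delta>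
  have M_add: "M (x + y) (\<alpha>+\<alpha>') (\<beta>+\<beta>') (\<gamma>+\<gamma>') (\<delta>+\<delta>')"
    if "M x \<alpha> \<beta> \<gamma> \<delta>" "M y \<alpha>' \<beta>' \<gamma>' \<delta>'" for x y \<alpha> \<beta> \<gamma> \<delta> \<alpha>' \<beta>' \<gamma>' \<delta>'
    using that unfolding M_def by (auto simp: scale_left_distrib algebra_simps)
  have M_sc: "M (c *s x) (c*\<alpha>) (c*\<beta>) (c*\<gamma>) (c*\<delta>)"
    if "M x \<alpha> \<beta> \<gamma> \<delta>" for x c \<alpha> \<beta> \<gamma> \<delta>
    using that unfolding M_def by (auto simp: scale_right_distrib)
  have M_0: "M 0 0 0 0 0" unfolding M_def by simp
  have M_ex: "\<exists>\<alpha> \<beta> \<gamma> \<delta>. M x \<alpha> \<beta> \<gamma> \<delta>" if "x \<in> V0" for x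
    using comb[of "x \<bullet> v"] comb[of "x \<bullet> w"] that vw V0_V V0_V1_brk unfolding M_def by meson
  have M_brk: "M (x \<bullet> y) (\<beta>*\<gamma>' + \<gamma>*\<beta>') (\<alpha>*\<beta>' + \<beta>*\<delta>' + \<alpha>'*\<beta> + \<beta>'*\<delta>) (\<gamma>*\<alpha>' + \<delta>*\<gamma>' + \<gamma>'*\<alpha> + \<delta>'*\<gamma>) (\<beta>*\<gamma>' + \<gamma>*\<beta>')"
    if "M x \<alpha> \<beta> \<gamma> \<delta>" "M y \<alpha>' \<beta>' \<gamma>' \<delta>'" for x y \<alpha> \<beta> \<gamma> \<delta> \<alpha>' \<beta>' \<gamma>' \<delta>'
    using that unfolding M_def by (simp add: jacobi_left scale_right_distrib scale_left_distrib algebra_simps)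
  have M_V: "M x \<alpha> \<beta> \<gamma> \<delta> \<Longrightarrow> x \<in> V" for x \<alpha> \<beta> \<gamma> \<delta> unfolding M_def by simp
  have s1: "V0 \<subseteq> {x. \<exists>\<alpha> \<beta> \<gamma>. M x \<alpha> \<beta> \<gamma> \<alpha>}"
  proof (rule V0_subset)
    show "subspace {x. \<exists>\<alpha> \<beta> \<gamma>. M x \<alpha> \<beta> \<gamma> \<alpha>}" unfolding subspace_def using M_0 M_sc M_add by blast
    fix x y
    show "x \<bullet> y \<in> {x. \<exists>\<alpha> \<beta> \<gamma>. M x \<alpha> \<beta> \<gamma> \<alpha>}" if xy: "x \<in> V0" "y \<in> V0"
    proof -
      obtain \<alpha> \<beta> \<gamma> \<delta> \<alpha>' \<beta>' \<gamma>' \<delta>' where "M x \<alpha> \<beta> \<gamma> \<delta>" "M y \<alpha>' \<beta>' \<gamma>' \<delta>'"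
        using M_ex xy by meson
      from M_brk[OF this] show ?thesis by blast
    qed
    show "x \<in> V1 \<Longrightarrow> y \<in> V1 \<Longrightarrow> x \<bullet> y \<in> {x. \<exists>\<alpha> \<beta> \<gamma>. M x \<alpha> \<beta> \<gamma> \<alpha>}" using 11 M_0 by force
  qed
  have s2: "V0 \<subseteq> {x. \<exists>\<alpha>. M x \<alpha> 0 0 \<alpha>}"
  proof (rule V0_subset)
    show "subspace {x. \<exists>\<alpha>. M x \<alpha> 0 0 \<alpha>}" unfolding subspace_def using M_0 M_sc[of _ _ 0 0] M_add[of _ _ 0 0 _ _ _ 0 0] by fastforce
    fix x y
    show "x \<bullet> y \<in> {x. \<exists>\<alpha>. M x \<alpha> 0 0 \<alpha>}" if xy: "x \<in> V0" "y \<in> V0"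
    proof -
      obtain \<alpha> \<beta> \<gamma> \<alpha>' \<beta>' \<gamma>' where "M x \<alpha> \<beta> \<gamma> \<alpha>" "M y \<alpha>' \<beta>' \<gamma>' \<alpha>'" using s1 xy by blast
      from M_brk[OF this] have "M (x \<bullet> y) (\<beta>*\<gamma>' + \<gamma>*\<beta>') 0 0 (\<beta>*\<gamma>' + \<gamma>*\<beta>')" by (simp add: algebra_simps)
      then show ?thesis by blast
    qed
    show "x \<in> V1 \<Longrightarrow> y \<in> V1 \<Longrightarrow> x \<bullet> y \<in> {x. \<exists>\<alpha>. M x \<alpha> 0 0 \<alpha>}" using 11 M_0 by force
  qed
  have s3: "V0 \<subseteq> {x. M x 0 0 0 0}"
  proof (rule V0_subset)
    show "subspace {x. M x 0 0 0 0}" unfolding subspace_def using M_0 M_sc[of _ 0 0 0 0] M_add[of _ 0 0 0 0 _ 0 0 0 0] by simp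
    fix x y
    show "x \<bullet> y \<in> {x. M x 0 0 0 0}" if xy: "x \<in> V0" "y \<in> V0"
    proof -
      obtain \<alpha> \<alpha>' where "M x \<alpha> 0 0 \<alpha>" "M y \<alpha>' 0 0 \<alpha>'" using s2 xy by blast
      from M_brk[OF this] show ?thesis by simp
    qed
    show "x \<in> V1 \<Longrightarrow> y \<in> V1 \<Longrightarrow> x \<bullet> y \<in> {x. M x 0 0 0 0}" using 11 M_0 by force
  qed
  show "x \<bullet> y \<in> {0}" if "x \<in> V0" "y \<in> V1" for x y
  proof -
    have "M x 0 0 0 0" using s3 that by blast
    then show ?thesis using comb[OF that(2)] unfolding M_def by auto
  qed
qed (simp add: subspace_0)

text \<open>
  The element \<open>[v, w]\<close> spans \<open>[V1, V1]\<close>, which is an ideal of \<open>V0\<close>.  If \<open>V0\<close> is spanned by \<open>[v, w]\<close>,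
  \<open>x\<close> and \<open>y\<close>, then all brackets lie in the span of \<open>[v, w]\<close> and \<open>[x, y]\<close>, hence so does \<open>V0\<close>; applying
  this once more with \<open>[x, y]\<close> in the place of both \<open>x\<close> and \<open>y\<close> leaves the line through \<open>[v, w]\<close>.
\<close>

lemma V1_dim_2:
  assumes gen: "V1 \<subseteq> span {v, w}" and vw: "v \<in> V1" "w \<in> V1"
    and xy: "V0 \<subseteq> span {v \<bullet> w, x, y}" "x \<in> V0" "y \<in> V0"
  shows "V0 \<subseteq> span {v \<bullet> w}"
proof -
  have [simp]: "v \<in> V" "w \<in> V" using vw V1_V by auto
  define a where "a = v \<bullet> w"
  have a0: "a \<in> V0" using V0_V1_brk vw a_def by blast
  have [simp]: "a \<in> V" using a0 V0_V by auto
  have comb: "\<exists>r s. x = r *s v + s *s w" if "x \<in> V1" for x using gen that by (auto simp: span_pair)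
  have wv: "w \<bullet> v = a" using brk_comm a_def by simp
  have 11: "x \<bullet> y \<in> span {a}" if xy1: "x \<in> V1" "y \<in> V1" for x y
  proof -
    obtain r s r' s' where xy: "x = r *s v + s *s w" "y = r' *s v + s' *s w" using comb xy1 by meson
    have "x \<bullet> y = (r' * s) *s a + (s' * r) *s a" 
      unfolding xy using wv a_def[symmetric] by simp
    then show ?thesis by (simp add: span_add span_scale span_base)
  qed
  have xa: "x \<bullet> a \<in> span {a}" if "x \<in> V0" for x
  proof -
    have "x \<bullet> a = (x \<bullet> v) \<bullet> w + v \<bullet> (x \<bullet> w)"
      unfolding a_def using that V0_V by (simp add: jacobi_left)
    then show ?thesis using 11 vw that V0_V1_brk by (simp add: span_add)
  qed
  have reduce: "V0 \<subseteq> span {a, x \<bullet> y}" if V0: "V0 \<subseteq> span {a, x, y}" and "x \<in> V0" "y \<in> V0" for x y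
  proof (rule V0_subset)
    have xyV: "x \<in> V" "y \<in> V" using that V0_V by auto
    have xa': "x \<bullet> a \<in> span {a, x \<bullet> y}" "y \<bullet> a \<in> span {a, x \<bullet> y}" "a \<bullet> x \<in> span {a, x \<bullet> y}" "a \<bullet> y \<in> span {a, x \<bullet> y}"
      using xa[of x] xa[of y] that span_mono[of "{a}" "{a, x \<bullet> y}"] brk_comm[of a x] brk_comm[of a y] xyV by auto
    have "x \<bullet> y \<in> span {a, x \<bullet> y}" "y \<bullet> x \<in> span {a, x \<bullet> y}"
      using brk_comm[of y x] xyV by (auto intro: span_base)
    note gens = this xa'
    fix z z'
    show "z \<bullet> z' \<in> span {a, x \<bullet> y}" if zz0: "z \<in> V0" "z' \<in> V0"
    proof -
      obtain r s t r' s' t' where "z = r *s a + s *s x + t *s y" "z' = r' *s a + s' *s x + t' *s y"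
        using subsetD[OF V0 zz0(1)] subsetD[OF V0 zz0(2)] unfolding span_triple by blast
      then show ?thesis using xyV gens by (auto intro!: span_add span_scale span_zero)
    qed
    show "z \<bullet> z' \<in> span {a, x \<bullet> y}" if "z \<in> V1" "z' \<in> V1"
      using 11 that span_mono[of "{a}" "{a, x \<bullet> y}"] by auto
  qed simp
  have "V0 \<subseteq> span {a, x \<bullet> y}" using reduce xy unfolding a_def by blast
  moreover have "x \<bullet> y \<in> V0" using xy V0_V1_brk by blast
  ultimately have "V0 \<subseteq> span {a, (x \<bullet> y) \<bullet> (x \<bullet> y)}" by (intro reduce) auto
  moreover have "span {a, (x \<bullet> y) \<bullet> (x \<bullet> y)} = span {a}"
    using xy V0_V by (simp add: insert_commute[of a 0])
  ultimately show ?thesis unfolding a_def by simp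
qed

text \<open>
  If \<open>V0\<close> is a line, it is spanned by some \<open>k = [u, v]\<close>, and by the Jacobi identity
  \<open>[k, w] = [u, [v, w]] + [v, [u, w]]\<close> is a combination of \<open>[k, u]\<close> and \<open>[k, v]\<close> for all \<open>w\<close> in \<open>V1\<close>.
  As \<open>V1 = [k, V1]\<close>, its dimension is at most 2.
\<close>

lemma V0_dim_1:
  assumes "V0 \<subseteq> span {h}"
  obtains p q where "V1 \<subseteq> span {p, q}" "p \<in> V1" "q \<in> V1"
proof (cases "\<exists>u\<in>V1. \<exists>v\<in>V1. u \<bullet> v \<noteq> 0")
  case True
  then obtain u v where uv: "u \<in> V1" "v \<in> V1" "u \<bullet> v \<noteq> 0" by blast
  define k where "k = u \<bullet> v"
  have [simp]: "u \<in> V" "v \<in> V" using uv V1_V by auto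
  have k0: "k \<in> V0" using V0_V1_brk uv k_def by simp
  have [simp]: "k \<in> V" using k0 V0_V by auto
  have mult: "\<exists>c. x = c *s k" if x: "x \<in> V0" for x
  proof -
    obtain c d where "k = c *s h" "x = d *s h" using assms x k0 unfolding span_singleton by blast
    moreover have "c \<noteq> 0" using \<open>k = c *s h\<close> uv(3) k_def by auto
    ultimately have "x = (d / c) *s k" by simp
    then show ?thesis by blast
  qed
  let ?U = "span {k \<bullet> u, k \<bullet> v}"
  have kw: "k \<bullet> w \<in> ?U" if w: "w \<in> V1" for w
  proof -
    have [simp]: "w \<in> V" using w V1_V by auto
    obtain c d where cd: "v \<bullet> w = c *s k" "u \<bullet> w = d *s k" using mult V0_V1_brk(4) uv w by meson
    have "k \<bullet> w = u \<bullet> (v \<bullet> w) + v \<bullet> (u \<bullet> w)" unfolding k_def by (simp add: jacobi_left)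
    also have "\<dots> = c *s (k \<bullet> u) + d *s (k \<bullet> v)" using cd by (simp add: brk_comm[of _ k])
    finally show ?thesis by (auto simp: span_pair)
  qed
  have "V1 \<subseteq> ?U"
  proof (rule V1_subset)
    show "x \<bullet> y \<in> ?U" if "x \<in> V0" "y \<in> V1" for x y
      using mult[OF that(1)] kw[OF that(2)] that V1_V by (auto intro: span_scale)
  qed simp
  then show ?thesis using that V0_V1_brk k0 uv by blast
next
  case False
  have "V0 \<subseteq> {0}"
  proof (rule V0_subset)
    show "x \<bullet> y \<in> {0}" if xy: "x \<in> V0" "y \<in> V0" for x y
    proof -
      obtain c d where cd: "x = c *s h" "y = d *s h" using assms xy unfolding span_singleton by blast
      show ?thesis
      proof (cases "c = 0")
        case True then show ?thesis using cd xy V0_V by simp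
      next
        case False
        then have "y = (d/c) *s x" using cd by simp
        then show ?thesis using xy V0_V by simp
      qed
    qed
    show "x \<bullet> y \<in> {0}" if "x \<in> V1" "y \<in> V1" for x y using that False by auto
  qed (simp add: subspace_0)
  then have "V1 \<subseteq> {0}"
    by (intro V1_subset) (auto simp: subspace_0 V1_V)
  then have "V1 \<subseteq> span {0,0}" by simp
  then show ?thesis using that[of 0 0] subspace_0 subspace_V1 by blast
qed

text \<open>
  Let \<open>a = [u, v]\<close>, \<open>b = [u, w]\<close>, and let \<open>\<gamma> x\<close> be the \<open>u\<close>-coordinate of \<open>[x, u]\<close> for \<open>x\<close> in \<open>V0\<close>.
  Since \<open>[x, [v, w]] = 0\<close>, the span of \<open>v, w\<close> is stable under \<open>V0\<close>, so it remains to show that \<open>\<gamma>\<close>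
  vanishes.  Now \<open>[a, b] = (\<gamma> a) b + [u, [a, w]]\<close> and \<open>[b, a] = (\<gamma> b) a + [u, [b, v]]\<close>, where
  \<open>[a, w] = [b, v]\<close> by the Jacobi identity for \<open>u, v, w\<close>.  Hence \<open>(\<gamma> a) b = (\<gamma> b) a\<close>, and \<open>a, b\<close> are
  independent.
\<close>

lemma V1_dim_3_commuting:
  assumes gen: "V1 \<subseteq> span {u, v, w}" and u: "u \<in> V1" and v: "v \<in> V1" and w: "w \<in> V1"
    and vw0: "v \<bullet> w = 0"
    and ab: "independent {u \<bullet> v, u \<bullet> w}" "u \<bullet> v \<noteq> u \<bullet> w" and V0: "V0 \<subseteq> span {u \<bullet> v, u \<bullet> w}"
  shows "V1 \<subseteq> span {v, w}"
proof -
  define a where "a = u \<bullet> v"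
  define b where "b = u \<bullet> w"
  have [simp]: "u \<in> V" "v \<in> V" "w \<in> V" using u v w V1_V by auto
  have a0: "a \<in> V0" and b0: "b \<in> V0" using V0_V1_brk u v w a_def b_def by auto
  have [simp]: "a \<in> V" "b \<in> V" using a0 b0 V0_V by auto
  have uniq: "r *s a + s *s b = 0 \<Longrightarrow> r = 0 \<and> s = 0" for r s
    using independent_pairD[OF ab] a_def b_def by blast
  have comb: "\<exists>q r s. x = q *s u + r *s v + s *s w" if "x \<in> V1" for x
    using gen that span_triple by blast
  have table: "u \<bullet> v = a" "v \<bullet> u = a" "u \<bullet> w = b" "w \<bullet> u = b" "v \<bullet> w = 0" "w \<bullet> v = 0"
    using vw0 brk_comm[of v u] brk_comm[of w u] brk_comm[of w v] unfolding a_def b_def by auto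
  have act: "\<exists>\<gamma> t. t \<in> span {v, w} \<and> x \<bullet> u = \<gamma> *s u + t \<and> x \<bullet> v \<in> span {v, w} \<and> x \<bullet> w \<in> span {v, w}
      \<and> x \<bullet> a = \<gamma> *s a + u \<bullet> (x \<bullet> v) \<and> x \<bullet> b = \<gamma> *s b + u \<bullet> (x \<bullet> w)"
    if x: "x \<in> V0" for x
  proof -
    have [simp]: "x \<in> V" using x V0_V by auto
    obtain \<gamma> \<rho> \<sigma> where xu: "x \<bullet> u = \<gamma> *s u + \<rho> *s v + \<sigma> *s w" using comb V0_V1_brk x u by meson
    obtain \<kappa> \<alpha> \<beta> where xv: "x \<bullet> v = \<kappa> *s u + \<alpha> *s v + \<beta> *s w" using comb V0_V1_brk x v by meson
    obtain \<kappa>' \<alpha>' \<beta>' where xw: "x \<bullet> w = \<kappa>' *s u + \<alpha>' *s v + \<beta>' *s w" using comb V0_V1_brk x w by meson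
    have "x \<bullet> (v \<bullet> w) = (x \<bullet> v) \<bullet> w + v \<bullet> (x \<bullet> w)" by (simp add: jacobi_left)
    then have "\<kappa>' *s a + \<kappa> *s b = 0" by (simp add: xv xw table add.commute)
    then have "\<kappa> = 0" "\<kappa>' = 0" using uniq by blast+
    then have "x \<bullet> v \<in> span {v, w}" "x \<bullet> w \<in> span {v, w}" unfolding span_pair using xv xw by auto
    moreover have "(x \<bullet> u) \<bullet> v = \<gamma> *s a" "(x \<bullet> u) \<bullet> w = \<gamma> *s b" by (simp_all add: xu table)
    moreover have "x \<bullet> a = (x \<bullet> u) \<bullet> v + u \<bullet> (x \<bullet> v)" "x \<bullet> b = (x \<bullet> u) \<bullet> w + u \<bullet> (x \<bullet> w)"
      unfolding a_def b_def by (rule jacobi_right; simp)+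
    ultimately have "x \<bullet> v \<in> span {v, w}" "x \<bullet> w \<in> span {v, w}"
      "x \<bullet> a = \<gamma> *s a + u \<bullet> (x \<bullet> v)" "x \<bullet> b = \<gamma> *s b + u \<bullet> (x \<bullet> w)" by simp_all
    moreover have "\<rho> *s v + \<sigma> *s w \<in> span {v, w}" unfolding span_pair by blast
    ultimately show ?thesis
      by (intro exI[of _ \<gamma>] exI[of _ "\<rho> *s v + \<sigma> *s w"]) (simp add: xu add.assoc)
  qed
  obtain \<gamma> t where A: "t \<in> span {v, w}" "a \<bullet> u = \<gamma> *s u + t" "a \<bullet> v \<in> span {v, w}"
    "a \<bullet> w \<in> span {v, w}" "a \<bullet> b = \<gamma> *s b + u \<bullet> (a \<bullet> w)" using act[OF a0] by blast
  obtain \<gamma>' t' where B: "t' \<in> span {v, w}" "b \<bullet> u = \<gamma>' *s u + t'" "b \<bullet> v \<in> span {v, w}"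
    "b \<bullet> w \<in> span {v, w}" "b \<bullet> a = \<gamma>' *s a + u \<bullet> (b \<bullet> v)" using act[OF b0] by blast
  have "a \<bullet> w = b \<bullet> v"
    using jacobi_left[of u v w] vw0
    by (simp add: table flip: a_def b_def) (simp add: brk_comm[of v b])
  then have "\<gamma>' *s a + \<gamma> *s b = a \<bullet> b + b \<bullet> a" unfolding A B by (simp add: ac_simps)
  then have g: "\<gamma> = 0" "\<gamma>' = 0" using uniq[of \<gamma>' \<gamma>] brk_comm[of a b] by simp_all
  show ?thesis
  proof (rule V1_subset)
    fix x y assume xy: "x \<in> V0" "y \<in> V1"
    obtain r s where x: "x = r *s a + s *s b" using V0 xy span_pair a_def b_def by blast
    obtain q r' s' where y: "y = q *s u + r' *s v + s' *s w" using comb xy by meson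
    have "a \<bullet> u \<in> span {v, w}" "b \<bullet> u \<in> span {v, w}" using A B g by simp_all
    then show "x \<bullet> y \<in> span {v, w}"
      unfolding x y using A(3,4) B(3,4) by (simp add: span_add span_scale)
  qed simp
qed

text \<open>
  Let the basis vectors have brackets \<open>A = [q, r]\<close>, \<open>B = [r, p]\<close>, \<open>C = [p, q]\<close>.  If two of them are
  independent, say \<open>B\<close> and \<open>C\<close>, they span \<open>V0\<close>, and \<open>A = s C + t B\<close> gives the commuting elements
  \<open>q + t p\<close> and \<open>r + s p\<close>, to which the previous lemma applies.  Otherwise \<open>[V1, V1]\<close> is at most a
  line, and an ideal of the at most two-dimensional algebra \<open>V0\<close>; then \<open>V0 = [V0, V0] + [V1, V1]\<close> is
  at most a line as well.
\<close>

lemma V1_dim_3: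
  assumes gen: "V1 \<subseteq> span {p, q, r}" and pqr: "p \<in> V1" "q \<in> V1" "r \<in> V1" and V0: "V0 \<subseteq> span {x, y}"
  shows "(\<exists>v w. V1 \<subseteq> span {v, w}) \<or> (\<exists>c. V0 \<subseteq> span {c})"
proof -
  have good: "\<exists>v w. V1 \<subseteq> span {v, w}"
    if gen: "V1 \<subseteq> span {p, q, r}" and pqr: "p \<in> V1" "q \<in> V1" "r \<in> V1"
      and ind: "p \<bullet> q \<notin> span {p \<bullet> r}" "p \<bullet> r \<noteq> 0" for p q r
  proof -
    have [simp]: "p \<in> V" "q \<in> V" "r \<in> V" using pqr V1_V by auto
    have ind': "independent {p \<bullet> q, p \<bullet> r}" "p \<bullet> q \<noteq> p \<bullet> r"
      using ind independent_insertI[of "p \<bullet> q" "{p \<bullet> r}"] by (auto simp: span_base)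
    then have V0': "V0 \<subseteq> span {p \<bullet> q, p \<bullet> r}"
      using span_if_independent_card[OF V0, of "{p \<bullet> q, p \<bullet> r}"] V0_V1_brk pqr by (simp add: card_insert_if)
    then obtain s t where st: "q \<bullet> r = s *s (p \<bullet> q) + t *s (p \<bullet> r)"
      using V0_V1_brk(4)[OF pqr(2,3)] span_pair by blast
    define v w where "v = q + t *s p" and "w = r + s *s p"
    have "v \<bullet> w = 0"
      unfolding v_def w_def using st by (simp add: brk_comm[of q p] ac_simps)
    moreover have "v \<in> V1" "w \<in> V1"
      unfolding v_def w_def using pqr subspace_V1 by (auto intro: subspace_add subspace_scale)
    moreover have "p \<bullet> v = p \<bullet> q" "p \<bullet> w = p \<bullet> r" unfolding v_def w_def by simp_all
    moreover have "V1 \<subseteq> span {p, v, w}"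
    proof -
      have "p \<in> span {p, v, w}" "v + t *s p \<in> span {p, v, w}" "w + s *s p \<in> span {p, v, w}"
        by (auto intro!: span_add span_scale intro: span_base)
      then have "{p, q, r} \<subseteq> span {p, v, w}" unfolding v_def w_def by (simp add: add.assoc)
      then show ?thesis using gen span_minimal[of "{p, q, r}" "span {p, v, w}"] by blast
    qed
    ultimately have "V1 \<subseteq> span {v, w}"
      using V1_dim_3_commuting[of p v w] pqr ind' V0' by simp
    then show ?thesis by blast
  qed
  have [simp]: "p \<in> V" "q \<in> V" "r \<in> V" using pqr V1_V by auto
  define A B C where "A = q \<bullet> r" and "B = r \<bullet> p" and "C = p \<bullet> q"
  have table: "q \<bullet> r = A" "r \<bullet> q = A" "r \<bullet> p = B" "p \<bullet> r = B" "p \<bullet> q = C" "q \<bullet> p = C"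
    unfolding A_def B_def C_def by (auto intro: brk_comm)
  have perm: "{q, r, p} = {p, q, r}" "{r, p, q} = {p, q, r}" by auto
  show ?thesis
  proof (cases "(C \<notin> span {B} \<and> B \<noteq> 0) \<or> (A \<notin> span {C} \<and> C \<noteq> 0) \<or> (B \<notin> span {A} \<and> A \<noteq> 0)")
    case True
    then show ?thesis
      using good[OF gen pqr] good[of q r p] good[of r p q] gen pqr unfolding perm table by blast
  next
    case False
    have "\<exists>c\<in>{A, B, C}. {A, B, C} \<subseteq> span {c}"
    proof (cases "B = 0")
      case True
      show ?thesis
      proof (cases "C = 0")
        case True then show ?thesis using \<open>B = 0\<close> by (intro bexI[of _ A]) (simp_all add: span_base span_zero)
      next
        case C0: False
        then have "A \<in> span {C}" using False by blast
        then show ?thesis using \<open>B = 0\<close> by (intro bexI[of _ C]) (simp_all add: span_base span_zero)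
      qed
    next
      case B0: False
      then have C: "C \<in> span {B}" using False by blast
      have "A \<in> span {B}"
      proof (cases "A = 0")
        case A0: False
        then have "B \<in> span {A}" using False by blast
        then obtain k where "B = k *s A" unfolding span_singleton by blast
        then have "A = inverse k *s B" using B0 by auto
        then show ?thesis using span_scale[OF span_base[of B "{B}"]] by simp
      qed (simp add: span_zero)
      then show ?thesis using C by (intro bexI[of _ B]) (simp_all add: span_base)
    qed
    then obtain c where c: "c \<in> {A, B, C}" "{A, B, C} \<subseteq> span {c}" by blast
    have 11: "x \<bullet> y \<in> span {c}" if xy1: "x \<in> V1" "y \<in> V1" for x y
    proof -
      have "x \<in> span {p, q, r}" "y \<in> span {p, q, r}" using gen xy1 by blast+
      then obtain a1 a2 a3 b1 b2 b3 where xy: "x = a1 *s p + a2 *s q + a3 *s r" "y = b1 *s p + b2 *s q + b3 *s r"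
        unfolding span_triple by blast
      show ?thesis unfolding xy using c(2) by (simp add: table span_add span_scale)
    qed
    have c0: "c \<in> V0" using c(1) V0_V1_brk pqr unfolding A_def B_def C_def by auto
    have zc: "z \<bullet> c \<in> span {c}" if z: "z \<in> V0" for z
    proof -
      obtain g g' where g: "g \<in> V1" "g' \<in> V1" "c = g \<bullet> g'" using c(1) pqr unfolding A_def B_def C_def by blast
      have "z \<bullet> c = (z \<bullet> g) \<bullet> g' + g \<bullet> (z \<bullet> g')"
        unfolding g(3) using g z V0_V V1_V by (simp add: jacobi_left)
      also have "\<dots> \<in> span {c}" by (intro span_add 11 V0_V1_brk(2) g z)
      finally show ?thesis .
    qed
    have line: "V0 \<subseteq> span {e}"
      if xy0: "x \<in> V0" "y \<in> V0" "V0 \<subseteq> span {x, y}" "x \<bullet> y \<in> span {e}" "c \<in> span {e}" for x y e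
    proof (rule V0_subset)
      have xyV: "x \<in> V" "y \<in> V" "y \<bullet> x = x \<bullet> y" using xy0 V0_V brk_comm by auto
      show "z \<bullet> z' \<in> span {e}" if zz0: "z \<in> V0" "z' \<in> V0" for z z'
      proof -
        obtain r s r' s' where zz: "z = r *s x + s *s y" "z' = r' *s x + s' *s y"
          using zz0 xy0(3) span_pair by blast
        show ?thesis unfolding zz using xyV xy0 by (auto intro!: span_add span_scale span_zero)
      qed
      show "z \<bullet> z' \<in> span {e}" if "z \<in> V1" "z' \<in> V1" for z z'
        using 11[OF that] span_minimal[of "{c}" "span {e}"] xy0(5) by auto
    qed simp
    consider "V0 \<subseteq> {0}" | x' where "c = 0" "x' \<in> V0" "x' \<noteq> 0" | "c \<noteq> 0" by blast
    then have "\<exists>c. V0 \<subseteq> span {c}"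
    proof cases
      case 1 then show ?thesis by (auto intro!: exI[of _ 0])
    next
      case 2
      obtain y' where "y' \<in> V0" "V0 \<subseteq> span {x', y'}" by (rule span_pair_extend[OF V0 2(2,3)])
      then show ?thesis using line[of x' y' "x' \<bullet> y'"] 2 by (auto simp: span_zero intro: span_base)
    next
      case 3
      then obtain d where d: "d \<in> V0" "V0 \<subseteq> span {c, d}" using span_pair_extend[OF V0 c0] by blast
      moreover have "c \<bullet> d \<in> span {c}" using zc[OF d(1)] brk_comm[of c d] d c0 V0_V by simp
      ultimately show ?thesis using line[of c d c] c0 by (auto intro: span_base)
    qed
    then show ?thesis by blast
  qed
qed

lemma span_homogeneous:
  assumes "x \<in> span (S0 \<union> S1)" "S0 \<subseteq> V0" "S1 \<subseteq> V1"
  shows "x + E x \<in> span S0 \<and> E x \<in> span S1"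
proof -
  have "x \<in> V \<and> x + E x \<in> span S0 \<and> E x \<in> span S1" using assms(1)
  proof (induction rule: span_induct_alt)
    case base then show ?case by (simp add: span_zero)
  next
    case (step c x y)
    have x: "x \<in> V \<and> x + E x \<in> span S0 \<and> E x \<in> span S1"
      using step(1) assms(2,3) span_base[of x S0] span_base[of x S1] by (auto simp: V0_def V1_def span_zero)
    have "c *s (x + E x) + (y + E y) \<in> span S0" "c *s E x + E y \<in> span S1"
      using x step by (auto intro: span_add span_scale)
    then show ?case using x step by (simp add: scale_right_distrib ac_simps)
  qed
  then show ?thesis by blast
qed

text \<open>
  Bases of the homogeneous parts combine to a basis of the whole algebra.
\<close>

lemma dim_V0_V1:
  assumes B: "independent B" "V \<subseteq> span B" "B \<subseteq> V" "finite B"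
  obtains B0 B1 where "B0 \<subseteq> V0" "independent B0" "V0 \<subseteq> span B0" "finite B0"
    "B1 \<subseteq> V1" "independent B1" "V1 \<subseteq> span B1" "finite B1" "card B0 + card B1 = card B"
proof -
  have V01: "V0 \<subseteq> span B" "V1 \<subseteq> span B" using B V0_V V1_V by blast+
  obtain B0 where B0: "B0 \<subseteq> V0" "independent B0" "V0 \<subseteq> span B0" "finite B0"
    by (rule independent_extend_card[OF V01(1) B(4) empty_subsetI independent_empty])
  obtain B1 where B1: "B1 \<subseteq> V1" "independent B1" "V1 \<subseteq> span B1" "finite B1"
    by (rule independent_extend_card[OF V01(2) B(4) empty_subsetI independent_empty])
  have "independent (B0 \<union> B1)"
  proof
    assume "dependent (B0 \<union> B1)"
    then obtain a where a: "a \<in> B0 \<union> B1" "a \<in> span ((B0 \<union> B1) - {a})" unfolding dependent_def by blast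
    then have "a \<in> span ((B0 - {a}) \<union> (B1 - {a}))" by (simp add: Un_Diff)
    then have "a + E a \<in> span (B0 - {a}) \<and> E a \<in> span (B1 - {a})"
      by (rule span_homogeneous) (use B0 B1 in auto)
    then show False using a(1) B0 B1 unfolding dependent_def V0_def V1_def by auto
  qed
  moreover have disj: "B0 \<inter> B1 = {}"
  proof (rule ccontr)
    assume "B0 \<inter> B1 \<noteq> {}"
    then obtain a where "a \<in> B0" "a \<in> B1" by blast
    then have "a \<in> V0" "a \<in> V1" using B0(1) B1(1) by auto
    then have "a = 0" unfolding V0_def V1_def by simp
    then show False using \<open>a \<in> B0\<close> B0(2) dependent_zero by blast
  qed
  moreover have "V \<subseteq> span (B0 \<union> B1)"
  proof
    fix x assume x: "x \<in> V"
    have "x + E x \<in> span (B0 \<union> B1)" "E x \<in> span (B0 \<union> B1)"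
      using V0_part[OF x] V1_part[OF x] B0(3) B1(3) span_mono[of B0 "B0 \<union> B1"] span_mono[of B1 "B0 \<union> B1"] by blast+
    then have "(x + E x) + E x \<in> span (B0 \<union> B1)" by (rule span_add)
    then show "x \<in> span (B0 \<union> B1)" by (simp add: add.assoc)
  qed
  moreover have "B0 \<union> B1 \<subseteq> span B" using B0 B1 V01 by blast
  ultimately have "card (B0 \<union> B1) \<le> card B" "card B \<le> card (B0 \<union> B1)"
    using independent_span_bound[OF B(4), of "B0 \<union> B1"] independent_span_bound[of "B0 \<union> B1" B] B0 B1 B by auto
  then have "card B0 + card B1 = card B" using disj B0(4) B1(4) by (simp add: card_Un_disjoint)
  then show ?thesis using that B0 B1 by blast
qed

text \<open>
  With \<open>(d0, d1)\<close> the dimensions of \<open>V0\<close> and \<open>V1\<close>, the preceding lemmas exclude \<open>d1 = 1\<close>, then \<open>d1 = 2\<close>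
  (with \<open>d0\<close> equal to 2 or 3), then \<open>d0 = 1\<close> (with \<open>d1 \<ge> 3\<close>), and finally \<open>(2, 3)\<close>.
\<close>

theorem no_toral_derivation:
  assumes B: "independent B" "V \<subseteq> span B" "B \<subseteq> V" "card B = 4 \<or> card B = 5" and nz: "x \<in> V" "E x \<noteq> 0"
  shows False
proof -
  have fB: "finite B" using B(4) card.infinite by fastforce
  from dim_V0_V1[OF B(1-3) fB] obtain B0 B1 where
    B0: "B0 \<subseteq> V0" "independent B0" "V0 \<subseteq> span B0" "finite B0" and
    B1: "B1 \<subseteq> V1" "independent B1" "V1 \<subseteq> span B1" "finite B1" and
    card: "card B0 + card B1 = card B" .
  have V1: "\<not> V1 \<subseteq> {0}" using V1_part[OF nz(1)] nz(2) by blast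
  have dim0: "card B0 \<le> card S" if "V0 \<subseteq> span S" "finite S" for S
    using independent_span_bound[OF that(2) B0(2)] that B0(1) by blast
  have dim1: "card B1 \<le> card S" if "V1 \<subseteq> span S" "finite S" for S
    using independent_span_bound[OF that(2) B1(2)] that B1(1) by blast
  have d1: "card B1 \<le> 2" if V0h: "V0 \<subseteq> span {h}" for h
  proof -
    obtain p q where "V1 \<subseteq> span {p, q}" using V0_dim_1[OF V0h] by metis
    then have "card B1 \<le> card {p, q}" by (rule dim1) simp
    also have "\<dots> \<le> 2" by (simp add: card_insert_if)
    finally show ?thesis .
  qed
  have c1: "card B1 \<noteq> 0" using B1 V1 by auto
  have c0: "card B0 \<noteq> 0" 
  proof
    assume "card B0 = 0"
    then have "V0 \<subseteq> span {0}" using B0 by (simp add: span_singleton)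
    moreover have "V0 \<subseteq> {0}" using \<open>card B0 = 0\<close> B0 by simp
    then have "V1 \<subseteq> {0}" by (intro V1_subset) (auto simp: subspace_0 V1_V)
    ultimately show False using V1 by blast
  qed
  have "card B1 \<noteq> 1"
  proof
    assume "card B1 = 1"
    then obtain u where "B1 = {u}" by (rule card_1_singletonE)
    then show False using V1_dim_1[of u] B1 V1 by blast
  qed
  moreover have "card B1 \<noteq> 2"
  proof
    assume "card B1 = 2"
    then obtain v w where vw: "B1 = {v, w}" "v \<noteq> w" unfolding card_2_iff by blast
    then have vw1: "v \<in> V1" "w \<in> V1" using B1 by auto
    have "2 \<le> card B0" "card B0 \<le> 3" using card \<open>card B1 = 2\<close> B by auto
    have "v \<bullet> w \<noteq> 0" using V1_dim_2_abelian[of v w] B1 vw vw1 V1 by auto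
    have "\<exists>x y z. B0 = {x, y, z}" using \<open>2 \<le> card B0\<close> \<open>card B0 \<le> 3\<close>
    proof -
      consider "card B0 = 2" | "card B0 = 3" using \<open>2 \<le> card B0\<close> \<open>card B0 \<le> 3\<close> by linarith
      then show ?thesis by cases (auto simp: card_2_iff card_3_iff)
    qed
    then obtain x y z where "V0 \<subseteq> span {x, y, z}" using B0 by blast
    then obtain d e where "d \<in> V0" "e \<in> V0" "V0 \<subseteq> span {v \<bullet> w, d, e}"
      by (rule span_triple_extend[OF _ V0_V1_brk(4)[OF vw1] \<open>v \<bullet> w \<noteq> 0\<close>])
    then have "V0 \<subseteq> span {v \<bullet> w}" using V1_dim_2[OF _ vw1] B1 vw by blast
    then have "card B0 \<le> card {v \<bullet> w}" by (rule dim0) simp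
    then show False using \<open>2 \<le> card B0\<close> by simp
  qed
  ultimately have c3: "card B1 \<ge> 3" using c1 by linarith
  have c0': "card B0 \<noteq> 1"
  proof
    assume "card B0 = 1"
    then obtain h where "B0 = {h}" by (rule card_1_singletonE)
    then show False using d1[of h] B0(3) c3 by auto
  qed
  then have "card B0 = 2" "card B1 = 3" using c0 c3 card B(4) by linarith+
  then obtain a b p q r where ab: "B0 = {a, b}" and pqr: "B1 = {p, q, r}"
    unfolding card_2_iff card_3_iff by blast
  have "(\<exists>v w. V1 \<subseteq> span {v, w}) \<or> (\<exists>c. V0 \<subseteq> span {c})"
    by (rule V1_dim_3[of p q r a b]) (use B0 B1 ab pqr in auto)
  then show False
  proof
    assume "\<exists>v w. V1 \<subseteq> span {v, w}"
    then obtain v w where "V1 \<subseteq> span {v, w}" by blast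
    then have "card B1 \<le> card {v, w}" by (rule dim1) simp
    also have "\<dots> \<le> 2" by (simp add: card_insert_if)
    finally show False using c3 by simp
  next
    assume "\<exists>c. V0 \<subseteq> span {c}"
    then show False using d1 c3 by fastforce
  qed
qed

end

section \<open>Engel's theorem and periodic derivations\<close>

context lie_char2
begin

definition act :: "'v set \<Rightarrow> 'v set \<Rightarrow> 'v set" where
  "act M U = span {m \<bullet> u |m u. m \<in> M \<and> u \<in> U}"

abbreviation act_series :: "'v set \<Rightarrow> nat \<Rightarrow> 'v set" where
  "act_series M i \<equiv> (act M ^^ i) V"

lemma act_least:
  assumes "subspace W" "\<And>m u. m \<in> M \<Longrightarrow> u \<in> U \<Longrightarrow> m \<bullet> u \<in> W"
  shows "act M U \<subseteq> W"
  unfolding act_def using assms by (intro span_minimal) auto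

lemma act_mem: "m \<in> M \<Longrightarrow> u \<in> U \<Longrightarrow> m \<bullet> u \<in> act M U"
  unfolding act_def by (auto intro: span_base)

lemma subspace_act: "subspace (act M U)"
  unfolding act_def by simp

lemma subspace_act_series: "subspace (act_series M i)"
  by (cases i) (auto simp: act_def subspace_carr)

lemma act_series_in: "M \<subseteq> V \<Longrightarrow> act_series M i \<subseteq> V"
proof (induction i)
  case (Suc i)
  then have "act M (act_series M i) \<subseteq> V" by (intro act_least[OF subspace_carr]) (blast intro: brk_closed)
  then show ?case by simp
qed simp

lemma act_series_decreasing: "M \<subseteq> V \<Longrightarrow> act_series M (Suc i) \<subseteq> act_series M i"
proof (induction i)
  case 0 then show ?case using act_series_in[of M 1] by simp
next
  case (Suc i)
  then show ?case
    using act_least[OF subspace_act_series[of "Suc i" M], of M "act_series M (Suc i)"] act_mem[of _ M _ "act_series M i"]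
    by auto
qed

text \<open>
  All sufficiently long products \<open>ad m1 \<dots> ad mr\<close> with \<open>mi\<close> in \<open>M\<close> vanish; this is stronger than
  nilpotency of each \<open>ad m\<close>, and is the property that can be extended one dimension at a time.
\<close>

definition acts_nilpotently :: "'v set \<Rightarrow> bool" where
  "acts_nilpotently M \<longleftrightarrow> lie_subalgebra M L \<and> (\<exists>r. act_series M r \<subseteq> {0})"

text \<open>
  Since \<open>y\<close> normalises \<open>M\<close>, it preserves the terms \<open>V \<supseteq> [M, V] \<supseteq> [M, [M, V]] \<supseteq> \<dots>\<close>, and on the quotient of
  two consecutive terms \<open>M + k y\<close> acts through \<open>y\<close> alone.  So \<open>N\<close> steps of the series for \<open>M + k y\<close>
  lead at least one step down in the series for \<open>M\<close>.
\<close>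

lemma acts_nilpotently_extend:
  assumes M: "acts_nilpotently M" and y: "y \<in> V" "\<And>m. m \<in> M \<Longrightarrow> m \<bullet> y \<in> M"
    and nil: "\<And>v. v \<in> V \<Longrightarrow> (brk L y ^^ N) v = 0"
  shows "acts_nilpotently {m + c *s y |m c. m \<in> M}"
proof -
  let ?M = "{m + c *s y |m c. m \<in> M}"
  have MV: "M \<subseteq> V" and sM: "subspace M" and closed: "\<And>x y. x \<in> M \<Longrightarrow> y \<in> M \<Longrightarrow> x \<bullet> y \<in> M"
    using M unfolding acts_nilpotently_def lie_subalgebra_def by auto
  have "lie_subalgebra ?M L"
    unfolding lie_subalgebra_def
  proof (intro conjI ballI)
    show "?M \<subseteq> V" using MV y by auto
    show "subspace ?M"
    proof (rule subspaceI)
      show "0 \<in> ?M" using subspace_0[OF sM] by (intro CollectI exI[of _ 0]) simp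
      fix u v assume "u \<in> ?M" "v \<in> ?M"
      then obtain m c m' c' where "u = m + c *s y" "m \<in> M" "v = m' + c' *s y" "m' \<in> M" by blast
      then show "u + v \<in> ?M" using subspace_add[OF sM, of m m']
        by (intro CollectI exI[of _ "m + m'"] exI[of _ "c + c'"]) (simp add: scale_left_distrib ac_simps)
    next
      fix a u assume "u \<in> ?M"
      then obtain m c where "u = m + c *s y" "m \<in> M" by blast
      then show "a *s u \<in> ?M" using subspace_scale[OF sM, of m a]
        by (intro CollectI exI[of _ "a *s m"] exI[of _ "a * c"]) (simp add: scale_right_distrib)
    qed
    fix u v assume "u \<in> ?M" "v \<in> ?M"
    then obtain m c m' c' where uv: "u = m + c *s y" "m \<in> M" "v = m' + c' *s y" "m' \<in> M" by blast
    have [simp]: "m \<in> V" "m' \<in> V" using uv MV by auto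
    have "u \<bullet> v = m \<bullet> m' + c' *s (m \<bullet> y) + c *s (m' \<bullet> y)"
      unfolding uv using y by (simp add: brk_comm[of y m'] ac_simps)
    then have "u \<bullet> v \<in> M" using closed y(2) uv by (simp add: subspace_add[OF sM] subspace_scale[OF sM])
    then show "u \<bullet> v \<in> ?M" by (intro CollectI exI[of _ "u \<bullet> v"] exI[of _ 0]) simp
  qed
  moreover 
  have M'V: "?M \<subseteq> V" using MV y by auto
  note inV = act_series_in[OF MV, THEN subsetD]
  have stable: "y \<bullet> v \<in> act_series M i" if "v \<in> act_series M i" for i v
    using that
  proof (induction i arbitrary: v)
    case 0 then show ?case using y by simp
  next
    case (Suc i)
    have "act M (act_series M i) \<subseteq> {v \<in> V. y \<bullet> v \<in> act_series M (Suc i)}"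
    proof (rule act_least)
      show "subspace {v \<in> V. y \<bullet> v \<in> act_series M (Suc i)}"
        using subspace_act_series[of "Suc i" M] y by (auto simp: subspace_def)
      fix m u assume mu: "m \<in> M" "u \<in> act_series M i"
      have [simp]: "m \<in> V" "u \<in> V" using mu MV inV by auto
      have "y \<bullet> (m \<bullet> u) = (m \<bullet> y) \<bullet> u + m \<bullet> (y \<bullet> u)"
        using y by (simp add: jacobi_right[of y m u] brk_comm[of y m])
      also have "\<dots> \<in> act_series M (Suc i)"
        using mu y Suc.IH by (simp add: act_mem span_add act_def[symmetric] subspace_add[OF subspace_act])
      finally show "m \<bullet> u \<in> {v \<in> V. y \<bullet> v \<in> act_series M (Suc i)}" by simp
    qed
    then show ?case using Suc.prems by auto
  qed
  have stable_pow: "(brk L y ^^ s) v \<in> act_series M i" if "v \<in> act_series M i" for i s v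
    using that stable by (induction s) auto
  \<comment> \<open>\<open>W i s\<close> contains what is left of the \<open>i\<close>-th term of the series for \<open>M\<close> after \<open>s\<close> steps of the series for \<open>M + k y\<close>.\<close>
  define W where "W i s = {(brk L y ^^ s) a + b |a b. a \<in> act_series M i \<and> b \<in> act_series M (Suc i)}" for i s
  have pow_in: "(brk L y ^^ s) a \<in> V" if "a \<in> V" for a s using that y by (induction s) auto
  have pow_add: "(brk L y ^^ s) (a + b) = (brk L y ^^ s) a + (brk L y ^^ s) b" if "a \<in> V" "b \<in> V" for a b s
    using that y pow_in by (induction s) auto
  have pow_sc: "(brk L y ^^ s) (c *s a) = c *s (brk L y ^^ s) a" if "a \<in> V" for a c s
    using that y pow_in by (induction s) auto
  have pow_0: "(brk L y ^^ s) 0 = 0" for s using y by (induction s) auto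
  have sub_W: "subspace (W i s)" for i s
  proof (rule subspaceI)
    show "0 \<in> W i s" unfolding W_def using subspace_0[OF subspace_act_series] subspace_0[OF subspace_act] pow_0 
      by (intro CollectI exI[of _ 0]) simp
    fix u v assume "u \<in> W i s" "v \<in> W i s"
    then obtain a b a' b' where *: "u = (brk L y ^^ s) a + b" "v = (brk L y ^^ s) a' + b'"
      "a \<in> act_series M i" "b \<in> act_series M (Suc i)" "a' \<in> act_series M i" "b' \<in> act_series M (Suc i)"
      unfolding W_def by blast
    have "u + v = (brk L y ^^ s) (a + a') + (b + b')"
      using * inV pow_add by (simp add: ac_simps)
    then show "u + v \<in> W i s" unfolding W_def using * subspace_add[OF subspace_act_series] by blast
  next
    fix c u assume "u \<in> W i s"
    then obtain a b where *: "u = (brk L y ^^ s) a + b" "a \<in> act_series M i" "b \<in> act_series M (Suc i)"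
      unfolding W_def by blast
    have "c *s u = (brk L y ^^ s) (c *s a) + c *s b"
      using * inV pow_sc by (simp add: scale_right_distrib)
    then show "c *s u \<in> W i s" unfolding W_def using * subspace_scale[OF subspace_act_series] by blast
  qed
  have step: "act ?M (W i s) \<subseteq> W i (Suc s)" for i s
  proof (rule act_least[OF sub_W])
    fix x u assume "x \<in> ?M" "u \<in> W i s"
    then obtain m c a b where *: "x = m + c *s y" "m \<in> M" "u = (brk L y ^^ s) a + b"
      "a \<in> act_series M i" "b \<in> act_series M (Suc i)" unfolding W_def by blast
    define a' where "a' = (brk L y ^^ s) a"
    have a': "a' \<in> act_series M i" unfolding a'_def using stable_pow * by blast
    have b': "b \<in> act_series M i" using act_series_decreasing[OF MV] * by blast
    have [simp]: "a' \<in> V" "b \<in> V" "m \<in> V" "a \<in> V" using a' b' inV MV * by auto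
    have "x \<bullet> u = (y \<bullet> (c *s a')) + (m \<bullet> a' + m \<bullet> b + c *s (y \<bullet> b))"
      unfolding * a'_def[symmetric] using y by (simp add: ac_simps)
    also have "y \<bullet> (c *s a') = (brk L y ^^ Suc s) (c *s a)"
      unfolding a'_def using pow_sc by simp
    finally have "x \<bullet> u = (brk L y ^^ Suc s) (c *s a) + (m \<bullet> a' + m \<bullet> b + c *s (y \<bullet> b))" .
    moreover have "c *s a \<in> act_series M i" using * subspace_scale[OF subspace_act_series] by blast
    moreover have "m \<bullet> a' + m \<bullet> b + c *s (y \<bullet> b) \<in> act_series M (Suc i)"
      using * a' b' stable[of b "Suc i"]
      by (intro subspace_add[OF subspace_act_series] subspace_scale[OF subspace_act_series])
        (auto intro: act_mem)
    ultimately show "x \<bullet> u \<in> W i (Suc s)" unfolding W_def by blast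
  qed
  have act_mono: "act ?M U \<subseteq> act ?M U'" if "U \<subseteq> U'" for U U'
    unfolding act_def using that by (intro span_mono) blast
  have chain: "act_series ?M (k + s) \<subseteq> W i s" if "act_series ?M k \<subseteq> W i 0" for k i s
  proof (induction s)
    case 0 then show ?case using that by simp
  next
    case (Suc s)
    then show ?case using act_mono[OF Suc] step[of i s] by auto
  qed
  have "act_series ?M (i * N) \<subseteq> act_series M i" for i
  proof (induction i)
    case 0 then show ?case by simp
  next
    case (Suc i)
    have "act_series M i \<subseteq> W i 0"
    proof
      fix a assume "a \<in> act_series M i"
      then show "a \<in> W i 0" unfolding W_def using subspace_0[OF subspace_act_series, of "Suc i" M]
        by (intro CollectI exI[of _ a] exI[of _ 0]) simp
    qed
    then have "act_series ?M (i * N + N) \<subseteq> W i N" using chain Suc by blast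
    also have "W i N \<subseteq> act_series M (Suc i)" unfolding W_def using nil inV by auto
    finally show ?case by (simp add: add.commute)
  qed
  then have "\<exists>r. act_series ?M r \<subseteq> {0}" using M unfolding acts_nilpotently_def by blast
  ultimately show ?thesis unfolding acts_nilpotently_def by blast
qed

text \<open>
  Take a maximal subalgebra \<open>M\<close> that acts nilpotently.  It is proper because the algebra is perfect.
  The last term of the series \<open>V, [M, V], \<dots>\<close> that is not contained in \<open>M\<close> provides an element \<open>y\<close>
  outside \<open>M\<close> that normalises \<open>M\<close>.  If \<open>ad y\<close> were nilpotent, then \<open>M + k y\<close> would contradict the
  maximality of \<open>M\<close>.
\<close>

theorem engel_perfect:
  assumes fin: "finite V" and perfect: perfect and nz: "V \<noteq> {0}"
  obtains x where "x \<in> V" "\<And>r. \<exists>v\<in>V. (brk L x ^^ r) v \<noteq> 0"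
proof (rule ccontr)
  note found = that
  assume "\<not> thesis"
  then have nil: "\<exists>r. \<forall>v\<in>V. (brk L x ^^ r) v = 0" if "x \<in> V" for x using that found[of x] by metis
  have "acts_nilpotently {0}"
    unfolding acts_nilpotently_def lie_subalgebra_def
  proof (intro conjI exI[of _ 1])
    show "act_series {0} 1 \<subseteq> {0}" using act_least[of "{0}" "{0}" V] by (auto simp: subspace_0)
  qed (auto simp: subspace_0)
  moreover have "finite {M. acts_nilpotently M}"
    by (rule finite_subset[of _ "Pow V"]) (auto simp: fin acts_nilpotently_def lie_subalgebra_def)
  ultimately obtain M where M: "acts_nilpotently M" and max: "\<And>M'. acts_nilpotently M' \<Longrightarrow> M \<subseteq> M' \<Longrightarrow> M = M'"
    using finite_has_maximal[of "{M. acts_nilpotently M}"] by blast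
  have MV: "M \<subseteq> V" and sM: "subspace M" using M unfolding acts_nilpotently_def lie_subalgebra_def by auto
  have "\<not> V \<subseteq> M"
  proof
    assume "V \<subseteq> M"
    then have "M = V" using MV by blast
    have "V \<subseteq> act_series V i" for i
    proof (induction i)
      case (Suc i)
      show ?case
        using Suc by (intro perfect_induct[OF perfect subspace_act_series]) (auto intro: act_mem)
    qed simp
    then show False using M nz unfolding acts_nilpotently_def \<open>M = V\<close> by fastforce
  qed
  obtain r where r: "act_series M r \<subseteq> {0}" using M acts_nilpotently_def by blast
  have "\<exists>i. \<not> act_series M i \<subseteq> M \<and> act_series M (Suc i) \<subseteq> M"
  proof (rule ccontr)
    assume *: "\<nexists>i. \<not> act_series M i \<subseteq> M \<and> act_series M (Suc i) \<subseteq> M"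
    have "\<not> act_series M i \<subseteq> M" for i
    proof (induction i)
      case 0 then show ?case using \<open>\<not> V \<subseteq> M\<close> by simp
    next
      case (Suc i) then show ?case using * by blast
    qed
    then show False using r subspace_0[OF sM] by blast
  qed
  then obtain i y where y: "y \<in> act_series M i" "y \<notin> M" and i: "act_series M (Suc i) \<subseteq> M" by blast
  have yV: "y \<in> V" using y act_series_in[OF MV] by blast
  have ym: "m \<bullet> y \<in> M" if "m \<in> M" for m using i act_mem[OF that y(1)] by auto
  obtain N where N: "\<And>v. v \<in> V \<Longrightarrow> (brk L y ^^ N) v = 0" using nil[OF yV] by blast
  let ?M = "{m + c *s y |m c. m \<in> M}"
  have "acts_nilpotently ?M" by (rule acts_nilpotently_extend[OF M yV ym N])
  moreover have "M \<subseteq> ?M"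
  proof
    show "m \<in> ?M" if "m \<in> M" for m using that by (intro CollectI exI[of _ m] exI[of _ 0]) simp
  qed
  moreover have "y \<in> ?M" using subspace_0[OF sM] by (intro CollectI exI[of _ 0] exI[of _ 1]) simp
  ultimately show False using max y(2) by blast
qed

definition derivation :: "('v \<Rightarrow> 'v) \<Rightarrow> bool" where
  "derivation D \<longleftrightarrow> (\<forall>x\<in>V. D x \<in> V) \<and> (\<forall>x\<in>V. \<forall>y\<in>V. D (x + y) = D x + D y) \<and>
     (\<forall>c. \<forall>x\<in>V. D (c *s x) = c *s D x) \<and> (\<forall>x\<in>V. \<forall>y\<in>V. D (x \<bullet> y) = D x \<bullet> y + x \<bullet> D y)"

lemma derivation_brk: "x \<in> V \<Longrightarrow> derivation (brk L x)"
  unfolding derivation_def by (auto intro: jacobi_right)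

text \<open>
  Leibniz' rule for the second power: the mixed terms \<open>2 [D x, D y]\<close> vanish.
\<close>

lemma derivation_square: "derivation D \<Longrightarrow> derivation (D \<circ> D)"
  unfolding derivation_def by (simp add: ac_simps)

lemma derivation_power: "derivation D \<Longrightarrow> derivation (D ^^ (2 ^ i))"
proof (induction i)
  case (Suc i)
  have "D ^^ (2 ^ Suc i) = (D ^^ (2 ^ i)) \<circ> (D ^^ (2 ^ i))" by (simp add: mult_2 funpow_add)
  then show ?case using derivation_square[OF Suc.IH[OF Suc.prems]] by metis
qed simp

text \<open>
  Among the finitely many self-maps of a finite algebra the powers \<open>(ad x)^(2^i)\<close> repeat, and none of
  them is zero if \<open>ad x\<close> is not nilpotent.
\<close>

lemma exists_periodic_derivation:
  assumes fin: "finite V" and perfect: perfect and nz: "V \<noteq> {0}"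
  obtains T m x where "derivation T" "0 < m" "\<And>v. v \<in> V \<Longrightarrow> (T ^^ (2 ^ m)) v = T v" "x \<in> V" "T x \<noteq> 0"
proof -
  obtain x where x: "x \<in> V" "\<And>r. \<exists>v\<in>V. (brk L x ^^ r) v \<noteq> 0"
    using engel_perfect[OF assms] by blast
  define D where "D i = restrict (brk L x ^^ (2 ^ i)) V" for i :: nat
  note der = derivation_power[OF derivation_brk[OF x(1)]]
  have "range D \<subseteq> PiE V (\<lambda>_. V)"
    using der unfolding D_def derivation_def by (auto intro!: restrict_PiE_iff[THEN iffD2])
  then have "finite (range D)" using fin by (meson finite_PiE finite_subset)
  then have "\<not> inj D" using finite_imageD by fastforce
  then obtain i j where ij: "i < j" "D i = D j" unfolding inj_def by (metis linorder_neqE_nat)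
  define T where "T = brk L x ^^ (2 ^ i)"
  have "(T ^^ (2 ^ (j - i))) v = T v" if "v \<in> V" for v
  proof -
    have "T ^^ (2 ^ (j - i)) = brk L x ^^ (2 ^ j)"
      unfolding T_def funpow_mult using ij(1) by (simp flip: power_add)
    then show ?thesis using fun_cong[OF ij(2), of v] that unfolding D_def T_def by simp
  qed
  moreover obtain v where "v \<in> V" "T v \<noteq> 0" using x(2) unfolding T_def by blast
  ultimately show ?thesis using that[of T "j - i" v] der ij(1) unfolding T_def by simp
qed

end

section \<open>Base change to the algebraic closure\<close>

text \<open>
  The polynomial \<open>X^(2^m) - X\<close> has derivative \<open>-1\<close>, hence \<open>2^m\<close> different roots, too many for the
  nonzero polynomial \<open>\<Sum>j<m. \<tau> j X^(2^j)\<close> of degree less than \<open>2^m\<close>.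
\<close>

lemma exists_nonroot_fixed_by_frobenius:
  fixes \<tau> :: "nat \<Rightarrow> 'a::alg_closed_field"
  assumes char2: "(1::'a) + 1 = 0" and m: "0 < m" and nz: "\<tau> 0 \<noteq> 0"
  obtains c where "c ^ (2 ^ m) = c" "(\<Sum>j<m. c ^ (2 ^ j) * \<tau> j) \<noteq> 0"
proof -
  define P :: "'a poly" where "P = monom 1 (2 ^ m) + [:0, -1:]"
  have two: "(2::'a) = 0" using char2 by simp
  have "(1::nat) < 2 ^ m" by (rule one_less_power) (use m in simp_all)
  then have deg: "degree P = 2 ^ m"
    unfolding P_def by (subst degree_add_eq_left) (auto simp: degree_monom_eq)
  have eval: "poly P x = x ^ (2 ^ m) - x" for x unfolding P_def by (simp add: poly_monom)
  have "P \<noteq> 0" using deg by auto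
  then obtain A where A: "size A = degree P" "P = smult (lead_coeff P) (\<Prod>x\<in>#A. [:-x, 1:])"
    using alg_closed_imp_factorization by blast
  have "pderiv P = [:-1:]"
    unfolding P_def using m two by (simp add: pderiv_add pderiv_monom pderiv_pCons power_0_left)
  then have pd: "poly (pderiv P) x \<noteq> 0" for x by simp
  have "count A x \<le> 1" for x
  proof (rule ccontr)
    assume "\<not> count A x \<le> 1"
    then have "count A x \<ge> 2" by simp
    then have "{#x, x#} \<subseteq># A" by (auto simp: subseteq_mset_def)
    then obtain A' where "A = {#x, x#} + A'" using subset_mset.le_iff_add by blast
    then have "P = [:-x, 1:] * ([:-x, 1:] * smult (lead_coeff P) (\<Prod>x\<in>#A'. [:-x, 1:]))"
      using A(2) by (metis (no_types, lifting) add_mset_add_single image_mset_add_mset mult_smult_right prod_mset.add_mset union_mset_add_mset_left add_mset_commute empty_neutral(1))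
    then obtain q where q: "P = [:-x, 1:] * ([:-x, 1:] * q)" by blast
    have "poly (pderiv P) x = 0" unfolding q by (simp only: pderiv_mult poly_add poly_mult) simp
    then show False using pd by blast
  qed
  then have "mset_set (set_mset A) = A"
    by (intro multiset_eqI) (metis count_mset_set(1,3) finite_set_mset le_antisym not_in_iff Suc_leI count_greater_zero_iff One_nat_def)
  then have cardA: "card (set_mset A) = 2 ^ m" using A(1) deg by (metis size_mset_set)
  have rootA: "x ^ (2 ^ m) = x" if "x \<in># A" for x
  proof -
    have "poly P x = 0" 
      by (subst A(2)) (use that in \<open>simp add: poly_prod_mset prod_mset_zero_iff image_iff\<close>)
    then show ?thesis using eval by simp
  qed
  define p where "p = (\<Sum>j<m. monom (\<tau> j) (2 ^ j))"
  have "coeff p 1 = (\<Sum>j<m. if j = 0 then \<tau> j else 0)"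
    unfolding p_def by (auto simp: coeff_sum intro!: sum.cong)
  also have "\<dots> = \<tau> 0" using m by simp
  finally have "p \<noteq> 0" using nz by auto
  have "degree p < 2 ^ m"
    unfolding p_def
  proof (rule degree_sum_less)
    show "degree (monom (\<tau> j) (2 ^ j)) < 2 ^ m" if "j \<in> {..<m}" for j
      using that by (intro le_less_trans[OF degree_monom_le]) simp
  qed simp
  then have "card {x. poly p x = 0} < card (set_mset A)"
    using card_poly_roots_bound[OF \<open>p \<noteq> 0\<close>] cardA by linarith
  then have "\<not> set_mset A \<subseteq> {x. poly p x = 0}"
    using card_mono[OF poly_roots_finite[OF \<open>p \<noteq> 0\<close>]] by (meson not_less)
  then obtain c where "c \<in># A" "poly p c \<noteq> 0" by blast
  moreover have "poly p c = (\<Sum>j<m. c ^ (2 ^ j) * \<tau> j)"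
    unfolding p_def by (simp add: poly_sum poly_monom mult.commute)
  ultimately show ?thesis using that[of c] rootA[of c] by simp
qed

lemma sum_fun_apply: "(\<Sum>i\<in>A. F i) l = (\<Sum>i\<in>A. F i l)"
  by (induction A rule: infinite_finite_induct) auto

lemma inj_dp: "inj_on (dp :: nat \<Rightarrow> nat \<Rightarrow> 'a::field) A"
  by (rule inj_onI) (metis dp_def zero_neq_one)

lemma sum_symmetric_char2:
  fixes a :: "nat \<Rightarrow> nat \<Rightarrow> 'a::field"
  assumes "(1::'a) + 1 = 0" "\<And>i j. a i j = a j i"
  shows "(\<Sum>i<m. \<Sum>j<m. a i j) = (\<Sum>i<m. a i i)"
proof (induction m)
  case (Suc m)
  have two: "x + x = 0" for x :: 'a using assms(1) by (metis distrib_left mult.right_neutral mult_zero_right)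
  have "(\<Sum>i<Suc m. \<Sum>j<Suc m. a i j) = (\<Sum>i<m. \<Sum>j<m. a i j) + ((\<Sum>i<m. a i m) + (\<Sum>j<m. a m j)) + a m m"
    by (simp add: sum.distrib)
  also have "(\<Sum>i<m. a i m) + (\<Sum>j<m. a m j) = 0" using assms(2)[of m] two by simp
  finally show ?case using Suc by simp
qed simp

text \<open>
  The algebra obtained from \<open>L\<close> by extension of scalars to the algebraic closure is realised on
  coordinate functions with respect to a basis \<open>b\<close> of \<open>L\<close>: \<open>emb\<close> embeds \<open>L\<close>, \<open>dp i\<close> is the image of
  \<open>b i\<close>, and \<open>extK\<close> extends linear maps.
\<close>

locale base_change = lie_char2 L for L :: "('k::field, 'v::ab_group_add) lie_data" +
  fixes b :: "nat \<Rightarrow> 'v" and n :: nat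
  assumes inj_b: "inj_on b {..<n}"
    and indep_b: "independent (b ` {..<n})"
    and span_b: "span (b ` {..<n}) = V"
begin

text \<open>
  Coordinate functions are treated as vectors, so the simplifier must not pass to their values.
\<close>

declare zero_fun_apply [simp del] plus_fun_apply [simp del]

definition emb :: "'v \<Rightarrow> nat \<Rightarrow> 'k alg_closure" where
  "emb x = (\<lambda>i. if i < n then to_ac (representation (b ` {..<n}) x (b i)) else 0)"

definition extK :: "('v \<Rightarrow> 'v) \<Rightarrow> (nat \<Rightarrow> 'k alg_closure) \<Rightarrow> nat \<Rightarrow> 'k alg_closure" where
  "extK D f = (\<lambda>l. \<Sum>i<n. f i * emb (D (b i)) l)"

definition LK :: "('k alg_closure, nat \<Rightarrow> 'k alg_closure) lie_data" where
  "LK = \<lparr>carr = {f. \<forall>i\<ge>n. f i = 0}, smul = (\<lambda>c f i. c * f i),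
     brk = (\<lambda>f g l. \<Sum>i<n. \<Sum>j<n. f i * g j * emb (b i \<bullet> b j) l)\<rparr>"

lemma b_in [simp]: "i < n \<Longrightarrow> b i \<in> V"
  unfolding span_b[symmetric] by (rule span_base) simp

lemma emb_add: "x \<in> V \<Longrightarrow> y \<in> V \<Longrightarrow> emb (x + y) = emb x + emb y"
  unfolding emb_def plus_fun_def using representation_add[OF indep_b] span_b by auto

lemma emb_scale: "x \<in> V \<Longrightarrow> emb (c *s x) = smul LK (to_ac c) (emb x)"
  unfolding emb_def LK_def using representation_scale[OF indep_b] span_b by auto

lemma emb_0 [simp]: "emb 0 = 0"
  unfolding emb_def zero_fun_def by (auto simp: representation_zero)

lemma emb_b: "i < n \<Longrightarrow> emb (b i) = dp i"
  unfolding emb_def dp_def using representation_basis[OF indep_b] inj_b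
  by (auto simp: fun_eq_iff zero_fun_apply plus_fun_apply inj_on_def)

lemma expand_b: "x \<in> V \<Longrightarrow> (\<Sum>i<n. representation (b ` {..<n}) x (b i) *s b i) = x"
  using sum_representation_eq[OF indep_b, of x "b ` {..<n}"] span_b inj_b by (simp add: sum.reindex)

lemma emb_eq_0:
  assumes "x \<in> V" "emb x = 0" shows "x = 0"
proof -
  have "representation (b ` {..<n}) x (b i) = 0" if "i < n" for i
    using fun_cong[OF assms(2), of i] that by (simp add: emb_def zero_fun_apply)
  then show ?thesis using expand_b[OF assms(1)] by simp
qed

lemma span_V_induct [consumes 1, case_names zero step]:
  assumes "x \<in> V" "P 0" "\<And>c i y. i < n \<Longrightarrow> y \<in> V \<Longrightarrow> P y \<Longrightarrow> P (c *s b i + y)"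
  shows "P x"
proof -
  have "x \<in> span (b ` {..<n})" using assms(1) span_b by simp
  then have "x \<in> V \<and> P x"
    by (induction rule: span_induct_alt) (use assms(2,3) in auto)
  then show ?thesis by simp
qed

lemma vector_space_K: "vector_space (smul LK)"
  unfolding LK_def by unfold_locales (auto simp: algebra_simps fun_eq_iff zero_fun_apply plus_fun_apply)

interpretation K: vector_space "smul LK" by (rule vector_space_K)

lemma smul_LK: "smul LK c f = (\<lambda>i. c * f i)" by (simp add: LK_def)
lemma carr_LK: "carr LK = {f. \<forall>i\<ge>n. f i = 0}" by (simp add: LK_def)
lemma brk_LK: "brk LK f g = (\<lambda>l. \<Sum>i<n. \<Sum>j<n. f i * g j * emb (b i \<bullet> b j) l)" by (simp add: LK_def)

lemma emb_in: "emb x \<in> carr LK" by (simp add: emb_def carr_LK)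

lemma subspace_LK: "K.subspace (carr LK)" by (auto simp: K.subspace_def carr_LK smul_LK zero_fun_apply plus_fun_apply)

lemma LK_eq_span: "carr LK = K.span (dp ` {..<n})"
proof
  show "K.span (dp ` {..<n}) \<subseteq> carr LK"
    by (rule K.span_minimal[OF _ subspace_LK]) (auto simp: carr_LK dp_def)
  show "carr LK \<subseteq> K.span (dp ` {..<n})"
  proof
    fix f assume f: "f \<in> carr LK"
    have "f = (\<Sum>i<n. smul LK (f i) (dp i))"
    proof
      fix l
      have "(\<Sum>i<n. smul LK (f i) (dp i)) l = (\<Sum>i<n. if i = l then f l else 0)"
        unfolding sum_fun_apply by (intro sum.cong refl) (simp add: smul_LK dp_def)
      then show "f l = (\<Sum>i<n. smul LK (f i) (dp i)) l" using f by (auto simp: carr_LK)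
    qed
    also have "\<dots> \<in> K.span (dp ` {..<n})" by (intro K.span_sum K.span_scale K.span_base) auto
    finally show "f \<in> K.span (dp ` {..<n})" .
  qed
qed

lemma indep_K: "\<not> K.dependent (dp ` {..<n})"
proof (rule K.independent_if_scalars_zero)
  fix f :: "(nat \<Rightarrow> 'k alg_closure) \<Rightarrow> 'k alg_closure" and x :: "nat \<Rightarrow> 'k alg_closure"
  assume s: "(\<Sum>x\<in>dp ` {..<n}. smul LK (f x) x) = 0" and "x \<in> dp ` {..<n}"
  then obtain i where i: "x = dp i" "i < n" by blast
  have "(\<Sum>j<n. smul LK (f (dp j)) (dp j)) = 0" using s by (simp add: sum.reindex inj_dp)
  then have "(\<Sum>j<n. smul LK (f (dp j)) (dp j)) i = 0" by (simp add: zero_fun_apply)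
  also have "(\<Sum>j<n. smul LK (f (dp j)) (dp j)) i = (\<Sum>j<n. if j = i then f (dp i) else 0)"
    unfolding sum_fun_apply by (intro sum.cong refl) (simp add: smul_LK dp_def)
  finally show "f x = 0" using i by simp
qed simp

text \<open>
  Every vector of the extended algebra is a combination of vectors from \<open>L\<close>, so multilinear
  identities need only be checked there.
\<close>

lemma LK_induct [consumes 1, case_names zero step]:
  assumes "f \<in> carr LK" "P 0" "\<And>c x g. x \<in> V \<Longrightarrow> g \<in> carr LK \<Longrightarrow> P g \<Longrightarrow> P (smul LK c (emb x) + g)"
  shows "P f"
proof -
  have "f \<in> K.span (dp ` {..<n})" using assms(1) LK_eq_span by simp
  then have "f \<in> carr LK \<and> P f"
  proof (induction rule: K.span_induct_alt)
    case base then show ?case using assms(2) K.subspace_0[OF subspace_LK] by blast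
  next
    case (step c x y)
    then obtain i where "x = dp i" "i < n" by blast
    then have "x = emb (b i)" "i < n" using emb_b by simp_all
    then show ?case using step assms(3)[of "b i" y c] emb_in
      by (auto intro!: K.subspace_add[OF subspace_LK] K.subspace_scale[OF subspace_LK])
  qed
  then show ?thesis by simp
qed

lemma brk_K_add: "brk LK (f + g) h = brk LK f h + brk LK g h" "brk LK h (f + g) = brk LK h f + brk LK h g"
  by (auto simp: brk_LK fun_eq_iff zero_fun_apply plus_fun_apply algebra_simps sum.distrib)

lemma brk_K_scale: "brk LK (smul LK c f) g = smul LK c (brk LK f g)" "brk LK f (smul LK c g) = smul LK c (brk LK f g)"
  by (auto simp: brk_LK smul_LK fun_eq_iff zero_fun_apply plus_fun_apply sum_distrib_left ac_simps)

lemma brk_K_0: "brk LK 0 f = 0" "brk LK f 0 = 0"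
  by (auto simp: brk_LK fun_eq_iff zero_fun_apply plus_fun_apply)

lemma brk_K_comm: "brk LK f g = brk LK g f"
proof
  fix l
  have "brk LK f g l = (\<Sum>j<n. \<Sum>i<n. f i * g j * emb (b i \<bullet> b j) l)"
    unfolding brk_LK by (rule sum.swap)
  also have "\<dots> = brk LK g f l"
    unfolding brk_LK by (intro sum.cong refl) (simp add: brk_comm mult.commute)
  finally show "brk LK f g l = brk LK g f l" .
qed

lemma brk_in_K: "brk LK f g \<in> carr LK"
  by (auto simp: brk_LK carr_LK emb_def)

lemma ext_add: "extK D (f + g) = extK D f + extK D g"
  by (auto simp: extK_def fun_eq_iff zero_fun_apply plus_fun_apply algebra_simps sum.distrib)

lemma ext_scale: "extK D (smul LK c f) = smul LK c (extK D f)"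
  by (auto simp: extK_def smul_LK fun_eq_iff zero_fun_apply plus_fun_apply sum_distrib_left ac_simps)

lemma ext_0: "extK D 0 = 0"
  by (auto simp: extK_def fun_eq_iff zero_fun_apply plus_fun_apply)

lemma ext_in_K: "extK D f \<in> carr LK"
  by (auto simp: extK_def carr_LK emb_def)

definition linear_on_V :: "('v \<Rightarrow> 'v) \<Rightarrow> bool" where
  "linear_on_V D \<longleftrightarrow> (\<forall>x\<in>V. D x \<in> V) \<and> (\<forall>x\<in>V. \<forall>y\<in>V. D (x + y) = D x + D y) \<and>
     (\<forall>c. \<forall>x\<in>V. D (c *s x) = c *s D x)"

lemma linear_on_V_derivation: "derivation D \<Longrightarrow> linear_on_V D"
  by (simp add: linear_on_V_def derivation_def)

lemma ext_dp: "i < n \<Longrightarrow> extK D (dp i) = emb (D (b i))"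
proof
  fix l assume "i < n"
  have "extK D (dp i) l = (\<Sum>j<n. if j = i then emb (D (b i)) l else 0)"
    unfolding extK_def by (intro sum.cong refl) (simp add: dp_def)
  then show "extK D (dp i) l = emb (D (b i)) l" using \<open>i < n\<close> by simp
qed

lemma ext_emb:
  assumes D: "linear_on_V D" and "x \<in> V"
  shows "extK D (emb x) = emb (D x)"
  using assms(2)
proof (induction rule: span_V_induct)
  case zero
  have "D 0 = 0" using D unfolding linear_on_V_def by (metis zero_in scale_zero_left)
  then show ?case by (simp only: ext_0 emb_0)
next
  case (step c i y)
  have "emb (c *s b i + y) = smul LK (to_ac c) (dp i) + emb y"
    using step by (simp add: emb_add emb_scale emb_b)
  then have "extK D (emb (c *s b i + y)) = smul LK (to_ac c) (emb (D (b i))) + emb (D y)"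
    using step by (simp add: ext_add ext_scale ext_dp)
  also have "\<dots> = emb (D (c *s b i + y))"
    using step D by (simp add: linear_on_V_def emb_add emb_scale)
  finally show ?case .
qed

lemma brk_K_emb:
  assumes "x \<in> V" "y \<in> V"
  shows "brk LK (emb x) (emb y) = emb (x \<bullet> y)"
proof -
  have lin: "linear_on_V (brk L x)" if "x \<in> V" for x using that by (simp add: linear_on_V_def)
  have 1: "brk LK (dp i) g = extK (brk L (b i)) g" if "i < n" for i g
  proof
    fix l
    have "brk LK (dp i) g l = (\<Sum>k<n. if k = i then (\<Sum>j<n. g j * emb (b i \<bullet> b j) l) else 0)"
      unfolding brk_LK by (intro sum.cong refl) (simp add: dp_def)
    then show "brk LK (dp i) g l = extK (brk L (b i)) g l" using that by (simp add: extK_def)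
  qed
  show ?thesis using assms(1)
  proof (induction rule: span_V_induct)
    case zero then show ?case using assms(2) by (simp add: brk_K_0)
  next
    case (step c i z)
    have "emb (c *s b i + z) = smul LK (to_ac c) (dp i) + emb z"
      using step by (simp add: emb_add emb_scale emb_b)
    moreover have "brk LK (emb (b i)) (emb y) = emb (b i \<bullet> y)" "emb (b i) = dp i"
      using step 1 ext_emb[OF lin assms(2)] emb_b by simp_all
    ultimately show ?case using step assms(2)
      by (simp add: brk_K_add brk_K_scale emb_add emb_scale)
  qed
qed

lemma char_two_K: "(1::'k alg_closure) + 1 = 0"
  using char_two by (metis to_ac_1 to_ac_add to_ac_0)

lemma double_K: "(f::nat \<Rightarrow> 'k alg_closure) + f = 0"
proof
  fix i
  have "f i + f i = f i * (1 + 1)" by (simp add: distrib_left)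
  then show "(f + f) i = 0 i" by (simp only: plus_fun_apply zero_fun_apply char_two_K mult_zero_right)
qed

lemma brk_K_self: "f \<in> carr LK \<Longrightarrow> brk LK f f = 0"
proof (induction rule: LK_induct)
  case zero then show ?case by (simp add: brk_K_0)
next
  case (step c x g)
  then show ?case using double_K
    by (simp add: brk_K_add brk_K_scale brk_K_emb brk_K_comm[of g "emb x"])
qed

lemma jacobi_K:
  assumes "f \<in> carr LK" "g \<in> carr LK" "h \<in> carr LK"
  shows "brk LK f (brk LK g h) + brk LK g (brk LK h f) + brk LK h (brk LK f g) = 0"
proof -
  define J where "J f g h = brk LK f (brk LK g h) + brk LK g (brk LK h f) + brk LK h (brk LK f g)" for f g h
  have J_lin: "J (smul LK c f + f') g h = smul LK c (J f g h) + J f' g h"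
    "J g (smul LK c f + f') h = smul LK c (J g f h) + J g f' h"
    "J g h (smul LK c f + f') = smul LK c (J g h f) + J g h f'" for c f f' g h
    unfolding J_def by (simp_all add: brk_K_add brk_K_scale K.scale_right_distrib ac_simps)
  have J0: "J 0 g h = 0" "J g 0 h = 0" "J g h 0 = 0" for g h
    unfolding J_def by (simp_all add: brk_K_0)
  have 1: "J (emb x) (emb y) (emb z) = 0" if "x \<in> V" "y \<in> V" "z \<in> V" for x y z
    unfolding J_def using that jacobi[OF that] by (simp add: brk_K_emb flip: emb_add)
  have 2: "J f (emb y) (emb z) = 0" if "y \<in> V" "z \<in> V" "f \<in> carr LK" for f y z
    using that(3) by (induction rule: LK_induct) (use that in \<open>simp_all add: J_lin J0 1\<close>)
  have 3: "J f g (emb z) = 0" if "z \<in> V" "f \<in> carr LK" "g \<in> carr LK" for f g z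
    using that(3) by (induction rule: LK_induct) (use that in \<open>simp_all add: J_lin J0 2\<close>)
  have "J f g h = 0"
    using assms(3) by (induction rule: LK_induct) (use assms in \<open>simp_all add: J_lin J0 3\<close>)
  then show ?thesis unfolding J_def .
qed

lemma lie_char2_LK: "lie_char2 LK"
proof (intro lie_char2.intro lie_algebra.intro vector_space_K lie_algebra_axioms.intro char2_field.intro)
qed (simp_all only: subspace_LK brk_in_K brk_K_add brk_K_scale brk_K_self jacobi_K char_two_K)

lemma perfect_LK:
  assumes perfect shows "lie_char2.perfect LK"
proof -
  let ?S = "K.span {brk LK x y |x y. x \<in> carr LK \<and> y \<in> carr LK}"
  have "V \<subseteq> {x \<in> V. emb x \<in> ?S}"
  proof (rule perfect_induct[OF assms])
    have "emb (x + y) \<in> ?S" if "x \<in> V" "y \<in> V" "emb x \<in> ?S" "emb y \<in> ?S" for x y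
      using that by (simp add: emb_add K.span_add)
    moreover have "emb (c *s x) \<in> ?S" if "x \<in> V" "emb x \<in> ?S" for c x
      using that K.span_scale[of "emb x" _ "to_ac c"] by (simp add: emb_scale)
    ultimately show "subspace {x \<in> V. emb x \<in> ?S}"
      by (auto simp: subspace_def K.span_zero)
    show "x \<bullet> y \<in> {x \<in> V. emb x \<in> ?S}" if "x \<in> V" "y \<in> V" for x y
      using that brk_K_emb[OF that] emb_in by (auto intro!: K.span_base) metis
  qed
  then have emb: "emb x \<in> ?S" if "x \<in> V" for x using that by blast
  have "carr LK \<subseteq> ?S"
  proof
    fix f assume "f \<in> carr LK" then show "f \<in> ?S"
      by (induction rule: LK_induct) (auto simp: K.span_zero intro!: K.span_add K.span_scale emb)
  qed
  then show ?thesis unfolding lie_char2.perfect_def[OF lie_char2_LK] .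
qed

lemma ext_derivation:
  assumes D: "derivation D" and "f \<in> carr LK" "g \<in> carr LK"
  shows "extK D (brk LK f g) = brk LK (extK D f) g + brk LK f (extK D g)"
proof -
  note ee = ext_emb[OF linear_on_V_derivation[OF D]]
  have Dp: "D x \<in> V" "D (x \<bullet> y) = D x \<bullet> y + x \<bullet> D y" if "x \<in> V" "y \<in> V" for x y
    using D that unfolding derivation_def by auto
  have 1: "extK D (brk LK f (emb y)) = brk LK (extK D f) (emb y) + brk LK f (extK D (emb y))"
    if "f \<in> carr LK" "y \<in> V" for f y
    using that(1)
    by (induction rule: LK_induct)
      (use that in \<open>simp_all add: brk_K_0 ext_0 ee brk_K_emb Dp emb_add ext_add ext_scale brk_K_add brk_K_scale K.scale_right_distrib ac_simps\<close>)
  show ?thesis using assms(3)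
    by (induction rule: LK_induct)
      (use assms in \<open>simp_all add: brk_K_0 ext_0 1 ext_add ext_scale brk_K_add brk_K_scale K.scale_right_distrib ac_simps\<close>)
qed

lemma ext_comp:
  assumes "linear_on_V D" "linear_on_V D'" "f \<in> carr LK"
  shows "extK D (extK D' f) = extK (D \<circ> D') f"
proof -
  have "linear_on_V (D \<circ> D')" using assms unfolding linear_on_V_def by simp
  note comp = ext_emb[OF this]
  show ?thesis using assms(3)
  proof (induction rule: LK_induct)
    case (step c x g)
    moreover have "D' x \<in> V" using assms(2) step(1) unfolding linear_on_V_def by blast
    ultimately show ?case using assms(1,2) using comp[OF step(1)] by (simp add: ext_add ext_scale ext_emb o_def)
  qed (simp add: ext_0)
qed

lemma ext_cong: "(\<And>x. x \<in> V \<Longrightarrow> D x = D' x) \<Longrightarrow> extK D f = extK D' f"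
  unfolding extK_def by (auto intro!: sum.cong)

text \<open>
  If \<open>T v = \<lambda> v\<close>, then \<open>v\<close> is an eigenvector of this map for the trace of \<open>c \<lambda>\<close> from the field with
  \<open>2^m\<close> elements to the field with 2 elements.
\<close>

definition trace_derivation :: "('v \<Rightarrow> 'v) \<Rightarrow> nat \<Rightarrow> 'k alg_closure \<Rightarrow> (nat \<Rightarrow> 'k alg_closure) \<Rightarrow> nat \<Rightarrow> 'k alg_closure"
  where "trace_derivation T m c f = (\<lambda>l. \<Sum>j<m. c ^ (2 ^ j) * extK (T ^^ (2 ^ j)) f l)"

text \<open>
  Squaring is additive on commuting maps in characteristic 2, and it permutes the summands
  cyclically because \<open>c^(2^m) = c\<close> and \<open>T^(2^m) = T\<close>.
\<close>

lemma trace_derivation_idem: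
  assumes T: "derivation T" "\<And>v. v \<in> V \<Longrightarrow> (T ^^ (2 ^ m)) v = T v" and c: "c ^ (2 ^ m) = c"
    and f: "f \<in> carr LK" and m: "0 < m"
  shows "trace_derivation T m c (trace_derivation T m c f) = trace_derivation T m c f"
proof
  fix l
  note lin = linear_on_V_derivation[OF derivation_power[OF T(1)]]
  define g where "g j = c ^ (2 ^ j) * extK (T ^^ (2 ^ j)) f l" for j
  have ext_sum: "extK D (\<lambda>l. \<Sum>j<k. a j * F j l) l = (\<Sum>j<k. a j * extK D (F j) l)" for D a F and k :: nat
    unfolding extK_def by (induction k) (auto simp: algebra_simps sum.distrib sum_distrib_left)
  have "trace_derivation T m c (trace_derivation T m c f) l
      = (\<Sum>i<m. \<Sum>j<m. c ^ (2 ^ i) * (c ^ (2 ^ j) * extK (T ^^ (2 ^ i)) (extK (T ^^ (2 ^ j)) f) l))"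
    unfolding trace_derivation_def ext_sum by (simp add: sum_distrib_left)
  also have "\<dots> = (\<Sum>i<m. \<Sum>j<m. c ^ (2 ^ i + 2 ^ j) * extK (T ^^ (2 ^ i + 2 ^ j)) f l)"
    by (intro sum.cong refl) (simp add: ext_comp[OF lin lin f] power_add funpow_add mult.assoc)
  also have "\<dots> = (\<Sum>i<m. c ^ (2 ^ i + 2 ^ i) * extK (T ^^ (2 ^ i + 2 ^ i)) f l)"
    by (rule sum_symmetric_char2[OF char_two_K]) (simp add: add.commute)
  also have "\<dots> = (\<Sum>i<m. g (Suc i))" unfolding g_def by (simp add: mult_2)
  also have "\<dots> = (\<Sum>i<m. g i) + g m - g 0"
    using sum.lessThan_Suc_shift[of g m] by (simp add: algebra_simps)
  also have "g m = g 0" unfolding g_def using c ext_cong[of "T ^^ (2 ^ m)" T] T(2) by simp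
  also have "(\<Sum>i<m. g i) + g 0 - g 0 = trace_derivation T m c f l"
    unfolding trace_derivation_def g_def by simp
  finally show "trace_derivation T m c (trace_derivation T m c f) l = trace_derivation T m c f l" .
qed

lemma toral_trace_derivation:
  assumes T: "derivation T" "\<And>v. v \<in> V \<Longrightarrow> (T ^^ (2 ^ m)) v = T v" and c: "c ^ (2 ^ m) = c"
    and m: "0 < m" and perfect: perfect
  shows "toral_derivation LK (trace_derivation T m c)"
proof (intro toral_derivation.intro lie_char2_LK toral_derivation_axioms.intro perfect_LK perfect)
  fix x y :: "nat \<Rightarrow> 'k alg_closure" and d :: "'k alg_closure"
  assume x: "x \<in> carr LK"
  show "trace_derivation T m c x \<in> carr LK"
    using ext_in_K by (auto simp: trace_derivation_def carr_LK)
  show "trace_derivation T m c (smul LK d x) = smul LK d (trace_derivation T m c x)"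
    unfolding trace_derivation_def ext_scale unfolding smul_LK by (simp add: sum_distrib_left ac_simps)
  show "trace_derivation T m c (trace_derivation T m c x) = trace_derivation T m c x"
    by (rule trace_derivation_idem[OF T c x m])
  assume y: "y \<in> carr LK"
  show "trace_derivation T m c (x + y) = trace_derivation T m c x + trace_derivation T m c y"
    by (auto simp: trace_derivation_def ext_add fun_eq_iff zero_fun_apply plus_fun_apply algebra_simps sum.distrib)
  have td: "trace_derivation T k c z = (\<Sum>j<k. smul LK (c ^ (2 ^ j)) (extK (T ^^ (2 ^ j)) z))" for k z
    by (induction k) (auto simp: trace_derivation_def smul_LK fun_eq_iff zero_fun_apply plus_fun_apply)
  have "trace_derivation T k c (brk LK x y) = brk LK (trace_derivation T k c x) y + brk LK x (trace_derivation T k c y)" for k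
    unfolding td
    by (induction k) (auto simp: brk_K_0 brk_K_add brk_K_scale K.scale_right_distrib
        ext_derivation[OF derivation_power[OF T(1)] x y] ac_simps)
  then show "trace_derivation T m c (brk LK x y) = brk LK (trace_derivation T m c x) y + brk LK x (trace_derivation T m c y)" .
qed

theorem not_perfect:
  assumes fin: "finite V" and n: "n = 4 \<or> n = 5"
  shows "\<not> perfect"
proof
  assume perfect: perfect
  have "b 0 \<in> V" "b 0 \<noteq> 0" using n indep_b dependent_zero by (auto simp: image_iff) (metis dependent_zero imageI lessThan_iff zero_less_numeral)+
  then have "V \<noteq> {0}" by blast
  then obtain T m x where T: "derivation T" "0 < m" "\<And>v. v \<in> V \<Longrightarrow> (T ^^ (2 ^ m)) v = T v" "x \<in> V" "T x \<noteq> 0"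
    using exists_periodic_derivation[OF fin perfect] by metis
  note lin = linear_on_V_derivation[OF derivation_power[OF T(1)]]
  have "T x \<in> V" using T unfolding derivation_def by blast
  then obtain l where l: "emb (T x) l \<noteq> 0" using emb_eq_0 T(5) by (metis HOL.ext zero_fun_apply)
  obtain c where c: "c ^ (2 ^ m) = c" "(\<Sum>j<m. c ^ (2 ^ j) * emb ((T ^^ (2 ^ j)) x) l) \<noteq> 0"
    using exists_nonroot_fixed_by_frobenius[of m "\<lambda>j. emb ((T ^^ (2 ^ j)) x) l"] char_two_K T(2) l by auto
  interpret E: toral_derivation LK "trace_derivation T m c"
    by (rule toral_trace_derivation[OF T(1,3) c(1) T(2) perfect])
  have "trace_derivation T m c (emb x) \<noteq> 0"
  proof
    assume "trace_derivation T m c (emb x) = 0"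
    then have "trace_derivation T m c (emb x) l = 0" by (simp add: zero_fun_apply)
    then show False using c(2) ext_emb[OF lin T(4)] unfolding trace_derivation_def by simp
  qed
  moreover have "card (dp ` {..<n} :: (nat \<Rightarrow> 'k alg_closure) set) = n"
    by (simp add: card_image inj_dp)
  ultimately show False
    using E.no_toral_derivation[of "dp ` {..<n}" "emb x"] indep_K LK_eq_span emb_in n
      K.span_superset[of "dp ` {..<n}"] by auto
qed

end

section \<open>Perfect algebras of dimension 3\<close>

text \<open>
  The field is perfect, which in characteristic 2 means that it has square roots.
\<close>

locale lie_perfect_field = lie_char2 L for L :: "('k::field, 'v::ab_group_add) lie_data" +
  assumes sqrt_exists: "\<exists>s. s * s = (a::'k)"

context lie_char2
begin

text \<open>
  The multiplication table of \<open>x\<^sup>(\<^sup>2\<^sup>)\<partial>\<close>, \<open>\<partial>\<close>, \<open>x\<partial>\<close> in \<open>W(1;2)\<^sup>(\<^sup>1\<^sup>)\<close>.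
\<close>

definition W_triple :: "'v \<Rightarrow> 'v \<Rightarrow> 'v \<Rightarrow> bool" where
  "W_triple e f h \<longleftrightarrow> e \<in> V \<and> f \<in> V \<and> h \<in> V \<and> h \<noteq> 0 \<and> e \<bullet> f = h \<and> h \<bullet> e = e \<and> h \<bullet> f = f"

lemma W_tripleD:
  assumes "W_triple e f h"
  shows "e \<in> V" "f \<in> V" "h \<in> V" "h \<noteq> 0" "e \<bullet> f = h" "h \<bullet> e = e" "h \<bullet> f = f"
    "f \<bullet> e = h" "e \<bullet> h = e" "f \<bullet> h = f"
  using assms brk_comm[of e h] brk_comm[of f h] brk_comm[of e f] unfolding W_triple_def by auto

text \<open>
  Bracketing with \<open>h\<close>, and then with \<open>f\<close> or \<open>e\<close>, isolates the coefficients; so the table,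
  together with \<open>h \<noteq> 0\<close>, makes the triple independent.
\<close>

lemma W_triple_coordinates:
  assumes W: "W_triple e f h" and 0: "\<alpha> *s e + \<beta> *s f + \<gamma> *s h = 0"
  shows "\<alpha> = 0" "\<beta> = 0" "\<gamma> = 0"
proof -
  note [simp] = W_tripleD[OF W]
  define x where "x = \<alpha> *s e + \<beta> *s f"
  have "h \<bullet> (\<alpha> *s e + \<beta> *s f + \<gamma> *s h) = x" unfolding x_def by simp
  then have x: "x = 0" using 0 by simp
  then show "\<gamma> = 0" using 0 unfolding x_def by simp
  have "f \<bullet> x = \<alpha> *s h" "e \<bullet> x = \<beta> *s h" unfolding x_def by simp_all
  then show "\<alpha> = 0" "\<beta> = 0" using x by simp_all
qed

lemma W_triple_independent:
  assumes "W_triple e f h"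
  shows "independent {e, f, h}" "card {e, f, h} = 3"
proof -
  note W = W_tripleD[OF assms]
  note co = W_triple_coordinates[OF assms]
  have "e \<noteq> f" "e \<noteq> h" "f \<noteq> h" using co[of 1 1 0] co[of 1 0 1] co[of 0 1 1] by auto
  then show "card {e, f, h} = 3" by simp
  have "e \<notin> span {f, h}"
  proof
    assume "e \<in> span {f, h}"
    then obtain r s where "e = r *s f + s *s h" unfolding span_pair by blast
    then have "1 *s e + r *s f + s *s h = 0" by (simp add: ac_simps)
    then show False using co(1) zero_neq_one by metis
  qed
  moreover have "f \<notin> span {h}"
  proof
    assume "f \<in> span {h}"
    then obtain s where "f = s *s h" unfolding span_singleton by blast
    then have "0 *s e + 1 *s f + s *s h = 0" by simp
    then show False using co(2) zero_neq_one by metis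
  qed
  ultimately show "independent {e, f, h}"
    using W(4) by (intro independent_insertI[of e] independent_insertI[of f]) simp_all
qed

text \<open>
  The claim is that \<open>[a, b]\<close> is outside the span of \<open>a, b\<close> for some pair of basis vectors.  Otherwise
  the matrix that expresses \<open>[x2, x3], [x3, x1], [x1, x2]\<close> by \<open>x1, x2, x3\<close> has zero diagonal.  The
  Jacobi identity makes this matrix symmetric, so it is alternating of odd size and therefore
  singular, although by perfectness the three brackets are a basis.
\<close>

lemma perfect_dim_3_generators:
  assumes perfect: perfect and gen: "V \<subseteq> span {x1, x2, x3}" 
    and ind: "independent {x1, x2, x3}" "card {x1, x2, x3} = 3" and x: "x1 \<in> V" "x2 \<in> V" "x3 \<in> V"
  obtains a b where "a \<in> V" "b \<in> V" "V \<subseteq> span {a, b, a \<bullet> b}"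
proof -
  note found = that
  note [simp] = x
  define f1 f2 f3 where "f1 = x2 \<bullet> x3" and "f2 = x3 \<bullet> x1" and "f3 = x1 \<bullet> x2"
  have inV: "f1 \<in> V" "f2 \<in> V" "f3 \<in> V" unfolding f1_def f2_def f3_def by simp_all
  have table: "x2 \<bullet> x3 = f1" "x3 \<bullet> x2 = f1" "x3 \<bullet> x1 = f2" "x1 \<bullet> x3 = f2" "x1 \<bullet> x2 = f3" "x2 \<bullet> x1 = f3"
    unfolding f1_def f2_def f3_def by (auto intro: brk_comm)
  have co: "\<exists>r s t. z = r *s x1 + s *s x2 + t *s x3" if "z \<in> V" for z using gen that span_triple by blast
  have "V \<subseteq> span {f1, f2, f3}"
  proof (rule perfect_induct[OF perfect])
    fix z z' assume zz: "z \<in> V" "z' \<in> V"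
    obtain r s t where z: "z = r *s x1 + s *s x2 + t *s x3" using co zz by meson
    obtain r' s' t' where z': "z' = r' *s x1 + s' *s x2 + t' *s x3" using co zz by meson
    show "z \<bullet> z' \<in> span {f1, f2, f3}" unfolding z z'
      by (simp add: table) (auto intro!: span_add span_scale intro: span_base)
  qed simp
  then have "{x1, x2, x3} \<subseteq> span {f1, f2, f3}" using x by blast
  moreover have "card {f1, f2, f3} \<le> 3" by (simp add: card_insert_if)
  ultimately have "independent {f1, f2, f3} \<and> card {f1, f2, f3} = card {x1, x2, x3}"
    using ind by (intro independent_if_spanning_card) auto
  then have uniq: "r = 0 \<and> s = 0 \<and> t = 0" if "r *s f1 + s *s f2 + t *s f3 = 0" for r s t
    using independent_triple_cardD[of f1 f2 f3 r s t] that ind(2) by simp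
  have indx: "V \<subseteq> span {a, b, a \<bullet> b}" if "independent {a, b}" "a \<noteq> b" "a \<in> V" "b \<in> V" "a \<bullet> b \<notin> span {a, b}" for a b
  proof (rule span_if_independent_card[OF gen])
    have ab: "a \<bullet> b \<noteq> a" "a \<bullet> b \<noteq> b" using that(5) span_base by (metis insertI1 insertI2)+
    then have "card {a, b, a \<bullet> b} = 3" using that(2) by simp
    then show "card {x1, x2, x3} \<le> card {a, b, a \<bullet> b}" using ind(2) by simp
    have "independent (insert (a \<bullet> b) {a, b})" by (rule independent_insertI[OF that(5,1)])
    then show "independent {a, b, a \<bullet> b}" by (simp add: insert_commute)
  qed (use that in auto)
  have dist: "x1 \<noteq> x2" "x1 \<noteq> x3" "x2 \<noteq> x3" using ind(2) by (auto simp: card_insert_if split: if_splits)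
  have pairs: "independent {x1, x2}" "independent {x2, x3}" "independent {x3, x1}"
    using independent_mono[OF ind(1)] by auto
  show thesis
  proof (cases "f3 \<in> span {x1, x2} \<and> f1 \<in> span {x2, x3} \<and> f2 \<in> span {x3, x1}")
    case False
    then show ?thesis
      using found[of x1 x2] found[of x2 x3] found[of x3 x1] indx[of x1 x2] indx[of x2 x3] indx[of x3 x1]
        pairs dist unfolding f1_def f2_def f3_def by auto
  next
    case True
    then obtain \<alpha> \<beta> \<gamma> \<delta> \<epsilon> \<zeta> where f: "f3 = \<alpha> *s x1 + \<beta> *s x2" "f1 = \<gamma> *s x2 + \<delta> *s x3" "f2 = \<epsilon> *s x3 + \<zeta> *s x1"
      unfolding span_pair by blast
    have "0 = x1 \<bullet> (x2 \<bullet> x3) + x2 \<bullet> (x3 \<bullet> x1) + x3 \<bullet> (x1 \<bullet> x2)" using jacobi[OF x] by simp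
    also have "\<dots> = x1 \<bullet> (\<gamma> *s x2 + \<delta> *s x3) + x2 \<bullet> (\<epsilon> *s x3 + \<zeta> *s x1) + x3 \<bullet> (\<alpha> *s x1 + \<beta> *s x2)"
      unfolding table f[symmetric] ..
    also have "\<dots> = (\<epsilon> + \<beta>) *s f1 + (\<delta> + \<alpha>) *s f2 + (\<gamma> + \<zeta>) *s f3"
      by (simp add: table scale_left_distrib ac_simps)
    finally have "\<epsilon> = \<beta>" "\<delta> = \<alpha>" "\<gamma> = \<zeta>" using uniq[of "\<epsilon> + \<beta>" "\<delta> + \<alpha>" "\<gamma> + \<zeta>"] field_add_eq_0 by auto
    then have "\<beta> *s f1 + \<alpha> *s f2 + \<gamma> *s f3 = 0"
      unfolding f by (simp add: scale_right_distrib ac_simps)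
    then have "\<alpha> = 0" "\<beta> = 0" using uniq by blast+
    then have "0 *s f1 + 0 *s f2 + 1 *s f3 = 0" using f by simp
    then show ?thesis using uniq[of 0 0 1] by simp
  qed
qed

end

context lie_perfect_field
begin

text \<open>
  Start from a basis \<open>a, b, g = [a, b]\<close>.  The Jacobi identity shows that \<open>ad g\<close> preserves the span of
  \<open>a, b\<close> and has trace 0 there, and perfectness shows that its determinant \<open>\<delta>\<close> is nonzero.  Rescaling
  \<open>a\<close> makes the determinant 1.  Then \<open>ad g\<close> is unipotent on this plane, but it need not be the
  identity; adding the right vector of the plane to \<open>g\<close> gives an element that acts as an idempotent.
\<close>

theorem perfect_dim_3:
  assumes perfect: perfect and gen: "V \<subseteq> span {x1, x2, x3}" 
    and ind: "independent {x1, x2, x3}" "card {x1, x2, x3} = 3" and x: "x1 \<in> V" "x2 \<in> V" "x3 \<in> V"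
  obtains e f h where "W_triple e f h" "V \<subseteq> span {e, f, h}"
proof -
  obtain a b where ab: "a \<in> V" "b \<in> V" "V \<subseteq> span {a, b, a \<bullet> b}"
    by (rule perfect_dim_3_generators[OF perfect gen ind x])
  note [simp] = ab(1,2)
  define g where "g = a \<bullet> b"
  have [simp]: "g \<in> V" and gb: "b \<bullet> a = g" "a \<bullet> b = g" unfolding g_def by (auto intro: brk_comm)
  have gen': "V \<subseteq> span {a, b, g}" using ab g_def by simp
  have "{x1, x2, x3} \<subseteq> span {a, b, g}" using x gen' by blast
  moreover have "card {a, b, g} \<le> 3" by (simp add: card_insert_if)
  ultimately have "independent {a, b, g} \<and> card {a, b, g} = 3"
    using ind independent_if_spanning_card[of "{x1, x2, x3}" "{a, b, g}"] by simp
  note abg = this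
  then have uniq: "r = 0 \<and> s = 0 \<and> t = 0" if "r *s a + s *s b + t *s g = 0" for r s t
    using independent_triple_cardD[of a b g r s t] that abg by blast
  define ga gb' where "ga = g \<bullet> a" and "gb' = g \<bullet> b"
  have table: "g \<bullet> a = ga" "a \<bullet> g = ga" "g \<bullet> b = gb'" "b \<bullet> g = gb'"
    unfolding ga_def gb'_def by (auto intro: brk_comm)
  have co: "\<exists>r s t. z = r *s a + s *s b + t *s g" if "z \<in> V" for z using gen' that span_triple by blast
  have "V \<subseteq> span {g, ga, gb'}"
  proof (rule perfect_induct[OF perfect])
    fix z z' assume zz: "z \<in> V" "z' \<in> V"
    obtain r s t where z: "z = r *s a + s *s b + t *s g" using co zz by meson
    obtain r' s' t' where z': "z' = r' *s a + s' *s b + t' *s g" using co zz by meson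
    show "z \<bullet> z' \<in> span {g, ga, gb'}" unfolding z z'
      by (simp add: table gb) (auto intro!: span_add span_scale intro: span_base)
  qed simp
  then have "{x1, x2, x3} \<subseteq> span {g, ga, gb'}" using x by blast
  moreover have "card {g, ga, gb'} \<le> 3" by (simp add: card_insert_if)
  ultimately have "independent {g, ga, gb'} \<and> card {g, ga, gb'} = 3"
    using ind independent_if_spanning_card[of "{x1, x2, x3}" "{g, ga, gb'}"] by simp
  note gab = this
  then have uniq': "r = 0 \<and> s = 0 \<and> t = 0" if "r *s g + s *s ga + t *s gb' = 0" for r s t
    using independent_triple_cardD[of g ga gb' r s t] that gab by blast
  have gaV: "ga \<in> V" "gb' \<in> V" unfolding ga_def gb'_def by simp_all
  obtain \<alpha> \<beta> \<gamma> where A: "ga = \<alpha> *s a + \<beta> *s b + \<gamma> *s g" using co gaV by meson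
  obtain \<alpha>' \<beta>' \<gamma>' where B: "gb' = \<alpha>' *s a + \<beta>' *s b + \<gamma>' *s g" using co gaV by meson
  have "0 = (a \<bullet> b) \<bullet> g" by (simp add: gb)
  also have "\<dots> = a \<bullet> gb' + b \<bullet> ga" by (subst jacobi_left) (simp_all add: table)
  also have "\<dots> = a \<bullet> (\<alpha>' *s a + \<beta>' *s b + \<gamma>' *s g) + b \<bullet> (\<alpha> *s a + \<beta> *s b + \<gamma> *s g)"
    unfolding A[symmetric] B[symmetric] ..
  also have "\<dots> = (\<beta>' + \<alpha>) *s g + \<gamma>' *s ga + \<gamma> *s gb'"
    by (simp add: table gb scale_left_distrib ac_simps)
  finally have "\<beta>' = \<alpha>" and \<gamma>: "\<gamma> = 0" "\<gamma>' = 0" using uniq'[of "\<beta>' + \<alpha>" \<gamma>' \<gamma>] field_add_eq_0 by auto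
  have A: "g \<bullet> a = \<alpha> *s a + \<beta> *s b" and B: "g \<bullet> b = \<alpha>' *s a + \<alpha> *s b"
    using A B \<gamma> \<open>\<beta>' = \<alpha>\<close> table by auto
  define \<delta> where "\<delta> = \<alpha> * \<alpha> + \<beta> * \<alpha>'"
  have "\<delta> \<noteq> 0"
  proof
    assume "\<delta> = 0"
    have "0 *s g + \<alpha> *s ga + \<beta> *s gb' = \<delta> *s a"
      unfolding A[unfolded table] B[unfolded table] \<delta>_def by (simp add: scale_right_distrib scale_left_distrib ac_simps)
    then have "\<alpha> = 0" "\<beta> = 0" using uniq'[of 0 \<alpha> \<beta>] \<open>\<delta> = 0\<close> by auto
    then have "0 *s g + 1 *s ga + 0 *s gb' = 0" using A table by simp
    then show False using uniq'[of 0 1 0] by simp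
  qed
  \<comment> \<open>After rescaling, \<open>ad h\<close> has on the span of \<open>e, b\<close> the matrix with rows \<open>(1 + p q, q^2)\<close> and \<open>(p^2, 1 + p q)\<close>, of determinant 1.\<close>
  obtain s where s: "s * s = inverse \<delta>" using sqrt_exists by blast
  have s0: "s \<noteq> 0" using s \<open>\<delta> \<noteq> 0\<close> by auto
  obtain p where p: "p * p = \<alpha>'" using sqrt_exists by blast
  obtain q where q: "q * q = s * s * \<beta>" using sqrt_exists by blast
  have "s * s * (\<alpha> * \<alpha>) + (s * s * \<beta>) * \<alpha>' = 1"
  proof -
    have "s * s * (\<alpha> * \<alpha>) + (s * s * \<beta>) * \<alpha>' = (s * s) * \<delta>" unfolding \<delta>_def by (simp add: algebra_simps)
    then show ?thesis using s \<open>\<delta> \<noteq> 0\<close> by simp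
  qed
  then have "s * s * (\<alpha> * \<alpha>) + (q * q) * (p * p) + 1 = 0" unfolding p q by simp
  moreover have "(s * \<alpha> + p * q + 1) * (s * \<alpha> + p * q + 1) = s * s * (\<alpha> * \<alpha>) + (q * q) * (p * p) + 1"
    by (simp add: algebra_simps)
  ultimately have "s * \<alpha> + p * q + 1 = 0" by simp
  then have sa: "s * \<alpha> = p * q + 1" by (simp add: add.assoc field_add_eq_0)
  define e h where "e = s *s a" and "h = s *s g"
  have [simp]: "e \<in> V" "h \<in> V" unfolding e_def h_def by simp_all
  have he: "h \<bullet> e = (p * q + 1) *s e + (q * q) *s b" 
    unfolding e_def h_def sa[symmetric] q using A by (simp add: scale_right_distrib ac_simps)
  have hf: "h \<bullet> b = (p * p) *s e + (p * q + 1) *s b"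
    unfolding e_def h_def sa[symmetric] p using B by (simp add: scale_right_distrib ac_simps)
  have ef: "e \<bullet> b = h" unfolding e_def h_def gb[symmetric] using gb by simp
  \<comment> \<open>The coefficients \<open>p\<close> and \<open>q\<close> solve the equations that make \<open>ad h'\<close> idempotent.\<close>
  define h' where "h' = h + p *s e + q *s b"
  define e' f' where "e' = e + q *s h'" and "f' = b + p *s h'"
  have [simp]: "h' \<in> V" "e' \<in> V" "f' \<in> V" unfolding h'_def e'_def f'_def by simp_all
  have h'e: "h' \<bullet> e = e'"
    unfolding h'_def e'_def using he ef brk_comm[of b e]
    by (simp add: scale_left_distrib scale_right_distrib ac_simps)
  have h'f: "h' \<bullet> b = f'"
    unfolding h'_def f'_def using hf ef 
    by (simp add: scale_left_distrib scale_right_distrib ac_simps)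
  have 1: "h' \<bullet> e' = e'" using h'e unfolding e'_def by simp
  have 2: "h' \<bullet> f' = f'" using h'f unfolding f'_def by simp
  have "e' \<bullet> f' = e \<bullet> b + p *s (e \<bullet> h') + q *s (h' \<bullet> b)"
    unfolding e'_def f'_def by (simp add: ac_simps)
  also have "\<dots> = h + p *s e' + q *s f'" using ef h'e h'f brk_comm[of e h'] by simp
  also have "\<dots> = h'" unfolding e'_def f'_def
    by (simp add: scale_right_distrib ac_simps) (simp add: h'_def ac_simps)
  finally have 3: "e' \<bullet> f' = h'" .
  have e_eq: "e = e' + q *s h'" and f_eq: "b = f' + p *s h'" unfolding e'_def f'_def by (simp_all add: add.assoc)
  have h_eq: "h = h' + p *s e + q *s b" unfolding h'_def by (simp add: ac_simps)
  have in1: "e' \<in> span {e', f', h'}" "f' \<in> span {e', f', h'}" "h' \<in> span {e', f', h'}" by (auto intro: span_base)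
  then have in2: "e \<in> span {e', f', h'}" "b \<in> span {e', f', h'}" unfolding e_eq f_eq by (intro span_add span_scale; simp)+
  then have in3: "h \<in> span {e', f', h'}" unfolding h_eq using in1 by (intro span_add span_scale)
  have "a = inverse s *s e" "g = inverse s *s h" using s0 unfolding e_def h_def by simp_all
  then have "{a, b, g} \<subseteq> span {e', f', h'}" using in2 in3 by (auto intro: span_scale)
  then have sp: "V \<subseteq> span {e', f', h'}" using gen' span_minimal[of "{a, b, g}"] by blast
  have "h' \<noteq> 0"
  proof
    assume "h' = 0"
    have "s *s (p *s a + (inverse s * q) *s b + 1 *s g) = h'"
      using s0 unfolding h'_def e_def h_def by (simp add: scale_right_distrib ac_simps)
    then have "p *s a + (inverse s * q) *s b + 1 *s g = 0" using \<open>h' = 0\<close> s0 by simp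
    then show False using uniq by (metis zero_neq_one)
  qed
  then show ?thesis using that[of e' f' h'] sp 1 2 3 unfolding W_triple_def by simp
qed

end

section \<open>Complements of a 3-dimensional perfect ideal\<close>

context lie_char2
begin

text \<open>
  A basis in coordinate form; the brackets of a five-dimensional algebra are compared through it.
\<close>

definition basis5 :: "'v \<Rightarrow> 'v \<Rightarrow> 'v \<Rightarrow> 'v \<Rightarrow> 'v \<Rightarrow> bool" where
  "basis5 a b c d e \<longleftrightarrow> {a, b, c, d, e} \<subseteq> V \<and> V \<subseteq> span {a, b, c, d, e} \<and>
     (\<forall>r s t u v. r *s a + s *s b + t *s c + u *s d + v *s e = 0 \<longrightarrow> r = 0 \<and> s = 0 \<and> t = 0 \<and> u = 0 \<and> v = 0)"

lemma basis5I_spanning: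
  assumes B: "independent B" "B \<subseteq> V" "card B = 5"
    and S: "{a, b, c, d, e} \<subseteq> V" "V \<subseteq> span {a, b, c, d, e}"
  shows "basis5 a b c d e"
  unfolding basis5_def
proof (intro conjI S allI impI)
  fix r s t u v
  assume 0: "r *s a + s *s b + t *s c + u *s d + v *s e = 0"
  have "card {a, b, c, d, e} \<le> 5" by (simp add: card_insert_if)
  then have ind: "independent {a, b, c, d, e}" and "card {a, b, c, d, e} = 5"
    using independent_if_spanning_card[OF B(1), of "{a, b, c, d, e}"] B S by auto
  then have d: "a \<noteq> b" "a \<noteq> c" "a \<noteq> d" "a \<noteq> e" "b \<noteq> c" "b \<noteq> d" "b \<noteq> e" "c \<noteq> d" "c \<noteq> e" "d \<noteq> e"
    by (auto simp: card_insert_if split: if_splits)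
  define w where "w x = (if x = a then r else if x = b then s else if x = c then t else if x = d then u else v)" for x
  have w: "w a = r" "w b = s" "w c = t" "w d = u" "w e = v" using d unfolding w_def by auto
  have "(\<Sum>x\<in>{a, b, c, d, e}. w x *s x) = r *s a + s *s b + t *s c + u *s d + v *s e"
    using d by (simp add: w add.assoc)
  then have "(\<Sum>x\<in>{a, b, c, d, e}. w x *s x) = 0" using 0 by simp
  then have "\<forall>x\<in>{a, b, c, d, e}. w x = 0"
    using independentD[OF ind _ subset_refl, of w] by auto
  then show "r = 0" "s = 0" "t = 0" "u = 0" "v = 0" using w by auto
qed

lemma basis5I_independent:
  assumes B: "finite B" "V \<subseteq> span B" "card B = 5" and S: "{a, b, c, d, e} \<subseteq> V"
    and ind: "\<And>r s t u v. r *s a + s *s b + t *s c + u *s d + v *s e = 0 \<Longrightarrow> r = 0 \<and> s = 0 \<and> t = 0 \<and> u = 0 \<and> v = 0"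
  shows "basis5 a b c d e"
proof -
  have 1: "a \<notin> span {b, c, d, e}"
  proof
    assume "a \<in> span {b, c, d, e}"
    then obtain s t u v where "a = s *s b + t *s c + u *s d + v *s e" unfolding span_quad by blast
    then have "1 *s a + s *s b + t *s c + u *s d + v *s e = 0" by (simp add: ac_simps)
    then show False using ind by (metis zero_neq_one)
  qed
  have 2: "b \<notin> span {c, d, e}"
  proof
    assume "b \<in> span {c, d, e}"
    then obtain t u v where "b = t *s c + u *s d + v *s e" unfolding span_triple by blast
    then have "0 *s a + 1 *s b + t *s c + u *s d + v *s e = 0" by (simp add: ac_simps)
    then show False using ind by (metis zero_neq_one)
  qed
  have 3: "c \<notin> span {d, e}"
  proof
    assume "c \<in> span {d, e}"
    then obtain u v where "c = u *s d + v *s e" unfolding span_pair by blast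
    then have "0 *s a + 0 *s b + 1 *s c + u *s d + v *s e = 0" by (simp add: ac_simps)
    then show False using ind by (metis zero_neq_one)
  qed
  have 4: "d \<notin> span {e}"
  proof
    assume "d \<in> span {e}"
    then obtain v where "d = v *s e" unfolding span_singleton by blast
    then have "0 *s a + 0 *s b + 0 *s c + 1 *s d + v *s e = 0" by simp
    then show False using ind by (metis zero_neq_one)
  qed
  have 5: "e \<noteq> 0"
  proof
    assume "e = 0"
    then have "0 *s a + 0 *s b + 0 *s c + 0 *s d + 1 *s e = 0" by simp
    then show False using ind by (metis zero_neq_one)
  qed
  have "independent {a, b, c, d, e}"
    using 1 2 3 4 5 by (intro independent_insertI[of a] independent_insertI[of b] independent_insertI[of c] independent_insertI[of d]) simp_all
  moreover have "a \<notin> {b, c, d, e}" "b \<notin> {c, d, e}" "c \<notin> {d, e}" "d \<notin> {e}"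
    using 1 2 3 4 span_superset[of "{b, c, d, e}"] span_superset[of "{c, d, e}"]
      span_superset[of "{d, e}"] span_superset[of "{e}"] by auto
  then have "card {a, b, c, d, e} = 5" by (simp add: card_insert_if)
  ultimately have "V \<subseteq> span {a, b, c, d, e}"
    using span_if_independent_card[OF B(2) S _ B(1)] B(3) by simp
  then show ?thesis unfolding basis5_def using S ind by blast
qed

lemma basis5_coordinates:
  assumes "basis5 a b c d e" "x \<in> V"
  obtains r s t u v where "x = r *s a + s *s b + t *s c + u *s d + v *s e"
proof -
  have "x \<in> span {a, b, c, d, e}" using assms unfolding basis5_def by blast
  then show ?thesis using that unfolding span_quint by auto
qed

text \<open>
  Leibniz' rule for \<open>h = [e, f]\<close> expresses \<open>D h\<close> by the coordinates of \<open>D e\<close> and \<open>D f\<close>, and for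
  \<open>e = [h, e]\<close> it then equates the \<open>e\<close>-coordinate of \<open>D e\<close> with the \<open>f\<close>-coordinate of \<open>D f\<close>.  Five
  parameters remain, three of which belong to inner derivations.
\<close>

lemma W_triple_derivation:
  assumes W: "W_triple e f h" and D: "D e \<in> span {e, f, h}" "D f \<in> span {e, f, h}"
    and Dh: "D h = D e \<bullet> f + e \<bullet> D f" and De: "D e = D h \<bullet> e + h \<bullet> D e"
  obtains p a b where "p \<in> span {e, f, h}" "D e = p \<bullet> e + b *s f" "D f = p \<bullet> f + a *s e" "D h = p \<bullet> h"
proof -
  note [simp] = W_tripleD[OF W]
  obtain a b c where e: "D e = a *s e + b *s f + c *s h" using D span_triple by blast
  obtain a' b' c' where f: "D f = a' *s e + b' *s f + c' *s h" using D span_triple by blast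
  have h: "D h = (a + b') *s h + c' *s e + c *s f"
    unfolding Dh e f by (simp add: scale_left_distrib ac_simps)
  have "D e = b' *s e + b *s f + c *s h"
    by (subst De, subst e, subst h) (simp add: scale_left_distrib ac_simps)
  then have "(a + b') *s e + 0 *s f + 0 *s h = 0"
    unfolding e by (simp add: scale_left_distrib add_eq_0)
  then have "a = b'" using W_triple_coordinates(1)[OF W] field_add_eq_0 by blast
  define p where "p = c' *s e + c *s f + a *s h"
  show ?thesis
  proof
    show "p \<in> span {e, f, h}" unfolding p_def span_triple by blast
    show "D e = p \<bullet> e + b *s f" unfolding p_def e by (simp add: ac_simps)
    show "D f = p \<bullet> f + a' *s e" unfolding p_def f \<open>a = b'\<close> by (simp add: ac_simps)
    show "D h = p \<bullet> h" unfolding p_def h \<open>a = b'\<close> by (simp add: ac_simps)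
  qed
qed

text \<open>
  Extend the triple to a basis and correct each of the two new vectors by the element \<open>p\<close> of
  \<open>W_triple_derivation\<close>.
\<close>

lemma exists_complement:
  assumes W: "W_triple e f h" and ideal: "\<And>x. x \<in> V \<Longrightarrow> x \<bullet> e \<in> span {e, f, h} \<and> x \<bullet> f \<in> span {e, f, h}"
    and B: "independent B" "B \<subseteq> V" "card B = 5" "V \<subseteq> span B"
  obtains y1 y2 a1 b1 a2 b2 where "basis5 e f h y1 y2"
    "y1 \<bullet> h = 0" "y1 \<bullet> e = b1 *s f" "y1 \<bullet> f = a1 *s e"
    "y2 \<bullet> h = 0" "y2 \<bullet> e = b2 *s f" "y2 \<bullet> f = a2 *s e"
proof -
  note found = that
  note [simp] = W_tripleD[OF W]
  have correct: "\<exists>p a b. p \<in> span {e, f, h} \<and> z + p \<in> V \<and> (z + p) \<bullet> h = 0 \<and> (z + p) \<bullet> e = b *s f \<and> (z + p) \<bullet> f = a *s e"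
    if z: "z \<in> V" for z
  proof -
    have "z \<bullet> h = (z \<bullet> e) \<bullet> f + e \<bullet> (z \<bullet> f)" using jacobi_right[of z e f] z by simp
    moreover have "z \<bullet> e = (z \<bullet> h) \<bullet> e + h \<bullet> (z \<bullet> e)" using jacobi_right[of z h e] z by simp
    ultimately obtain p a b where p: "p \<in> span {e, f, h}" "z \<bullet> e = p \<bullet> e + b *s f" "z \<bullet> f = p \<bullet> f + a *s e" "z \<bullet> h = p \<bullet> h"
      using W_triple_derivation[OF W, of "brk L z"] ideal[OF z] by metis
    have "p \<in> V" using p(1) span_minimal[of "{e, f, h}" V] subspace_carr by auto
    then have "(z + p) \<bullet> h = 0" "(z + p) \<bullet> e = b *s f" "(z + p) \<bullet> f = a *s e"
      using z p by (simp_all add: ac_simps)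
    moreover have "z + p \<in> V" using \<open>p \<in> V\<close> z by simp
    ultimately show ?thesis using p(1) by metis
  qed
  have finB: "finite B" using B(3) card.infinite by fastforce
  have "{e, f, h} \<subseteq> V" by simp
  then obtain C where C: "{e, f, h} \<subseteq> C" "C \<subseteq> V" "independent C" "V \<subseteq> span C" "finite C" "card C \<le> card B"
    using independent_extend_card[OF B(4) finB _ W_triple_independent(1)[OF W]] by metis
  have "card B \<le> card C" using independent_span_bound[OF C(5) B(1)] C(4) B(2) by blast
  then have "card C = 5" using C(6) B(3) by simp
  then have "card (C - {e, f, h}) = 2"
    using C(1) W_triple_independent(2)[OF W] by (simp add: card_Diff_subset)
  then obtain z1 z2 where "C - {e, f, h} = {z1, z2}" unfolding card_2_iff by blast
  then have C': "C = {e, f, h, z1, z2}" using C(1) by blast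
  then have z: "z1 \<in> V" "z2 \<in> V" using C(2) by auto
  obtain p1 a1 b1 where 1: "p1 \<in> span {e, f, h}" "z1 + p1 \<in> V" "(z1 + p1) \<bullet> h = 0" "(z1 + p1) \<bullet> e = b1 *s f" "(z1 + p1) \<bullet> f = a1 *s e"
    using correct[OF z(1)] by blast
  obtain p2 a2 b2 where 2: "p2 \<in> span {e, f, h}" "z2 + p2 \<in> V" "(z2 + p2) \<bullet> h = 0" "(z2 + p2) \<bullet> e = b2 *s f" "(z2 + p2) \<bullet> f = a2 *s e"
    using correct[OF z(2)] by blast
  let ?S = "{e, f, h, z1 + p1, z2 + p2}"
  have sub: "{e, f, h} \<subseteq> span ?S" by (auto intro: span_base)
  then have "p1 \<in> span ?S" "p2 \<in> span ?S" using 1(1) 2(1) span_minimal[OF sub subspace_span] by blast+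
  moreover have "z1 + p1 \<in> span ?S" "z2 + p2 \<in> span ?S" by (auto intro: span_base)
  ultimately have "(z1 + p1) + p1 \<in> span ?S" "(z2 + p2) + p2 \<in> span ?S" by (blast intro: span_add)+
  then have "C \<subseteq> span ?S" using sub unfolding C' by (simp add: add.assoc)
  then have "V \<subseteq> span ?S" using C(4) span_minimal[of C "span ?S"] by blast
  then have "basis5 e f h (z1 + p1) (z2 + p2)"
    using 1 2 by (intro basis5I_spanning[OF B(1-3)]) auto
  then show ?thesis using found 1 2 by blast
qed

end

context lie_perfect_field
begin

text \<open>
  The multiplication tables of \<open>W_line \<delta>\<close> and \<open>W'_plane \<delta>\<close> with respect to the bases
  \<open>\<partial>, x\<partial>, x\<^sup>(\<^sup>2\<^sup>)\<partial>, x\<^sup>(\<^sup>3\<^sup>)\<partial>, u\<close> and \<open>\<partial>, x\<partial>, x\<^sup>(\<^sup>2\<^sup>)\<partial>, h, u\<close>; here \<open>y\<close> plays the role of \<open>x\<^sup>(\<^sup>3\<^sup>)\<partial>\<close>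
  and of the second \<open>h\<close>.
\<close>

definition W_line_frame :: "'k \<Rightarrow> 'v \<Rightarrow> 'v \<Rightarrow> 'v \<Rightarrow> 'v \<Rightarrow> 'v \<Rightarrow> bool" where
  "W_line_frame \<delta> f h e y u \<longleftrightarrow> basis5 f h e y u \<and> W_triple e f h \<and> y \<bullet> f = e \<and> y \<bullet> h = 0 \<and> y \<bullet> e = 0 \<and>
     u \<bullet> f = 0 \<and> u \<bullet> h = 0 \<and> u \<bullet> e = 0 \<and> y \<bullet> u = \<delta> *s u"

definition W'_plane_frame :: "'k \<Rightarrow> 'v \<Rightarrow> 'v \<Rightarrow> 'v \<Rightarrow> 'v \<Rightarrow> 'v \<Rightarrow> bool" where
  "W'_plane_frame \<delta> f h e y u \<longleftrightarrow> basis5 f h e y u \<and> W_triple e f h \<and> y \<bullet> f = 0 \<and> y \<bullet> h = 0 \<and> y \<bullet> e = 0 \<and>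
     u \<bullet> f = 0 \<and> u \<bullet> h = 0 \<and> u \<bullet> e = 0 \<and> y \<bullet> u = \<delta> *s u"

lemma basis5_of_W_triple:
  assumes B: "finite B" "V \<subseteq> span B" "card B = 5" and W: "W_triple e f h"
    and y: "y \<in> V" "y \<bullet> h = 0" "y \<bullet> e = 0" and u: "u \<in> V" "u \<bullet> h = 0" "u \<bullet> e = 0"
    and yu: "\<And>s t. s *s y + t *s u = 0 \<Longrightarrow> s = 0 \<and> t = 0"
  shows "basis5 f h e y u"
proof (rule basis5I_independent[OF B])
  note [simp] = W_tripleD[OF W] y u
  show "{f, h, e, y, u} \<subseteq> V" by simp
  fix \<beta> \<gamma> \<alpha> s t
  assume 0: "\<beta> *s f + \<gamma> *s h + \<alpha> *s e + s *s y + t *s u = 0" (is "?x = 0")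
  have "?x \<bullet> h = \<alpha> *s e + \<beta> *s f + 0 *s h" by (simp add: ac_simps)
  then have z: "\<alpha> = 0" "\<beta> = 0" using 0 W_triple_coordinates[OF W, of \<alpha> \<beta> 0] by simp_all
  have "?x \<bullet> e = \<gamma> *s e + 0 *s f + 0 *s h" using z by simp
  then have "\<gamma> = 0" using 0 W_triple_coordinates[OF W, of \<gamma> 0 0] by simp
  then show "\<beta> = 0 \<and> \<gamma> = 0 \<and> \<alpha> = 0 \<and> s = 0 \<and> t = 0" using 0 z yu[of s t] by simp
qed

lemma basis5_dim:
  assumes "basis5 a b c d e"
  shows "finite {a, b, c, d, e}" "V \<subseteq> span {a, b, c, d, e}" "card {a, b, c, d, e} = 5"
proof -
  have ind: "\<And>r s t u v. r *s a + s *s b + t *s c + u *s d + v *s e = 0 \<Longrightarrow> r = 0 \<and> s = 0 \<and> t = 0 \<and> u = 0 \<and> v = 0"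
    using assms unfolding basis5_def by blast
  have "a \<noteq> b" "a \<noteq> c" "a \<noteq> d" "a \<noteq> e" "b \<noteq> c" "b \<noteq> d" "b \<noteq> e" "c \<noteq> d" "c \<noteq> e" "d \<noteq> e"
    using ind[of 1 1 0 0 0] ind[of 1 0 1 0 0] ind[of 1 0 0 1 0] ind[of 1 0 0 0 1] ind[of 0 1 1 0 0]
      ind[of 0 1 0 1 0] ind[of 0 1 0 0 1] ind[of 0 0 1 1 0] ind[of 0 0 1 0 1] ind[of 0 0 0 1 1] by auto
  then show "card {a, b, c, d, e} = 5" by simp
qed (use assms in \<open>simp_all add: basis5_def\<close>)

text \<open>
  The bracket \<open>[y1, y2]\<close> centralises the triple, and the centraliser is the span of \<open>y1, y2\<close>, so this
  span is a Lie algebra of dimension 2: it is abelian, or spanned by \<open>y\<close> and \<open>u\<close> with \<open>[y, u] = u\<close>.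
\<close>

lemma outer_rank_0:
  assumes W: "W_triple e f h" and b: "basis5 e f h y1 y2"
    and 1: "y1 \<bullet> h = 0" "y1 \<bullet> e = 0" "y1 \<bullet> f = 0"
    and 2: "y2 \<bullet> h = 0" "y2 \<bullet> e = 0" "y2 \<bullet> f = 0"
  obtains \<delta> y u where "\<delta> \<in> {0, 1}" "W'_plane_frame \<delta> f h e y u"
proof -
  note found = that
  note [simp] = W_tripleD[OF W] 1 2
  have [simp]: "y1 \<in> V" "y2 \<in> V" using b unfolding basis5_def by auto
  have [simp]: "h \<bullet> y1 = 0" "e \<bullet> y1 = 0" "f \<bullet> y1 = 0" "h \<bullet> y2 = 0" "e \<bullet> y2 = 0" "f \<bullet> y2 = 0"
    using brk_comm[of _ y1] brk_comm[of _ y2] by simp_all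
  obtain \<alpha> \<beta> \<gamma> s t where yy: "y1 \<bullet> y2 = \<alpha> *s e + \<beta> *s f + \<gamma> *s h + s *s y1 + t *s y2"
    by (rule basis5_coordinates[OF b, of "y1 \<bullet> y2"]) simp
  have cen: "(y1 \<bullet> y2) \<bullet> x = 0" if "x \<in> {e, f, h}" for x using that by (auto simp: jacobi_left)
  have "0 = (y1 \<bullet> y2) \<bullet> h" using cen by simp
  also have "\<dots> = \<alpha> *s e + \<beta> *s f + 0 *s h" unfolding yy by (simp add: ac_simps)
  finally have z: "\<alpha> = 0" "\<beta> = 0" using W_triple_coordinates[OF W, of \<alpha> \<beta> 0] by simp_all
  have "0 = (y1 \<bullet> y2) \<bullet> e" using cen by simp
  also have "\<dots> = \<gamma> *s e + 0 *s f + 0 *s h" unfolding yy using z by (simp add: ac_simps)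
  finally have "\<gamma> = 0" using W_triple_coordinates[OF W, of \<gamma> 0 0] by simp_all
  then have yy: "y1 \<bullet> y2 = s *s y1 + t *s y2" using yy z by simp
  have ind: "p = 0 \<and> q = 0" if "p *s y1 + q *s y2 = 0" for p q
  proof -
    have "0 *s e + 0 *s f + 0 *s h + p *s y1 + q *s y2 = 0" using that by simp
    then show ?thesis using b unfolding basis5_def by blast
  qed
  show ?thesis
  proof (cases "s = 0 \<and> t = 0")
    case True
    have "basis5 f h e y1 y2"
      by (rule basis5_of_W_triple[OF basis5_dim[OF b] W]) (use ind in simp_all)
    then have "W'_plane_frame 0 f h e y1 y2" unfolding W'_plane_frame_def using W yy True by simp
    then show ?thesis using found by blast
  next
    case False
    define u where "u = s *s y1 + t *s y2"
    have u0: "u \<noteq> 0" using ind[of s t] False u_def by auto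
    have [simp]: "u \<in> V" "u \<bullet> e = 0" "u \<bullet> f = 0" "u \<bullet> h = 0" unfolding u_def by simp_all
    have "\<exists>y. y \<in> V \<and> y \<bullet> e = 0 \<and> y \<bullet> f = 0 \<and> y \<bullet> h = 0 \<and> y \<bullet> u = u"
    proof (cases "s = 0")
      case True
      then have "t \<noteq> 0" using False by simp
      then have "(inverse t *s y1) \<bullet> u = u" using True unfolding u_def by (simp add: yy)
      then show ?thesis by (intro exI[of _ "inverse t *s y1"]) simp
    next
      case False
      have "y2 \<bullet> y1 = u" using yy brk_comm[of y2 y1] u_def by simp
      then have "(inverse s *s y2) \<bullet> u = u" using False unfolding u_def by simp
      then show ?thesis by (intro exI[of _ "inverse s *s y2"]) simp
    qed
    then obtain y where y: "y \<in> V" "y \<bullet> e = 0" "y \<bullet> f = 0" "y \<bullet> h = 0" "y \<bullet> u = u" by blast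
    have "basis5 f h e y u"
    proof (rule basis5_of_W_triple[OF basis5_dim[OF b] W])
      fix p q assume 0: "p *s y + q *s u = 0"
      have "y \<bullet> (p *s y + q *s u) = q *s u" using y by simp
      then have q: "q = 0" using 0 u0 y by simp
      moreover have "y \<noteq> 0" using y(5) u0 by auto
      ultimately show "p = 0 \<and> q = 0" using 0 by simp
    qed (use y in simp_all)
    then have "W'_plane_frame 1 f h e y u" unfolding W'_plane_frame_def using W y by simp
    then show ?thesis using found by blast
  qed
qed

text \<open>
  Let \<open>a = pa^2\<close> and \<open>b = pb^2\<close>.  On the span of \<open>e, f\<close> the element \<open>y1 = y + pa pb h\<close> acts nilpotently,
  with image spanned by \<open>e1 = pa e + pb f\<close>; choosing \<open>f1\<close> with \<open>[e1, f1] = h\<close> one gets \<open>[y1, f1] = e1\<close>, as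
  for \<open>x\<^sup>(\<^sup>3\<^sup>)\<partial>\<close>.  If \<open>[y, u] = \<delta> u\<close> with \<open>\<delta> \<noteq> 0\<close>, then the substitution \<open>y1 \<mapsto> l^2 y1\<close>, \<open>e1 \<mapsto> l e1\<close>,
  \<open>f1 \<mapsto> f1 / l\<close> preserves the table and, for \<open>l^2 = 1 / \<delta>\<close>, replaces \<open>\<delta>\<close> by 1.
\<close>

lemma outer_rank_1:
  assumes W: "W_triple e f h" and b: "basis5 e f h y u"
    and 1: "y \<bullet> h = 0" "y \<bullet> e = b *s f" "y \<bullet> f = a *s e" and nz: "a \<noteq> 0 \<or> b \<noteq> 0"
    and 2: "u \<bullet> h = 0" "u \<bullet> e = 0" "u \<bullet> f = 0"
  obtains \<delta> e' f' y' where "\<delta> \<in> {0, 1}" "W_line_frame \<delta> f' h e' y' u"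
proof -
  note found = that
  note [simp] = W_tripleD[OF W] 1 2
  have [simp]: "y \<in> V" "u \<in> V" using b unfolding basis5_def by auto
  have [simp]: "h \<bullet> u = 0" "e \<bullet> u = 0" "f \<bullet> u = 0" using brk_comm[of _ u] by simp_all
  have [simp]: "h \<bullet> y = 0" using brk_comm[of h y] by simp
  have uniq: "r = 0 \<and> s = 0 \<and> t = 0 \<and> p = 0 \<and> q = 0" if "r *s e + s *s f + t *s h + p *s y + q *s u = 0" for r s t p q
    using b that unfolding basis5_def by blast
  have u0: "u \<noteq> 0" using uniq[of 0 0 0 0 1] by auto
  \<comment> \<open>As \<open>[y, u]\<close> centralises the triple, it is a multiple of \<open>u\<close>.\<close>
  obtain \<alpha> \<beta> \<gamma> s \<delta> where yu: "y \<bullet> u = \<alpha> *s e + \<beta> *s f + \<gamma> *s h + s *s y + \<delta> *s u"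
    by (rule basis5_coordinates[OF b, of "y \<bullet> u"]) simp
  have cen: "(y \<bullet> u) \<bullet> x = 0" if "x \<in> {e, f, h}" for x using that by (auto simp: jacobi_left)
  have "0 = (y \<bullet> u) \<bullet> h" using cen by simp
  also have "\<dots> = \<alpha> *s e + \<beta> *s f + 0 *s h" unfolding yu by (simp add: ac_simps)
  finally have z: "\<alpha> = 0" "\<beta> = 0" using W_triple_coordinates[OF W, of \<alpha> \<beta> 0] by simp_all
  have "0 = (y \<bullet> u) \<bullet> e" using cen by simp
  also have "\<dots> = \<gamma> *s e + (s * b) *s f + 0 *s h" unfolding yu using z by (simp add: ac_simps)
  finally have z2: "\<gamma> = 0" "s * b = 0" using W_triple_coordinates[OF W, of \<gamma> "s * b" 0] by simp_all
  have "0 = (y \<bullet> u) \<bullet> f" using cen by simp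
  also have "\<dots> = (s * a) *s e + 0 *s f + 0 *s h" unfolding yu using z z2 by (simp add: ac_simps)
  finally have "s * a = 0" using W_triple_coordinates[OF W, of "s * a" 0 0] by simp_all
  then have "s = 0" using z2 nz by auto
  then have yu: "y \<bullet> u = \<delta> *s u" using yu z z2 by simp
  obtain pa where pa: "a = pa * pa" using sqrt_exists[of a] by metis
  obtain pb where pb: "b = pb * pb" using sqrt_exists[of b] by metis
  define e1 where "e1 = pa *s e + pb *s f"
  define y1 where "y1 = y + (pa * pb) *s h"
  have [simp]: "e1 \<in> V" "y1 \<in> V" unfolding e1_def y1_def by simp_all
  have y1: "y1 \<bullet> e = pb *s e1" "y1 \<bullet> f = pa *s e1" "y1 \<bullet> h = 0" "y1 \<bullet> u = \<delta> *s u"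
    unfolding y1_def e1_def using yu pa pb by (simp_all add: scale_right_distrib ac_simps)
  have y1e1: "y1 \<bullet> e1 = 0" unfolding e1_def by (simp add: y1 mult.commute)
  have "\<exists>f1. f1 \<in> V \<and> e1 \<bullet> f1 = h \<and> h \<bullet> f1 = f1 \<and> y1 \<bullet> f1 = e1 \<and> u \<bullet> f1 = 0"
  proof (cases "pb = 0")
    case True
    then have "pa \<noteq> 0" using nz pa pb by auto
    then show ?thesis using True y1
      by (intro exI[of _ "inverse pa *s f"]) (simp, simp add: e1_def)
  next
    case False
    then show ?thesis using y1
      by (intro exI[of _ "inverse pb *s e"]) (simp, simp add: e1_def)
  qed
  then obtain f1 where f1: "f1 \<in> V" "e1 \<bullet> f1 = h" "h \<bullet> f1 = f1" "y1 \<bullet> f1 = e1" "u \<bullet> f1 = 0" by blast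
  have he1: "h \<bullet> e1 = e1" "u \<bullet> e1 = 0" unfolding e1_def by simp_all
  have frame: "W_line_frame (c * \<delta>) (inverse l *s f1) h (l *s e1) (c *s y1) u" if l: "l \<noteq> 0" "l * l = c" for l c
  proof -
    have W1: "W_triple (l *s e1) (inverse l *s f1) h" unfolding W_triple_def using f1 he1 l by simp
    have c: "c * inverse l = l" using l by (auto simp: field_simps)
    have t: "(c *s y1) \<bullet> (inverse l *s f1) = l *s e1" using f1 c by (simp add: mult.commute)
    have "basis5 (inverse l *s f1) h (l *s e1) (c *s y1) u"
    proof (rule basis5_of_W_triple[OF basis5_dim[OF b] W1])
      fix p q assume 0: "p *s c *s y1 + q *s u = 0"
      have "(p * c) *s e1 = (p *s c *s y1 + q *s u) \<bullet> f1" using f1 by simp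
      also have "\<dots> = 0" unfolding 0 using f1(1) by simp
      finally have "p * c = 0 \<or> e1 = 0" by simp
      moreover have "c \<noteq> 0" using l by auto
      moreover have "e1 \<noteq> 0" using f1(1,2) W_tripleD(4)[OF W] by auto
      ultimately have "p = 0" by simp
      then show "p = 0 \<and> q = 0" using 0 u0 by simp
    qed (use he1 y1 y1e1 in simp_all)
    then show ?thesis unfolding W_line_frame_def using W1 t f1 he1 y1 y1e1 by simp
  qed
  show ?thesis
  proof (cases "\<delta> = 0")
    case True
    then show ?thesis using found[of 0] frame[of 1 1] by simp
  next
    case False
    obtain l where l: "l * l = inverse \<delta>" using sqrt_exists by blast
    then have "l \<noteq> 0" using False by auto
    then show ?thesis using found[of 1] frame[OF _ l] False by simp
  qed
qed

text \<open>
  If the determinant \<open>b1 a2 + b2 a1\<close> vanishes, then a combination of \<open>y1\<close> and \<open>y2\<close> centralises the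
  triple.
\<close>

theorem complement_cases:
  assumes W: "W_triple e f h" and ideal: "\<And>x. x \<in> V \<Longrightarrow> x \<bullet> e \<in> span {e, f, h} \<and> x \<bullet> f \<in> span {e, f, h}"
    and B: "independent B" "B \<subseteq> V" "card B = 5" "V \<subseteq> span B"
  obtains (full) y1 y2 a1 b1 a2 b2 where "basis5 e f h y1 y2"
    "y1 \<bullet> h = 0" "y1 \<bullet> e = b1 *s f" "y1 \<bullet> f = a1 *s e"
    "y2 \<bullet> h = 0" "y2 \<bullet> e = b2 *s f" "y2 \<bullet> f = a2 *s e" "b1 * a2 + b2 * a1 \<noteq> 0"
  | (line) \<delta> f' h' e' y u where "\<delta> \<in> {0, 1}" "W_line_frame \<delta> f' h' e' y u"
  | (plane) \<delta> f' h' e' y u where "\<delta> \<in> {0, 1}" "W'_plane_frame \<delta> f' h' e' y u"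
proof -
  note [simp] = W_tripleD[OF W]
  obtain y1 y2 a1 b1 a2 b2 where b: "basis5 e f h y1 y2"
    and 1: "y1 \<bullet> h = 0" "y1 \<bullet> e = b1 *s f" "y1 \<bullet> f = a1 *s e"
    and 2: "y2 \<bullet> h = 0" "y2 \<bullet> e = b2 *s f" "y2 \<bullet> f = a2 *s e"
    by (rule exists_complement[OF W ideal B])
  have rank1: thesis
    if b: "basis5 e f h y1 y2" and det: "b1 * a2 + b2 * a1 = 0" and nz: "a1 \<noteq> 0 \<or> b1 \<noteq> 0"
    and 1: "y1 \<bullet> h = 0" "y1 \<bullet> e = b1 *s f" "y1 \<bullet> f = a1 *s e"
    and 2: "y2 \<bullet> h = 0" "y2 \<bullet> e = b2 *s f" "y2 \<bullet> f = a2 *s e" for y1 y2 a1 b1 a2 b2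
  proof -
    have yV [simp]: "y1 \<in> V" "y2 \<in> V" using b unfolding basis5_def by auto
    have det': "b1 * a2 = b2 * a1" using det field_add_eq_0 by blast
    have "\<exists>t. t * b1 = b2 \<and> t * a1 = a2"
    proof (cases "b1 = 0")
      case True
      then show ?thesis using det' nz by (intro exI[of _ "a2 / a1"]) auto
    next
      case False
      then show ?thesis using det' by (intro exI[of _ "b2 / b1"]) (auto simp: field_simps)
    qed
    then obtain t where t: "b2 = t * b1" "a2 = t * a1" by metis
    define u where "u = y2 + t *s y1"
    have u: "u \<in> V" "u \<bullet> h = 0" "u \<bullet> e = 0" "u \<bullet> f = 0" unfolding u_def using 1 2 t by simp_all
    have "basis5 e f h y1 u"
    proof (rule basis5I_independent[OF basis5_dim[OF b]])
      show "{e, f, h, y1, u} \<subseteq> V" using u by simp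
      fix r s q p v
      assume "r *s e + s *s f + q *s h + p *s y1 + v *s u = 0"
      then have "r *s e + s *s f + q *s h + (p + v * t) *s y1 + v *s y2 = 0"
        unfolding u_def by (simp add: scale_left_distrib scale_right_distrib ac_simps)
      then have "r = 0 \<and> s = 0 \<and> q = 0 \<and> p + v * t = 0 \<and> v = 0" using b unfolding basis5_def by blast
      then show "r = 0 \<and> s = 0 \<and> q = 0 \<and> p = 0 \<and> v = 0" by auto
    qed
    then show thesis by (rule outer_rank_1[OF W _ 1 nz u(2-4)]) (rule line)
  qed
  show thesis
  proof (cases "b1 * a2 + b2 * a1 = 0")
    case False
    show thesis by (rule full[OF b 1 2 False])
  next
    case det: True
    consider "a1 \<noteq> 0 \<or> b1 \<noteq> 0" | "a2 \<noteq> 0 \<or> b2 \<noteq> 0" | "a1 = 0" "b1 = 0" "a2 = 0" "b2 = 0" by blast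
    then show thesis
    proof cases
      case 1
      then show ?thesis by (rule rank1[OF b det _ \<open>y1 \<bullet> h = 0\<close> \<open>y1 \<bullet> e = b1 *s f\<close> \<open>y1 \<bullet> f = a1 *s e\<close> 2])
    next
      case c: 2
      have "V \<subseteq> span {e, f, h, y2, y1}" "{e, f, h, y2, y1} \<subseteq> V"
        using b unfolding basis5_def by (simp_all add: insert_commute)
      then have b': "basis5 e f h y2 y1" by (intro basis5I_spanning[OF B(1-3)])
      show ?thesis by (rule rank1[OF b' _ c 2 1]) (use det in \<open>simp add: ac_simps\<close>)
    next
      case 3
      show ?thesis by (rule outer_rank_0[OF W b]) (use 1 2 3 plane in auto)
    qed
  qed
qed

end

section \<open>The model algebras\<close>

lemma lie_iso_inverse:
  assumes M: "lie_algebra M" and \<phi>: "lie_iso \<phi> M L"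
  shows "L \<cong>\<^sub>L M"
proof -
  interpret M: lie_algebra M by (rule M)
  let ?\<psi> = "inv_into (carr M) \<phi>"
  have bij: "bij_betw \<phi> (carr M) (carr L)" using \<phi> unfolding lie_iso_def by blast
  have \<psi>: "?\<psi> x \<in> carr M" "\<phi> (?\<psi> x) = x" if "x \<in> carr L" for x
    using that bij by (auto simp: bij_betw_def inv_into_into f_inv_into_f)
  have \<psi>I: "?\<psi> x = y" if "y \<in> carr M" "\<phi> y = x" for x y
    using that bij by (auto simp: bij_betw_def)
  have "lie_iso ?\<psi> L M"
    unfolding lie_iso_def
  proof (intro conjI ballI allI)
    show "bij_betw ?\<psi> (carr L) (carr M)" using bij by (rule bij_betw_inv_into)
    fix x y c assume x: "x \<in> carr L"
    show "?\<psi> (smul L c x) = smul M c (?\<psi> x)"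
      using \<psi>[OF x] \<phi> M.subspace_scale[OF M.subspace_carr] unfolding lie_iso_def by (intro \<psi>I) auto
    assume y: "y \<in> carr L"
    show "?\<psi> (x + y) = ?\<psi> x + ?\<psi> y"
      using \<psi>[OF x] \<psi>[OF y] \<phi> M.subspace_add[OF M.subspace_carr] unfolding lie_iso_def by (intro \<psi>I) auto
    show "?\<psi> (brk L x y) = brk M (?\<psi> x) (?\<psi> y)"
      using \<psi>[OF x] \<psi>[OF y] \<phi> M.brk_closed unfolding lie_iso_def by (intro \<psi>I) auto
  qed
  then show ?thesis unfolding isomorphic_def by blast
qed

context char2_field
begin

lemma two_three [simp]: "(2::'k) = 0" "(3::'k) = 1"
proof -
  show "(2::'k) = 0" using char_two by (simp only: one_add_one)
  then have "(2::'k) + 1 = 1" by (simp only: add_0)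
  then show "(3::'k) = 1" by simp
qed

lemma smul_W12: "smul W12 c f = (\<lambda>r. c * f r)" by (simp add: W12_def)
lemma carr_W12: "carr W12 = O12" by (simp add: W12_def)

text \<open>
  Over the integers the coordinate at \<open>x\<^sup>(\<^sup>3\<^sup>)\<close> is \<open>2 (f 1 g 3 - f 3 g 1)\<close>.  In characteristic 2 it vanishes, so a
  bracket never involves \<open>x\<^sup>(\<^sup>3\<^sup>)\<partial>\<close>.
\<close>

lemma brk_W12:
  assumes "f \<in> O12" "g \<in> O12"
  shows "brk W12 f g = (\<lambda>n. if n = 0 then f 0 * g 1 + f 1 * g 0 else if n = 1 then f 0 * g 2 + f 2 * g 0
     else if n = 2 then f 0 * g 3 + f 3 * g 0 + f 1 * g 2 + f 2 * g 1 else (0::'k))"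
proof
  fix n :: nat
  have 4: "f 4 = 0" "g 4 = 0" using assms unfolding O12_def by auto
  have ev: "{..0::nat} = {0}" "{..1::nat} = {0,1}" "{..2::nat} = {0,1,2}" "{..3::nat} = {0,1,2,3}" by auto
  have ch: "(2::nat) choose 1 = 2" "(3::nat) choose 1 = 3" "(3::nat) choose 2 = 3" by (simp_all add: numeral_eq_Suc)
  have "n = 0 \<or> n = 1 \<or> n = 2 \<or> n = 3 \<or> n \<ge> 4" by linarith
  then show "brk W12 f g n = (if n = 0 then f 0 * g 1 + f 1 * g 0 else if n = 1 then f 0 * g 2 + f 2 * g 0
     else if n = 2 then f 0 * g 3 + f 3 * g 0 + f 1 * g 2 + f 2 * g 1 else 0)"
    by (elim disjE) (use 4 ch in \<open>simp_all add: W12_def dp_mult_def dp_deriv_def ev ac_simps numeral_2_eq_2[symmetric] numeral_3_eq_3[symmetric] eval_nat_numeral(3)[symmetric]\<close>)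
qed

lemma brk_W12_in: "f \<in> O12 \<Longrightarrow> g \<in> O12 \<Longrightarrow> brk W12 f (g :: nat \<Rightarrow> 'k) \<in> O12"
  by (simp add: brk_W12 O12_def)

lemma vector_space_pointwise: "vector_space (\<lambda>c (f :: nat \<Rightarrow> 'k) r. c * f r)"
  by unfold_locales (auto simp: algebra_simps fun_eq_iff)

lemma lie_W12: "lie_char2 (W12 :: ('k, nat \<Rightarrow> 'k) lie_data)"
proof (intro lie_char2.intro lie_algebra.intro lie_algebra_axioms.intro char2_field_axioms)
  show vs: "vector_space (smul (W12 :: ('k, nat \<Rightarrow> 'k) lie_data))"
    using vector_space_pointwise by (simp add: W12_def)
  interpret vector_space "smul (W12 :: ('k, nat \<Rightarrow> 'k) lie_data)" by (rule vs)
  show "subspace (carr W12)" by (auto simp: subspace_def carr_W12 smul_W12 O12_def)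
  have O [simp]: "f + g \<in> O12" "(\<lambda>r. c * f r) \<in> O12" "brk W12 f g \<in> O12" if "f \<in> O12" "g \<in> O12" for f g :: "nat \<Rightarrow> 'k" and c
    using that brk_W12_in by (auto simp: O12_def)
  fix f g h :: "nat \<Rightarrow> 'k" and c :: 'k
  assume f: "f \<in> carr W12"
  then have [simp]: "f \<in> O12" by (simp add: carr_W12)
  show "brk W12 f f = 0" by (auto simp: brk_W12 fun_eq_iff algebra_simps)
  assume g: "g \<in> carr W12"
  then have [simp]: "g \<in> O12" by (simp add: carr_W12)
  show "brk W12 f g \<in> carr W12" by (simp add: carr_W12)
  show "brk W12 (smul W12 c f) g = smul W12 c (brk W12 f g)" "brk W12 f (smul W12 c g) = smul W12 c (brk W12 f g)"
    using O(2)[of f f c] O(2)[of g g c] by (auto simp: smul_W12 brk_W12 fun_eq_iff algebra_simps)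
  assume h: "h \<in> carr W12"
  then have [simp]: "h \<in> O12" by (simp add: carr_W12)
  show "brk W12 (f + g) h = brk W12 f h + brk W12 g h" "brk W12 f (g + h) = brk W12 f g + brk W12 f h"
    by (auto simp: brk_W12 fun_eq_iff algebra_simps)
  have "brk W12 f (brk W12 g h) + brk W12 g (brk W12 h f) + brk W12 h (brk W12 f g) = (\<lambda>_. 0)"
    unfolding brk_W12[OF \<open>f \<in> O12\<close> brk_W12_in[OF \<open>g \<in> O12\<close> \<open>h \<in> O12\<close>]]
      brk_W12[OF \<open>g \<in> O12\<close> brk_W12_in[OF \<open>h \<in> O12\<close> \<open>f \<in> O12\<close>]]
      brk_W12[OF \<open>h \<in> O12\<close> brk_W12_in[OF \<open>f \<in> O12\<close> \<open>g \<in> O12\<close>]]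
    by (auto simp: fun_eq_iff brk_W12 algebra_simps)
  then show "brk W12 f (brk W12 g h) + brk W12 g (brk W12 h f) + brk W12 h (brk W12 f g) = 0"
    by (simp add: zero_fun_def)
qed

lemma dp_in_O12 [simp]: "r < 4 \<Longrightarrow> dp r \<in> O12"
  by (auto simp: dp_def O12_def)


lemma brk_dp: 
  "brk W12 (dp 0) (dp 1) = (dp 0 :: nat \<Rightarrow> 'k)" "brk W12 (dp 0) (dp 2) = (dp 1 :: nat \<Rightarrow> 'k)"
  "brk W12 (dp 1) (dp 2) = (dp 2 :: nat \<Rightarrow> 'k)" "brk W12 (dp 0) (dp 3) = (dp 2 :: nat \<Rightarrow> 'k)"
  "brk W12 (dp 1) (dp 3) = (0 :: nat \<Rightarrow> 'k)" "brk W12 (dp 2) (dp 3) = (0 :: nat \<Rightarrow> 'k)"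
  by (auto simp: brk_W12 fun_eq_iff) (simp_all add: dp_def)

lemma carr_W12': "carr W12' = {f :: nat \<Rightarrow> 'k. \<forall>r\<ge>3. f r = 0}"
proof -
  interpret W: lie_char2 "W12 :: ('k, nat \<Rightarrow> 'k) lie_data" by (rule lie_W12)
  let ?S = "{brk W12 x y |x y :: nat \<Rightarrow> 'k. x \<in> carr W12 \<and> y \<in> carr W12}"
  have "W.subspace {f :: nat \<Rightarrow> 'k. \<forall>r\<ge>3. f r = 0}" by (auto simp: W.subspace_def smul_W12)
  then have "W.span ?S \<subseteq> {f. \<forall>r\<ge>3. f r = 0}"
    by (rule W.span_minimal[rotated]) (auto simp: carr_W12 brk_W12)
  moreover have "f \<in> W.span ?S" if "\<forall>r\<ge>3. f r = 0" for f
  proof -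
    have b: "brk W12 (dp i) (dp j) \<in> W.span ?S" if "i < 4" "j < 4" for i j
      using that dp_in_O12 unfolding carr_W12 by (intro W.span_base) blast
    have "dp 0 \<in> W.span ?S" "dp 1 \<in> W.span ?S" "dp 2 \<in> W.span ?S"
      using b[of 0 1] b[of 0 2] b[of 1 2] unfolding brk_dp by simp_all
    then have "smul W12 (f 0) (dp 0) + smul W12 (f 1) (dp 1) + smul W12 (f 2) (dp 2) \<in> W.span ?S"
      by (intro W.span_add W.span_scale)
    also have "smul W12 (f 0) (dp 0) + smul W12 (f 1) (dp 1) + smul W12 (f 2) (dp 2) = f"
    proof
      fix n :: nat
      have "n = 0 \<or> n = 1 \<or> n = 2 \<or> n \<ge> 3" by linarith
      then show "(smul W12 (f 0) (dp 0) + smul W12 (f 1) (dp 1) + smul W12 (f 2) (dp 2)) n = f n"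
        using that by (auto simp: smul_W12 dp_def)
    qed
    finally show ?thesis .
  qed
  ultimately show ?thesis unfolding derived_alg_def restrict_to_def by auto
qed

lemma W12'_O12: "f \<in> carr W12' \<Longrightarrow> (f :: nat \<Rightarrow> 'k) \<in> O12"
  by (auto simp: carr_W12' O12_def)

lemma brk_W12': "brk W12' = (brk W12 :: (nat \<Rightarrow> 'k) \<Rightarrow> _)" and smul_W12': "smul W12' = (smul W12 :: 'k \<Rightarrow> (nat \<Rightarrow> 'k) \<Rightarrow> _)"
  by (simp_all add: derived_alg_def restrict_to_def)

lemma lie_subalgebra_lie_char2:
  assumes L: "lie_char2 (L :: ('k, 'v::ab_group_add) lie_data)" and S: "lie_subalgebra S L"
  shows "lie_char2 (restrict_to L S)"
proof -
  interpret L: lie_char2 L by (rule L)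
  show ?thesis
    using S unfolding restrict_to_def lie_subalgebra_def
    by (intro lie_char2.intro lie_algebra.intro lie_algebra_axioms.intro char2_field_axioms)
      (simp_all add: L.jacobi subset_iff L.vector_space_axioms)
qed

lemma lie_semidirect_by:
  fixes A :: "('k, 'v::ab_group_add) lie_data" and I :: "('k, 'w::ab_group_add) lie_data"
  assumes A: "lie_char2 A" and I: "lie_char2 I"
    and act_in: "\<And>a x. a \<in> carr A \<Longrightarrow> x \<in> carr I \<Longrightarrow> act a x \<in> carr I"
    and act_add: "\<And>a b x. a \<in> carr A \<Longrightarrow> b \<in> carr A \<Longrightarrow> x \<in> carr I \<Longrightarrow> act (a + b) x = act a x + act b x"
      "\<And>a x y. a \<in> carr A \<Longrightarrow> x \<in> carr I \<Longrightarrow> y \<in> carr I \<Longrightarrow> act a (x + y) = act a x + act a y"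
    and act_smul: "\<And>c a x. a \<in> carr A \<Longrightarrow> x \<in> carr I \<Longrightarrow> act (smul A c a) x = smul I c (act a x)"
      "\<And>c a x. a \<in> carr A \<Longrightarrow> x \<in> carr I \<Longrightarrow> act a (smul I c x) = smul I c (act a x)"
    and act_der: "\<And>a x y. a \<in> carr A \<Longrightarrow> x \<in> carr I \<Longrightarrow> y \<in> carr I \<Longrightarrow>
        act a (brk I x y) = brk I (act a x) y + brk I x (act a y)"
    and act_brk: "\<And>a b x. a \<in> carr A \<Longrightarrow> b \<in> carr A \<Longrightarrow> x \<in> carr I \<Longrightarrow>
        act (brk A a b) x = act a (act b x) + act b (act a x)"
  shows "lie_char2 (semidirect_by A act I)" (is "lie_char2 ?M")
proof -
  interpret A: lie_char2 A by (rule A)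
  interpret I: lie_char2 I by (rule I)
  have carr: "carr ?M = carr A \<times> carr I" and smul: "smul ?M = (\<lambda>c (a, x). (smul A c a, smul I c x))"
    and brk: "brk ?M = (\<lambda>(a, x) (b, y). (brk A a b, act a y - act b x + brk I x y))"
    unfolding semidirect_by_def by simp_all
  note act = act_in act_add act_smul act_der act_brk
  have vs: "vector_space (smul ?M)"
    unfolding smul by unfold_locales
      (auto simp: A.scale_right_distrib A.scale_left_distrib I.scale_right_distrib I.scale_left_distrib)
  then interpret M: vector_space "smul ?M" .
  have "M.subspace (carr ?M)"
    unfolding M.subspace_def unfolding carr smul by (auto simp: zero_prod_def)
  then show ?thesis
  proof (intro lie_char2.intro lie_algebra.intro lie_algebra_axioms.intro char2_field_axioms vs)
    fix p q r c
    assume "p \<in> carr ?M"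
    then obtain a x where p: "p = (a, x)" "a \<in> carr A" "x \<in> carr I" unfolding carr by blast
    show "brk ?M p p = 0" unfolding p brk using p by (simp add: zero_prod_def)
    assume "q \<in> carr ?M"
    then obtain b y where q: "q = (b, y)" "b \<in> carr A" "y \<in> carr I" unfolding carr by blast
    show "brk ?M p q \<in> carr ?M" unfolding p q brk carr using p q by (simp add: act)
    show "brk ?M (smul ?M c p) q = smul ?M c (brk ?M p q)" "brk ?M p (smul ?M c q) = smul ?M c (brk ?M p q)"
      unfolding p q brk smul using p q by (simp_all add: act I.scale_right_distrib)
    assume "r \<in> carr ?M"
    then obtain d z where r: "r = (d, z)" "d \<in> carr A" "z \<in> carr I" unfolding carr by blast
    show "brk ?M (p + q) r = brk ?M p r + brk ?M q r" "brk ?M p (q + r) = brk ?M p q + brk ?M p r"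
      unfolding p q r brk using p q r by (simp_all add: act ac_simps)
    have "act a (brk I y z) = brk I (act a y) z + brk I (act a z) y"
      "act b (brk I z x) = brk I (act b z) x + brk I (act b x) z"
      "act d (brk I x y) = brk I (act d x) y + brk I (act d y) x"
      using p q r act_der by (simp_all add: I.brk_comm[of y "act a z"] I.brk_comm[of z "act b x"] I.brk_comm[of x "act d y"] act)
    moreover have "brk I x (act b z) = brk I (act b z) x" "brk I x (act d y) = brk I (act d y) x" 
      "brk I y (act d x) = brk I (act d x) y" "brk I y (act a z) = brk I (act a z) y" 
      "brk I z (act a y) = brk I (act a y) z" "brk I z (act b x) = brk I (act b x) z"
      using p q r by (auto intro: I.brk_comm simp: act)
    ultimately show "brk ?M p (brk ?M q r) + brk ?M q (brk ?M r p) + brk ?M r (brk ?M p q) = 0"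
      unfolding p q r brk using p q r A.jacobi[of a b d] I.jacobi[of x y z]
      by (simp add: act zero_prod_def ac_simps)
  qed
qed

lemma lie_line_alg: "lie_char2 (line_alg :: ('k, 'k) lie_data)"
proof (intro lie_char2.intro lie_algebra.intro lie_algebra_axioms.intro char2_field_axioms)
  show vs: "vector_space (smul (line_alg :: ('k, 'k) lie_data))"
    unfolding line_alg_def by unfold_locales (auto simp: algebra_simps)
  interpret vector_space "smul (line_alg :: ('k, 'k) lie_data)" by (rule vs)
  show "subspace (carr line_alg)" unfolding subspace_def by (simp add: line_alg_def)
qed (simp_all add: line_alg_def)

lemma lie_plane_alg: "lie_char2 (plane_alg \<delta> :: ('k, 'k \<times> 'k) lie_data)"
proof (intro lie_char2.intro lie_algebra.intro lie_algebra_axioms.intro char2_field_axioms)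
  show vs: "vector_space (smul (plane_alg \<delta>))"
    unfolding plane_alg_def by unfold_locales (auto simp: algebra_simps)
  interpret vector_space "smul (plane_alg \<delta>)" by (rule vs)
  show "subspace (carr (plane_alg \<delta>))" unfolding subspace_def by (simp add: plane_alg_def)
qed (auto simp: plane_alg_def zero_prod_def algebra_simps)

lemma lie_W_line: "lie_char2 (W_line \<delta> :: ('k, (nat \<Rightarrow> 'k) \<times> 'k) lie_data)"
  unfolding W_line_def
  by (rule lie_semidirect_by[OF lie_W12 lie_line_alg])
    (auto simp: line_alg_def smul_W12 carr_W12 brk_W12 algebra_simps)

lemma lie_W12': "lie_char2 (W12' :: ('k, nat \<Rightarrow> 'k) lie_data)"
proof -
  interpret W: lie_char2 "W12 :: ('k, nat \<Rightarrow> 'k) lie_data" by (rule lie_W12)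
  have "W.subspace (carr W12')" by (auto simp: W.subspace_def carr_W12' smul_W12)
  then have "lie_subalgebra (carr W12') (W12 :: ('k, nat \<Rightarrow> 'k) lie_data)"
    using W12'_O12 by (auto simp: lie_subalgebra_def carr_W12 brk_W12) (auto simp: carr_W12' brk_W12 W12'_O12)
  from lie_subalgebra_lie_char2[OF lie_W12 this] show ?thesis
    by (simp add: derived_alg_def restrict_to_def)
qed

lemma lie_W'_plane: "lie_char2 (W'_plane \<delta> :: ('k, (nat \<Rightarrow> 'k) \<times> ('k \<times> 'k)) lie_data)"
proof -
  interpret P: lie_char2 "plane_alg \<delta>" by (rule lie_plane_alg)
  show ?thesis unfolding W'_plane_def
    by (rule lie_semidirect_by[OF lie_W12' lie_plane_alg]) simp_all
qed

lemma W_line_simps: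
  "carr (W_line \<delta>) = {(f, c). f \<in> O12}"
  "smul (W_line \<delta>) c (f, d) = ((\<lambda>r. c * f r), c * d)"
  "brk (W_line \<delta>) (f, c) (g, d) = (brk W12 f g, \<delta> * f 3 * d + \<delta> * g 3 * (c::'k))"
  by (auto simp: W_line_def semidirect_by_def line_alg_def W12_def)

lemma W'_plane_simps:
  "carr (W'_plane \<delta>) = {(f, x). f \<in> carr W12'}"
  "smul (W'_plane \<delta>) c (f, (a, b)) = ((\<lambda>r. c * f r), (c * a, c * b))"
  "brk (W'_plane \<delta>) (f, (a, b)) (g, (a', b')) = (brk W12 f g, (0, \<delta> * (a * b' + b * (a'::'k))))"
  by (auto simp: W'_plane_def semidirect_by_def plane_alg_def brk_W12' smul_W12' smul_W12)

end

section \<open>The centraliser of the second derived algebra, and the radical\<close>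

text \<open>
  The centraliser of \<open>L\<^sup>(\<^sup>2\<^sup>)\<close>, defined by equations between brackets, so that its behaviour under
  isomorphisms is immediate.
\<close>

definition second_derived_centraliser :: "('k::field, 'v::ab_group_add) lie_data \<Rightarrow> 'v set" where
  "second_derived_centraliser L = {z \<in> carr L. \<forall>a\<in>carr L. \<forall>b\<in>carr L. \<forall>c\<in>carr L. \<forall>d\<in>carr L.
     brk L z (brk L (brk L a b) (brk L c d)) = 0}"

lemma lie_algebra_closed:
  assumes "lie_algebra L"
  shows "0 \<in> carr L" "\<And>x y. x \<in> carr L \<Longrightarrow> y \<in> carr L \<Longrightarrow> brk L x y \<in> carr L"
proof -
  interpret lie_algebra L by (rule assms)
  show "0 \<in> carr L" "\<And>x y. x \<in> carr L \<Longrightarrow> y \<in> carr L \<Longrightarrow> brk L x y \<in> carr L"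
    using subspace_0[OF subspace_carr] brk_closed by auto
qed

lemma second_derived_centraliser_iso:
  assumes 0: "0 \<in> carr L" and brk_closed: "\<And>x y. x \<in> carr L \<Longrightarrow> y \<in> carr L \<Longrightarrow> brk L x y \<in> carr L"
    and \<phi>: "lie_iso \<phi> L M"
  shows "bij_betw \<phi> (second_derived_centraliser L) (second_derived_centraliser M)"
proof -
  have bij: "bij_betw \<phi> (carr L) (carr M)" 
    and add: "\<And>x y. x \<in> carr L \<Longrightarrow> y \<in> carr L \<Longrightarrow> \<phi> (x + y) = \<phi> x + \<phi> y"
    and hom: "\<And>x y. x \<in> carr L \<Longrightarrow> y \<in> carr L \<Longrightarrow> \<phi> (brk L x y) = brk M (\<phi> x) (\<phi> y)"
    using \<phi> unfolding lie_iso_def by blast+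
  have phi0: "\<phi> 0 = 0" using add[OF 0 0] by simp
  have inj: "inj_on \<phi> (carr L)" and im: "\<phi> ` carr L = carr M" using bij by (auto simp: bij_betw_def)
  have zero_iff: "\<phi> x = 0 \<longleftrightarrow> x = 0" if "x \<in> carr L" for x
    using inj_onD[OF inj, of x 0] that 0 phi0 by auto
  have "\<phi> z \<in> second_derived_centraliser M \<longleftrightarrow> z \<in> second_derived_centraliser L" if z: "z \<in> carr L" for z
  proof -
    have "brk M (\<phi> z) (brk M (brk M (\<phi> a) (\<phi> b)) (brk M (\<phi> c) (\<phi> d))) = 0 \<longleftrightarrow> brk L z (brk L (brk L a b) (brk L c d)) = 0"
      if "a \<in> carr L" "b \<in> carr L" "c \<in> carr L" "d \<in> carr L" for a b c d
      using that z zero_iff[of "brk L z (brk L (brk L a b) (brk L c d))"] by (simp add: hom brk_closed)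
    moreover have "\<phi> z \<in> carr M" using im z by blast
    ultimately show ?thesis
      unfolding second_derived_centraliser_def im[symmetric] using z by (simp add: ball_simps(9))
  qed
  moreover have "second_derived_centraliser L \<subseteq> carr L" "second_derived_centraliser M \<subseteq> carr M"
    unfolding second_derived_centraliser_def by auto
  ultimately have "\<phi> ` second_derived_centraliser L = second_derived_centraliser M"
    unfolding im[symmetric] by blast
  then show ?thesis using inj \<open>second_derived_centraliser L \<subseteq> carr L\<close> unfolding bij_betw_def
    by (metis inj_on_subset)
qed

lemma second_derived_centraliser_central_iso:
  assumes L: "lie_algebra L" and \<phi>: "lie_iso \<phi> L M"
    and "\<forall>z\<in>second_derived_centraliser L. \<forall>x\<in>carr L. brk L z x = 0"
  shows "\<forall>z\<in>second_derived_centraliser M. \<forall>x\<in>carr M. brk M z x = 0"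
proof (intro ballI)
  interpret L: lie_algebra L by (rule L)
  fix z' x' assume "z' \<in> second_derived_centraliser M" "x' \<in> carr M"
  then obtain z x where zx: "z \<in> second_derived_centraliser L" "z' = \<phi> z" "x \<in> carr L" "x' = \<phi> x"
    using second_derived_centraliser_iso[OF lie_algebra_closed[OF L] \<phi>] \<phi> unfolding lie_iso_def bij_betw_def by blast
  have z: "z \<in> carr L" using zx unfolding second_derived_centraliser_def by simp
  have 0: "0 \<in> carr L" using L.subspace_0[OF L.subspace_carr] .
  have "\<phi> (0 + 0) = \<phi> 0 + \<phi> 0" using \<phi> 0 unfolding lie_iso_def by blast
  then have "\<phi> 0 = 0" by simp
  moreover have "brk M z' x' = \<phi> (brk L z x)" using \<phi> zx z unfolding lie_iso_def by auto
  ultimately show "brk M z' x' = 0" using assms(3) zx by simp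
qed

context lie_char2
begin

text \<open>
  So a triple lies in the second derived algebra.
\<close>

lemma W_triple_double_brackets:
  assumes "W_triple e f h"
  shows "(e \<bullet> f) \<bullet> (h \<bullet> e) = e" "(e \<bullet> f) \<bullet> (h \<bullet> f) = f" "(h \<bullet> e) \<bullet> (h \<bullet> f) = h"
  using W_tripleD[OF assms] by simp_all

lemma W_triple_centreless:
  assumes W: "W_triple e f h" and p: "p \<in> span {e, f, h}" "p \<bullet> e = 0" "p \<bullet> f = 0" "p \<bullet> h = 0"
  shows "p = 0"
proof -
  note [simp] = W_tripleD[OF W]
  obtain \<alpha> \<beta> \<gamma> where p': "p = \<alpha> *s e + \<beta> *s f + \<gamma> *s h" using p(1) span_triple by blast
  have "p \<bullet> h = \<alpha> *s e + \<beta> *s f + 0 *s h" "p \<bullet> e = \<gamma> *s e + 0 *s f + \<beta> *s h" unfolding p' by (simp_all add: ac_simps)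
  then have "\<alpha> = 0" "\<beta> = 0" "\<gamma> = 0"
    using p W_triple_coordinates[OF W, of \<alpha> \<beta> 0] W_triple_coordinates[OF W, of \<gamma> 0 \<beta>] by simp_all
  then show ?thesis using p' by simp
qed

lemma Der_closed:
  shows "0 \<in> carr (Der L)"
    and "D \<in> carr (Der L) \<Longrightarrow> E \<in> carr (Der L) \<Longrightarrow> brk (Der L) D E \<in> carr (Der L)"
proof -
  show "0 \<in> carr (Der L)" by (auto simp: Der_def)
  assume "D \<in> carr (Der L)" "E \<in> carr (Der L)"
  moreover from this have "D 0 = 0" "E 0 = 0"
    unfolding Der_def by (simp_all, (metis zero_in scale_zero_left)+)
  ultimately show "brk (Der L) D E \<in> carr (Der L)"
    unfolding Der_def by (simp add: scale_right_distrib ac_simps)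
qed

text \<open>
  A derivation \<open>D\<close> that commutes with \<open>ad p\<close> satisfies \<open>ad (D p) = [D, ad p] = 0\<close>, so \<open>D p = 0\<close> since the
  algebra has trivial centre.
\<close>

lemma second_derived_centraliser_Der:
  assumes W: "W_triple e f h" and gen: "V \<subseteq> span {e, f, h}"
  shows "second_derived_centraliser (Der L) \<subseteq> {0}"
proof
  fix D assume D: "D \<in> second_derived_centraliser (Der L)"
  note [simp] = W_tripleD[OF W]
  have D': "D x = 0 \<or> x \<in> V" "x \<in> V \<Longrightarrow> D x \<in> V" "x \<in> V \<Longrightarrow> y \<in> V \<Longrightarrow> D (x + y) = D x + D y"
     "x \<in> V \<Longrightarrow> D (c *s x) = c *s D x" "x \<in> V \<Longrightarrow> y \<in> V \<Longrightarrow> D (x \<bullet> y) = D x \<bullet> y + x \<bullet> D y" for x y c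
    using D unfolding second_derived_centraliser_def Der_def by auto
  define adj where "adj p = (\<lambda>x. if x \<in> V then p \<bullet> x else 0)" for p
  have adj: "adj p \<in> carr (Der L)" if "p \<in> V" for p
    using that unfolding adj_def Der_def by (auto intro: jacobi_right)
  have adj_brk: "brk (Der L) (adj p) (adj q) = adj (p \<bullet> q)" if "p \<in> V" "q \<in> V" for p q
    using that unfolding adj_def Der_def by (auto simp: fun_eq_iff jacobi_left)
  have "brk (Der L) D (adj p) = adj (D p)" if p: "p \<in> V" for p
  proof
    fix x
    have "D 0 = 0" using D'(4)[of 0 0] by simp
    show "brk (Der L) D (adj p) x = adj (D p) x"
    proof (cases "x \<in> V")
      case True
      then show ?thesis using p D'(2) D'(5)[of p x] unfolding adj_def Der_def by (simp add: add.assoc)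
    next
      case False
      then show ?thesis using \<open>D 0 = 0\<close> D'(1)[of x] p unfolding adj_def Der_def by simp
    qed
  qed
  moreover have "brk (Der L) D (adj ((a \<bullet> b) \<bullet> (c \<bullet> d))) = 0" if "a \<in> V" "b \<in> V" "c \<in> V" "d \<in> V" for a b c d
    using D that adj unfolding second_derived_centraliser_def by (simp flip: adj_brk)
  ultimately have 1: "adj (D ((a \<bullet> b) \<bullet> (c \<bullet> d))) = 0" if "a \<in> V" "b \<in> V" "c \<in> V" "d \<in> V" for a b c d
    using that by simp
  have adj0: "p = 0" if "p \<in> V" "adj p = 0" for p
  proof (rule W_triple_centreless[OF W])
    have "adj p x = 0" for x using that(2) by (simp add: zero_fun_def)
    then show "p \<bullet> e = 0" "p \<bullet> f = 0" "p \<bullet> h = 0" unfolding adj_def by (metis W_tripleD(1-3)[OF W])+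
  qed (use gen that in blast)
  have Dz: "D e = 0" "D f = 0" "D h = 0"
    using adj0[OF _ 1[of e f h e]] adj0[OF _ 1[of e f h f]] adj0[OF _ 1[of h e h f]] D'(2) 
    unfolding W_triple_double_brackets[OF W] by auto
  have "D x = 0" for x
  proof (cases "x \<in> V")
    case True
    then obtain \<alpha> \<beta> \<gamma> where "x = \<alpha> *s e + \<beta> *s f + \<gamma> *s h" using gen span_triple by blast
    then show ?thesis using Dz by (simp add: D'(3,4))
  next
    case False then show ?thesis using D'(1) by blast
  qed
  then show "D \<in> {0}" by (simp add: fun_eq_iff)
qed

text \<open>
  The algebra spanned by a triple is simple: bracketing a nonzero element with suitable members of
  the triple leads to a nonzero multiple of \<open>h\<close>.
\<close>

lemma W_triple_in_ideal:
  assumes W: "W_triple e f h" and I: "lie_ideal I L" and p: "p \<in> I" "p \<in> span {e, f, h}" "p \<noteq> 0"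
  shows "{e, f, h} \<subseteq> I"
proof -
  note [simp] = W_tripleD[OF W]
  have sI: "subspace I" and IV: "I \<subseteq> V" and idl: "\<And>x y. x \<in> V \<Longrightarrow> y \<in> I \<Longrightarrow> x \<bullet> y \<in> I" using I unfolding lie_ideal_def by auto
  obtain \<alpha> \<beta> \<gamma> where p': "p = \<alpha> *s e + \<beta> *s f + \<gamma> *s h" using p(2) span_triple by blast
  have cancel: "x \<in> I" if "c *s x \<in> I" "c \<noteq> 0" for c x
    using subspace_scale[OF sI that(1), of "inverse c"] that(2) by simp
  have v: "h \<bullet> p \<in> I" using idl p by simp
  have "f \<bullet> (h \<bullet> p) = \<alpha> *s h" "e \<bullet> (h \<bullet> p) = \<beta> *s h" unfolding p' by simp_all
  then have *: "\<alpha> *s h \<in> I" "\<beta> *s h \<in> I" using idl v W_tripleD(1,2)[OF W] by metis+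
  have h: "h \<in> I"
  proof (cases "\<alpha> = 0 \<and> \<beta> = 0")
    case True
    then have "\<gamma> \<noteq> 0" "\<gamma> *s h \<in> I" using p p' by auto
    then show ?thesis using cancel by blast
  next
    case False then show ?thesis using * cancel by blast
  qed
  then have "e \<bullet> h \<in> I" "f \<bullet> h \<in> I" by (intro idl; simp)+
  then show ?thesis using h by simp
qed

lemma brk_derived_funpow: "brk ((derived_alg ^^ n) M) = brk M" "smul ((derived_alg ^^ n) M) = smul M"
  by (induction n) (auto simp: derived_alg_def restrict_to_def)

lemma W_triple_not_solvable:
  assumes W: "W_triple e f h" and "{e, f, h} \<subseteq> I"
  shows "\<not> solvable (restrict_to L I)"
proof -
  have "{e, f, h} \<subseteq> carr ((derived_alg ^^ n) (restrict_to L I))" for n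
  proof (induction n)
    case 0 then show ?case using assms by (simp add: restrict_to_def)
  next
    case (Suc n)
    let ?M = "(derived_alg ^^ n) (restrict_to L I)"
    have "carr (derived_alg ?M) = span {x \<bullet> y |x y. x \<in> carr ?M \<and> y \<in> carr ?M}"
      by (simp add: derived_alg_def restrict_to_def brk_derived_funpow)
    moreover have "e = h \<bullet> e" "f = h \<bullet> f" "h = e \<bullet> f" using W_tripleD[OF W] by auto
    then have "{e, f, h} \<subseteq> {x \<bullet> y |x y. x \<in> carr ?M \<and> y \<in> carr ?M}" using Suc by blast
    ultimately show ?case using span_superset by fastforce
  qed
  then show ?thesis using W_tripleD(4)[OF W] unfolding solvable_def by blast
qed

text \<open>
  A solvable ideal \<open>I\<close> centralises the triple: otherwise some bracket of an element of \<open>I\<close> with a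
  member of the triple is a nonzero element of \<open>I\<close> in the span of the triple, and then \<open>I\<close> contains the
  triple and is not solvable.
\<close>

theorem rad_eq_centraliser:
  assumes W: "W_triple e f h" and ideal: "\<And>x. x \<in> V \<Longrightarrow> x \<bullet> e \<in> span {e, f, h} \<and> x \<bullet> f \<in> span {e, f, h} \<and> x \<bullet> h \<in> span {e, f, h}"
    and C: "C = {z \<in> V. z \<bullet> e = 0 \<and> z \<bullet> f = 0 \<and> z \<bullet> h = 0}" and sol: "solvable (restrict_to L C)"
  shows "rad L = C" and "lie_ideal C L"
proof -
  note [simp] = W_tripleD[OF W]
  have sC: "subspace C" unfolding C by (auto simp: subspace_def)
  have kill: "z \<bullet> p = 0" if zp: "z \<in> C" "p \<in> span {e, f, h}" for z p
  proof -
    obtain \<alpha> \<beta> \<gamma> where p': "p = \<alpha> *s e + \<beta> *s f + \<gamma> *s h" using zp(2) span_triple by blast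
    show ?thesis using zp(1) unfolding p' C by simp
  qed
  show lC: "lie_ideal C L"
    unfolding lie_ideal_def
  proof (intro conjI ballI sC)
    show "C \<subseteq> V" unfolding C by blast
    fix x y assume xy: "x \<in> V" "y \<in> C"
    then have "y \<in> V" unfolding C by blast
    have y0: "y \<bullet> e = 0" "y \<bullet> f = 0" "y \<bullet> h = 0" using xy unfolding C by auto
    have "(x \<bullet> y) \<bullet> g = 0" if "g \<in> {e, f, h}" for g
    proof -
      have "g \<in> V" "y \<bullet> g = 0" "y \<bullet> (x \<bullet> g) = 0" using that y0 kill[OF xy(2)] ideal[OF xy(1)] by auto
      then show ?thesis using xy \<open>y \<in> V\<close> by (simp add: jacobi_left)
    qed
    then show "x \<bullet> y \<in> C" unfolding C using xy \<open>y \<in> V\<close> by simp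
  qed
  have "I \<subseteq> C" if I: "lie_ideal I L" "solvable (restrict_to L I)" for I
  proof
    fix z assume z: "z \<in> I"
    have zV: "z \<in> V" using I z unfolding lie_ideal_def by blast
    have "z \<bullet> g = 0" if g: "g \<in> {e, f, h}" for g
    proof (rule ccontr)
      assume nz: "z \<bullet> g \<noteq> 0"
      have gV: "g \<in> V" using g by auto
      have "g \<bullet> z \<in> I" using I z gV unfolding lie_ideal_def by blast
      then have "z \<bullet> g \<in> I" using brk_comm[OF zV gV] by simp
      then have "{e, f, h} \<subseteq> I" using W_triple_in_ideal[OF W I(1) _ _ nz] ideal[OF zV] g by auto
      then show False using W_triple_not_solvable[OF W] I(2) by blast
    qed
    then show "z \<in> C" using zV unfolding C by simp
  qed
  then have "\<Union>{I. lie_ideal I L \<and> solvable (restrict_to L I)} = C" using lC sol by blast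
  then show "rad L = C" unfolding rad_def using sC by (simp add: span_eq_iff)
qed

lemma solvable_restrict_abelian:
  assumes "0 \<in> C" "\<And>x y. x \<in> C \<Longrightarrow> y \<in> C \<Longrightarrow> x \<bullet> y = 0"
  shows "solvable (restrict_to L C)"
  unfolding solvable_def
proof (rule exI[of _ 1])
  have "{x \<bullet> y |x y. x \<in> C \<and> y \<in> C} = {0}" using assms by force
  then show "carr ((derived_alg ^^ 1) (restrict_to L C)) = {0}"
    by (simp add: derived_alg_def restrict_to_def)
qed

lemma solvable_restrict_metabelian:
  assumes "0 \<in> C" "subspace U" "\<And>x y. x \<in> C \<Longrightarrow> y \<in> C \<Longrightarrow> x \<bullet> y \<in> U" "\<And>x y. x \<in> U \<Longrightarrow> y \<in> U \<Longrightarrow> x \<bullet> y = 0"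
  shows "solvable (restrict_to L C)"
  unfolding solvable_def
proof (rule exI[of _ 2])
  define S where "S = span {x \<bullet> y |x y. x \<in> C \<and> y \<in> C}"
  have "S \<subseteq> U" unfolding S_def using assms by (intro span_minimal) auto
  moreover have "0 \<in> S" unfolding S_def by (rule span_zero)
  ultimately have "x \<bullet> y = 0" if "x \<in> S" "y \<in> S" for x y using that assms(4) by blast
  then have "{x \<bullet> y |x y. x \<in> S \<and> y \<in> S} = {0}" using \<open>0 \<in> S\<close> by force
  then show "carr ((derived_alg ^^ 2) (restrict_to L C)) = {0}"
    unfolding S_def by (simp add: derived_alg_def restrict_to_def numeral_2_eq_2)
qed

end

section \<open>Adjoint representations and the shape of the model algebras\<close>

context lie_char2
begin

text \<open>
  The map sends \<open>z\<close> to the restriction of \<open>ad z\<close> to \<open>P\<close>, transported to \<open>A\<close> by \<open>\<phi>\<close>.  The hypotheses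
  \<open>faithful\<close> and \<open>inner\<close> are its injectivity and surjectivity.
\<close>

theorem isomorphic_Der_ideal:
  assumes A: "lie_algebra (A :: ('k, 'w::ab_group_add) lie_data)" and P: "lie_ideal P L"
    and \<phi>: "lie_iso \<phi> A (restrict_to L P)"
    and faithful: "\<And>z. z \<in> V \<Longrightarrow> (\<And>p. p \<in> P \<Longrightarrow> z \<bullet> p = 0) \<Longrightarrow> z = 0"
    and inner: "\<And>E. (\<And>p. p \<in> P \<Longrightarrow> E p \<in> P) \<Longrightarrow> (\<And>p q. p \<in> P \<Longrightarrow> q \<in> P \<Longrightarrow> E (p + q) = E p + E q) \<Longrightarrow>
      (\<And>c p. p \<in> P \<Longrightarrow> E (c *s p) = c *s E p) \<Longrightarrow>
      (\<And>p q. p \<in> P \<Longrightarrow> q \<in> P \<Longrightarrow> E (p \<bullet> q) = E p \<bullet> q + p \<bullet> E q) \<Longrightarrow> \<exists>z\<in>V. \<forall>p\<in>P. E p = z \<bullet> p"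
  shows "L \<cong>\<^sub>L Der A"
proof -
  interpret A: lie_algebra A by (rule A)
  have bij: "bij_betw \<phi> (carr A) P"
    and add: "\<And>x y. x \<in> carr A \<Longrightarrow> y \<in> carr A \<Longrightarrow> \<phi> (x + y) = \<phi> x + \<phi> y"
    and sc: "\<And>c x. x \<in> carr A \<Longrightarrow> \<phi> (smul A c x) = c *s \<phi> x"
    and hom: "\<And>x y. x \<in> carr A \<Longrightarrow> y \<in> carr A \<Longrightarrow> \<phi> (brk A x y) = \<phi> x \<bullet> \<phi> y"
    using \<phi> unfolding lie_iso_def restrict_to_def by auto
  have PV: "P \<subseteq> V" and sP: "subspace P" and idl: "\<And>x p. x \<in> V \<Longrightarrow> p \<in> P \<Longrightarrow> x \<bullet> p \<in> P"
    using P unfolding lie_ideal_def by auto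
  have A0: "0 \<in> carr A" by (rule A.subspace_0[OF A.subspace_carr])
  have A_in: "x + y \<in> carr A" "smul A c x \<in> carr A" "brk A x y \<in> carr A" "x - y \<in> carr A"
    if "x \<in> carr A" "y \<in> carr A" for x y c
    using that A.subspace_add[OF A.subspace_carr] A.subspace_scale[OF A.subspace_carr]
      A.subspace_diff[OF A.subspace_carr] A.brk_closed by auto
  define \<iota> where "\<iota> = inv_into (carr A) \<phi>"
  have \<iota>: "\<iota> p \<in> carr A" "\<phi> (\<iota> p) = p" if "p \<in> P" for p
    using that bij unfolding \<iota>_def by (auto simp: bij_betw_def inv_into_into f_inv_into_f)
  have \<phi>P: "\<phi> x \<in> P" if "x \<in> carr A" for x using that bij by (auto simp: bij_betw_def)
  have \<phi>V: "\<phi> x \<in> V" if "x \<in> carr A" for x using \<phi>P that PV by blast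
  have eqI: "x = y" if "\<phi> x = \<phi> y" "x \<in> carr A" "y \<in> carr A" for x y
    using that bij by (auto simp: bij_betw_def inj_on_def)
  have \<iota>\<phi>: "\<iota> (\<phi> x) = x" if "x \<in> carr A" for x using that \<iota>[OF \<phi>P] by (intro eqI) auto
  have \<phi>0: "\<phi> 0 = 0"
  proof -
    have "\<phi> (0 + 0) = \<phi> 0 + \<phi> 0" by (rule add[OF A0 A0])
    then show ?thesis by simp
  qed
  have diff: "\<phi> (x - y) = \<phi> x + \<phi> y" if "x \<in> carr A" "y \<in> carr A" for x y
    using add[of "x - y" y] that A_in by simp
  define ad where "ad z = (\<lambda>w. if w \<in> carr A then \<iota> (z \<bullet> \<phi> w) else 0)" for z
  have ad: "ad z w \<in> carr A" "\<phi> (ad z w) = z \<bullet> \<phi> w" if "z \<in> V" "w \<in> carr A" for z w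
    using that \<iota> idl \<phi>P unfolding ad_def by auto
  have ad_out: "ad z w = 0" if "w \<notin> carr A" for z w using that unfolding ad_def by simp
  have ad_0: "ad z 0 = 0" if "z \<in> V" for z
    using ad[OF that A0] A0 \<phi>0 that by (intro eqI) auto
  have in_Der: "ad z \<in> carr (Der A)" if z: "z \<in> V" for z
  proof -
    have "ad z (x + y) = ad z x + ad z y" if "x \<in> carr A" "y \<in> carr A" for x y
      using that z by (intro eqI) (auto simp: ad add A_in \<phi>V)
    moreover have "ad z (smul A c x) = smul A c (ad z x)" if "x \<in> carr A" for x c
      using that z by (intro eqI) (auto simp: ad sc A_in \<phi>V)
    moreover have "ad z (brk A x y) = brk A (ad z x) y + brk A x (ad z y)" if "x \<in> carr A" "y \<in> carr A" for x y
      using that z jacobi_right[OF z \<phi>V[OF that(1)] \<phi>V[OF that(2)]]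
      by (intro eqI) (auto simp: ad add hom A_in \<phi>V)
    ultimately show ?thesis using ad ad_out z unfolding Der_def by auto
  qed
  have "lie_iso ad L (Der A)"
    unfolding lie_iso_def
  proof (intro conjI ballI allI)
    fix x y c assume x: "x \<in> V"
    show "ad (c *s x) = smul (Der A) c (ad x)"
    proof
      fix w show "ad (c *s x) w = smul (Der A) c (ad x) w"
      proof (cases "w \<in> carr A")
        case True then show ?thesis using x unfolding Der_def by (intro eqI) (auto simp: ad sc A_in \<phi>V)
      qed (simp add: ad_out Der_def)
    qed
    assume y: "y \<in> V"
    show "ad (x + y) = ad x + ad y"
    proof
      fix w show "ad (x + y) w = (ad x + ad y) w"
      proof (cases "w \<in> carr A")
        case True then show ?thesis using x y by (intro eqI) (auto simp: ad add A_in \<phi>V)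
      qed (simp add: ad_out)
    qed
    show "ad (x \<bullet> y) = brk (Der A) (ad x) (ad y)"
    proof
      fix w show "ad (x \<bullet> y) w = brk (Der A) (ad x) (ad y) w"
      proof (cases "w \<in> carr A")
        case True then show ?thesis using x y unfolding Der_def
          by (intro eqI) (auto simp: ad diff A_in \<phi>V jacobi_left)
      qed (simp add: ad_out Der_def ad_0 x y)
    qed
  next
    show "bij_betw ad V (carr (Der A))"
      unfolding bij_betw_def
    proof
      show "inj_on ad V"
      proof (rule inj_onI)
        fix x y assume xy: "x \<in> V" "y \<in> V" "ad x = ad y"
        have "(x + y) \<bullet> p = 0" if p: "p \<in> P" for p
        proof -
          have "x \<bullet> \<phi> (\<iota> p) = y \<bullet> \<phi> (\<iota> p)" using ad(2) xy \<iota>[OF p] by metis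
          then show ?thesis using xy \<iota>[OF p] p PV by auto
        qed
        then have "x + y = 0" using faithful xy by simp
        then show "x = y" by (simp add: add_eq_0)
      qed
      show "ad ` V = carr (Der A)"
      proof
        show "ad ` V \<subseteq> carr (Der A)" using in_Der by blast
        show "carr (Der A) \<subseteq> ad ` V"
        proof
          fix D assume "D \<in> carr (Der A)"
          then have D: "\<And>x. x \<notin> carr A \<Longrightarrow> D x = 0" "\<And>x. x \<in> carr A \<Longrightarrow> D x \<in> carr A"
            "\<And>x y. x \<in> carr A \<Longrightarrow> y \<in> carr A \<Longrightarrow> D (x + y) = D x + D y"
            "\<And>c x. x \<in> carr A \<Longrightarrow> D (smul A c x) = smul A c (D x)"
            "\<And>x y. x \<in> carr A \<Longrightarrow> y \<in> carr A \<Longrightarrow> D (brk A x y) = brk A (D x) y + brk A x (D y)"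
            unfolding Der_def by auto
          have \<iota>_add: "\<iota> (p + q) = \<iota> p + \<iota> q" if "p \<in> P" "q \<in> P" for p q
            using \<iota> that subspace_add[OF sP that] by (intro eqI) (auto simp: add A_in)
          have \<iota>_sc: "\<iota> (c *s p) = smul A c (\<iota> p)" if "p \<in> P" for p c
            using \<iota> that subspace_scale[OF sP that] A_in(2)[OF \<iota>(1)[OF that] \<iota>(1)[OF that]]
            by (intro eqI) (auto simp: sc)
          have \<iota>_brk: "\<iota> (p \<bullet> q) = brk A (\<iota> p) (\<iota> q)" if "p \<in> P" "q \<in> P" for p q
            using \<iota> that idl[of p q] PV by (intro eqI) (auto simp: hom A_in)
          have "\<exists>z\<in>V. \<forall>p\<in>P. \<phi> (D (\<iota> p)) = z \<bullet> p"
            by (rule inner) (use \<iota> D PV in \<open>simp_all add: \<phi>P \<iota>_add \<iota>_sc \<iota>_brk add sc hom A_in\<close>)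
          then obtain z where z: "z \<in> V" "\<And>p. p \<in> P \<Longrightarrow> \<phi> (D (\<iota> p)) = z \<bullet> p" by blast
          have "ad z = D"
          proof
            fix w show "ad z w = D w"
            proof (cases "w \<in> carr A")
              case True
              then show ?thesis using z(1) z(2)[OF \<phi>P[OF True]] D(2) by (intro eqI) (auto simp: ad \<iota>\<phi>)
            qed (simp add: ad_out D)
          qed
          then show "D \<in> ad ` V" using z(1) by blast
        qed
      qed
    qed
  qed
  then show ?thesis unfolding isomorphic_def by blast
qed

end

context char2_field
begin

lemma W_triple_W12: "lie_char2.W_triple W12 (dp 2) (dp 0) (dp 1 :: nat \<Rightarrow> 'k)"
proof -
  interpret W: lie_char2 "W12 :: ('k, nat \<Rightarrow> 'k) lie_data" by (rule lie_W12)
  have "dp 1 \<noteq> (0 :: nat \<Rightarrow> 'k)" by (metis dp_def zero_fun_apply zero_neq_one)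
  then show ?thesis unfolding W.W_triple_def
    using brk_dp(1-3) W.brk_comm[of "dp 2" "dp 0"] W.brk_comm[of "dp 1" "dp 0"] by (simp add: carr_W12)
qed

lemma W12'_expand: "f \<in> carr W12' \<Longrightarrow> f = (\<lambda>r. f 2 * dp 2 r) + (\<lambda>r. f 0 * dp 0 r) + (\<lambda>r. f 1 * dp 1 r :: 'k)"
proof
  fix n :: nat assume f: "f \<in> carr W12'"
  have "n = 0 \<or> n = 1 \<or> n = 2 \<or> n \<ge> 3" by linarith
  then show "f n = ((\<lambda>r. f 2 * dp 2 r) + (\<lambda>r. f 0 * dp 0 r) + (\<lambda>r. f 1 * dp 1 r)) n"
    using f by (auto simp: dp_def carr_W12')
qed

lemma W_triple_W12': "lie_char2.W_triple W12' (dp 2) (dp 0) (dp 1 :: nat \<Rightarrow> 'k)"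
  and W12'_span: "carr W12' \<subseteq> lie_span (W12' :: ('k, nat \<Rightarrow> 'k) lie_data) {dp 2, dp 0, dp 1}"
proof -
  interpret W: lie_char2 "W12 :: ('k, nat \<Rightarrow> 'k) lie_data" by (rule lie_W12)
  interpret W': lie_char2 "W12' :: ('k, nat \<Rightarrow> 'k) lie_data" by (rule lie_W12')
  have "(dp 0 :: nat \<Rightarrow> 'k) \<in> carr W12'" "(dp 1 :: nat \<Rightarrow> 'k) \<in> carr W12'" "(dp 2 :: nat \<Rightarrow> 'k) \<in> carr W12'"
    by (auto simp: carr_W12' dp_def)
  then show "W'.W_triple (dp 2) (dp 0) (dp 1)"
    using W.W_tripleD[OF W_triple_W12] unfolding W'.W_triple_def brk_W12' by simp
  show "carr W12' \<subseteq> W'.span {dp 2, dp 0, dp 1}"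
  proof
    fix f :: "nat \<Rightarrow> 'k" assume "f \<in> carr W12'"
    from W12'_expand[OF this] show "f \<in> W'.span {dp 2, dp 0, dp 1}"
      unfolding W'.span_triple unfolding smul_W12' smul_W12 by blast
  qed
qed

lemma brk_W12_0: "g \<in> O12 \<Longrightarrow> brk W12 0 g = (0 :: nat \<Rightarrow> 'k)" "g \<in> O12 \<Longrightarrow> brk W12 g 0 = (0 :: nat \<Rightarrow> 'k)"
  using lie_char2.brk_0_left[OF lie_W12] lie_char2.brk_0_right[OF lie_W12] by (simp_all add: carr_W12)

lemma W12_centraliser:
  assumes "g \<in> O12" "brk W12 g (dp 2) = 0" "brk W12 g (dp 0) = 0" "brk W12 g (dp 1 :: nat \<Rightarrow> 'k) = 0"
  shows "g = 0"
proof
  fix n :: nat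
  have dp: "dp 0 \<in> (O12 :: (nat \<Rightarrow> 'k) set)" "dp 1 \<in> (O12 :: (nat \<Rightarrow> 'k) set)" by simp_all
  note b = assms(3,4)[unfolded brk_W12[OF assms(1) dp(1)] brk_W12[OF assms(1) dp(2)]]
  have "g 1 = 0" "g 2 = 0" "g 3 = 0" "g 0 = 0"
    using fun_cong[OF b(1), of 0] fun_cong[OF b(1), of 1] fun_cong[OF b(1), of 2] fun_cong[OF b(2), of 0]
    by (simp_all add: dp_def)
  moreover have "n = 0 \<or> n = 1 \<or> n = 2 \<or> n = 3 \<or> n \<ge> 4" by linarith
  ultimately show "g n = 0 n" using assms(1) by (auto simp: O12_def)
qed

lemma W_triple_W_line: "lie_char2.W_triple (W_line \<delta>) (dp 2, 0) (dp 0, 0) (dp 1 :: nat \<Rightarrow> 'k, 0)"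
proof -
  interpret W: lie_char2 "W12 :: ('k, nat \<Rightarrow> 'k) lie_data" by (rule lie_W12)
  interpret L: lie_char2 "W_line \<delta>" by (rule lie_W_line)
  show ?thesis
    using W.W_tripleD[OF W_triple_W12] unfolding L.W_triple_def by (simp add: W_line_simps carr_W12 zero_prod_def)
qed

lemma W_triple_W'_plane: "lie_char2.W_triple (W'_plane \<delta>) (dp 2, 0) (dp 0, 0) (dp 1 :: nat \<Rightarrow> 'k, 0)"
proof -
  interpret W: lie_char2 "W12' :: ('k, nat \<Rightarrow> 'k) lie_data" by (rule lie_W12')
  interpret L: lie_char2 "W'_plane \<delta>" by (rule lie_W'_plane)
  show ?thesis
    using W.W_tripleD[OF W_triple_W12'] unfolding L.W_triple_def by (simp add: W'_plane_simps zero_prod_def brk_W12')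
qed

text \<open>
  The radical and the centraliser of the second derived algebra are both the centraliser of the
  triple \<open>x\<^sup>(\<^sup>2\<^sup>)\<partial>, \<partial>, x\<partial>\<close>.
\<close>

lemma W_line_facts:
  shows rad_W_line: "rad (W_line \<delta>) = {0} \<times> (UNIV :: 'k set)"
    and ideal_rad_W_line: "lie_ideal ({0} \<times> UNIV) (W_line \<delta>)"
    and second_derived_centraliser_W_line: "second_derived_centraliser (W_line \<delta>) = {0} \<times> (UNIV :: 'k set)"
proof -
  interpret L: lie_char2 "W_line \<delta>" by (rule lie_W_line)
  note W = W_triple_W_line[of \<delta>]
  let ?C = "{z \<in> L.V. brk (W_line \<delta>) z (dp 2, 0) = 0 \<and> brk (W_line \<delta>) z (dp 0, 0) = 0 \<and> brk (W_line \<delta>) z (dp 1, 0) = 0}"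
  have C: "{0} \<times> UNIV = ?C"
    using W12_centraliser by (auto simp: W_line_simps zero_prod_def brk_W12 O12_def dp_def fun_eq_iff)
  have sp: "(g, 0) \<in> L.span {(dp 2, 0), (dp 0, 0), (dp 1, 0)}" if "g \<in> carr W12'" for g
    unfolding L.span_triple using W12'_expand[OF that]
    by (intro exI[of _ "g 2"] exI[of _ "g 0"] exI[of _ "g 1"]) (simp add: W_line_simps)
  have sol: "solvable (restrict_to (W_line \<delta>) ({0} \<times> UNIV))"
    by (rule L.solvable_restrict_abelian) (auto simp: zero_prod_def W_line_simps brk_W12 O12_def fun_eq_iff)
  have id: "brk (W_line \<delta>) x (dp i, 0) \<in> L.span {(dp 2, 0), (dp 0, 0), (dp 1, 0)}" if "x \<in> L.V" "i < 3" for x i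
  proof -
    have "brk W12 (fst x) (dp i) \<in> carr W12'" "dp i 3 = (0::'k)"
      using that by (auto simp: W_line_simps carr_W12' brk_W12) (simp add: dp_def)
    then show ?thesis using sp by (cases x) (simp add: W_line_simps)
  qed
  show "rad (W_line \<delta>) = {0} \<times> UNIV" "lie_ideal ({0} \<times> UNIV) (W_line \<delta>)"
    by (rule L.rad_eq_centraliser[OF W _ C sol]; use id in simp)+
  have "second_derived_centraliser (W_line \<delta>) \<subseteq> ?C"
    using L.W_triple_double_brackets[OF W] L.W_tripleD(1-3)[OF W]
    unfolding second_derived_centraliser_def by (smt (verit) mem_Collect_eq subsetI)
  moreover have "{0} \<times> UNIV \<subseteq> second_derived_centraliser (W_line \<delta>)"
    unfolding second_derived_centraliser_def
    by (auto simp: W_line_simps brk_W12 brk_W12_in zero_prod_def O12_def fun_eq_iff)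
  ultimately show "second_derived_centraliser (W_line \<delta>) = {0} \<times> UNIV" using C by blast
qed

lemma W'_plane_facts:
  shows rad_W'_plane: "rad (W'_plane \<delta>) = {0} \<times> (UNIV :: ('k \<times> 'k) set)"
    and ideal_rad_W'_plane: "lie_ideal ({0} \<times> UNIV) (W'_plane \<delta>)"
    and second_derived_centraliser_W'_plane: "second_derived_centraliser (W'_plane \<delta>) = {0} \<times> (UNIV :: ('k \<times> 'k) set)"
proof -
  interpret L: lie_char2 "W'_plane \<delta>" by (rule lie_W'_plane)
  interpret W': lie_char2 "W12' :: ('k, nat \<Rightarrow> 'k) lie_data" by (rule lie_W12')
  note W = W_triple_W'_plane[of \<delta>]
  let ?C = "{z \<in> L.V. brk (W'_plane \<delta>) z (dp 2, 0) = 0 \<and> brk (W'_plane \<delta>) z (dp 0, 0) = 0 \<and> brk (W'_plane \<delta>) z (dp 1, 0) = 0}"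
  have C: "{0} \<times> UNIV = ?C"
    using W12_centraliser W12'_O12
    by (auto simp: W'_plane_simps zero_prod_def brk_W12 O12_def dp_def fun_eq_iff carr_W12')
  have sp: "(g, 0) \<in> L.span {(dp 2, 0), (dp 0, 0), (dp 1, 0)}" if "g \<in> carr W12'" for g
    unfolding L.span_triple using W12'_expand[OF that]
    by (intro exI[of _ "g 2"] exI[of _ "g 0"] exI[of _ "g 1"]) (simp add: W'_plane_simps zero_prod_def)
  have sol: "solvable (restrict_to (W'_plane \<delta>) ({0} \<times> UNIV))"
  proof (rule L.solvable_restrict_metabelian[where U = "{0} \<times> {0} \<times> UNIV"])
    show "L.subspace ({0} \<times> {0} \<times> UNIV)"
      by (auto simp: L.subspace_def W'_plane_simps zero_prod_def fun_eq_iff)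
  qed (auto simp: zero_prod_def W'_plane_simps brk_W12 O12_def fun_eq_iff)
  have id: "brk (W'_plane \<delta>) x (dp i, 0) \<in> L.span {(dp 2, 0), (dp 0, 0), (dp 1, 0)}" if "x \<in> L.V" "i < 3" for x i
  proof -
    have "brk W12 (fst x) (dp i) \<in> carr W12'"
      using that W12'_O12 by (auto simp: W'_plane_simps carr_W12' brk_W12)
    then show ?thesis using sp by (cases x) (auto simp: W'_plane_simps zero_prod_def)
  qed
  show "rad (W'_plane \<delta>) = {0} \<times> UNIV" "lie_ideal ({0} \<times> UNIV) (W'_plane \<delta>)"
    by (rule L.rad_eq_centraliser[OF W _ C sol]; use id in simp)+
  have "second_derived_centraliser (W'_plane \<delta>) \<subseteq> ?C"
    using L.W_triple_double_brackets[OF W] L.W_tripleD(1-3)[OF W]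
    unfolding second_derived_centraliser_def by (smt (verit) mem_Collect_eq subsetI)
  moreover have "{0} \<times> UNIV \<subseteq> second_derived_centraliser (W'_plane \<delta>)"
    unfolding second_derived_centraliser_def
    by (auto simp: W'_plane_simps brk_W12_0 brk_W12_in W12'_O12 zero_prod_def)
  ultimately show "second_derived_centraliser (W'_plane \<delta>) = {0} \<times> UNIV" using C by blast
qed

lemma W_line_description: "is_W_semidirect_rad \<delta> (W_line (\<delta> :: 'k))"
proof -
  interpret W: lie_char2 "W12 :: ('k, nat \<Rightarrow> 'k) lie_data" by (rule lie_W12)
  interpret L: lie_char2 "W_line \<delta>" by (rule lie_W_line)
  let ?A = "carr W12 \<times> {0 :: 'k}"
  let ?u = "(0 :: nat \<Rightarrow> 'k, 1 :: 'k)"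
  have 1: "lie_subalgebra ?A (W_line \<delta>)"
    unfolding lie_subalgebra_def L.subspace_def
    by (auto simp: W_line_simps carr_W12 zero_prod_def brk_W12_in) (auto simp: O12_def)
  have 2: "semidirect_sum (W_line \<delta>) ?A (rad (W_line \<delta>))"
    unfolding semidirect_sum_def rad_W_line
    using 1 ideal_rad_W_line[of \<delta>] L.lie_algebra_axioms W.zero_in
    by (auto simp: W_line_simps carr_W12 zero_prod_def)
  have 3: "lie_iso (\<lambda>f. (f, 0)) W12 (restrict_to (W_line \<delta>) ?A)"
    unfolding lie_iso_def restrict_to_def
    by (auto simp: W_line_simps carr_W12 smul_W12 bij_betw_def inj_on_def)
  have 4: "brk (W_line \<delta>) (w, 0) r = 0" if "w \<in> carr W12'" "r \<in> rad (W_line \<delta>)" for w r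
    using that by (auto simp: rad_W_line W_line_simps zero_prod_def brk_W12 W12'_O12 O12_def fun_eq_iff carr_W12')
  have 5: "rad (W_line \<delta>) = L.span {?u}"
    unfolding rad_W_line L.span_singleton by (auto simp: W_line_simps image_iff fun_eq_iff)
  have 6: "brk (W_line \<delta>) (dp 3, 0) ?u = smul (W_line \<delta>) \<delta> ?u"
    by (auto simp: W_line_simps brk_W12 O12_def dp_def fun_eq_iff)
  show ?thesis unfolding is_W_semidirect_rad_def
    by (rule exI[of _ ?A], rule exI[of _ "\<lambda>f. (f, 0)"], rule exI[of _ ?u]) (use 2 3 4 5 6 in \<open>auto simp: zero_prod_def\<close>)
qed

lemma W'_plane_description: "is_W'_direct_rad \<delta> (W'_plane (\<delta> :: 'k))"
proof -
  interpret L: lie_char2 "W'_plane \<delta>" by (rule lie_W'_plane)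
  interpret W': lie_char2 "W12' :: ('k, nat \<Rightarrow> 'k) lie_data" by (rule lie_W12')
  let ?A = "carr W12' \<times> {0 :: 'k \<times> 'k}"
  let ?h = "(0 :: nat \<Rightarrow> 'k, (1 :: 'k, 0 :: 'k))"
  let ?u = "(0 :: nat \<Rightarrow> 'k, (0 :: 'k, 1 :: 'k))"
  have clos: "brk W12 f g \<in> carr W12'" if "f \<in> carr W12'" "g \<in> carr W12'" for f g :: "nat \<Rightarrow> 'k"
    using W'.brk_closed[OF that] by (simp add: brk_W12')
  have 0: "lie_ideal ?A (W'_plane \<delta>)"
    unfolding lie_ideal_def L.subspace_def
    by (auto simp: W'_plane_simps zero_prod_def clos) (auto simp: carr_W12')
  then have 1: "lie_subalgebra ?A (W'_plane \<delta>)"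
    unfolding lie_subalgebra_def lie_ideal_def by blast
  have 2: "direct_sum_of_ideals (W'_plane \<delta>) ?A (rad (W'_plane \<delta>))"
    unfolding semidirect_sum_def direct_sum_of_ideals_def rad_W'_plane
    using 0 1 ideal_rad_W'_plane[of \<delta>] L.lie_algebra_axioms
    by (auto simp: W'_plane_simps zero_prod_def)
  have 3: "lie_iso (\<lambda>f. (f, 0)) W12' (restrict_to (W'_plane \<delta>) ?A)"
    unfolding lie_iso_def restrict_to_def
    by (auto simp: W'_plane_simps smul_W12' smul_W12 bij_betw_def inj_on_def brk_W12' zero_prod_def)
  have comb: "smul (W'_plane \<delta>) r ?h + smul (W'_plane \<delta>) s ?u = (0, (r, s))" for r s
    by (simp add: W'_plane_simps zero_fun_def)
  have 4: "\<not> L.dependent {?h, ?u}"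
  proof -
    have "?h \<notin> L.span {?u}" unfolding L.span_singleton by (auto simp: W'_plane_simps)
    then show ?thesis by (rule L.independent_insertI) (simp add: zero_prod_def)
  qed
  have 5: "rad (W'_plane \<delta>) = L.span {?h, ?u}"
  proof -
    have "x \<in> rad (W'_plane \<delta>) \<longleftrightarrow> x \<in> L.span {?h, ?u}" for x
      unfolding rad_W'_plane L.span_pair comb by auto
    then show ?thesis by blast
  qed
  have 6: "brk (W'_plane \<delta>) ?h ?u = smul (W'_plane \<delta>) \<delta> ?u"
    by (auto simp: W'_plane_simps brk_W12 O12_def fun_eq_iff)
  show ?thesis unfolding is_W'_direct_rad_def
    by (rule exI[of _ ?A], rule exI[of _ "\<lambda>f. (f, 0)"], rule exI[of _ ?h], rule exI[of _ ?u]) (use 2 3 4 5 6 in auto)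
qed

end

section \<open>Isomorphisms with the models\<close>

lemma (in lie_char2) brk_frame:
  assumes b: "f \<in> V" "h \<in> V" "e \<in> V" "y \<in> V" "u \<in> V"
  shows "(a0 *s f + a1 *s h + a2 *s e + a3 *s y + a4 *s u) \<bullet> (b0 *s f + b1 *s h + b2 *s e + b3 *s y + b4 *s u)
    = (a0 * b1 + a1 * b0) *s (f \<bullet> h) + (a0 * b2 + a2 * b0) *s (f \<bullet> e) + (a0 * b3 + a3 * b0) *s (f \<bullet> y)
      + (a0 * b4 + a4 * b0) *s (f \<bullet> u) + (a1 * b2 + a2 * b1) *s (h \<bullet> e) + (a1 * b3 + a3 * b1) *s (h \<bullet> y)
      + (a1 * b4 + a4 * b1) *s (h \<bullet> u) + (a2 * b3 + a3 * b2) *s (e \<bullet> y) + (a2 * b4 + a4 * b2) *s (e \<bullet> u)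
      + (a3 * b4 + a4 * b3) *s (y \<bullet> u)"
proof -
  have c: "h \<bullet> f = f \<bullet> h" "e \<bullet> f = f \<bullet> e" "y \<bullet> f = f \<bullet> y" "u \<bullet> f = f \<bullet> u" "e \<bullet> h = h \<bullet> e" "y \<bullet> h = h \<bullet> y"
    "u \<bullet> h = h \<bullet> u" "y \<bullet> e = e \<bullet> y" "u \<bullet> e = e \<bullet> u" "u \<bullet> y = y \<bullet> u"
    using b by (auto intro: brk_comm)
  show ?thesis using b by (simp add: c scale_left_distrib scale_right_distrib ac_simps)
qed

context lie_perfect_field
begin

lemma isomorphic_by_coordinates:
  fixes M :: "('k, 'w::ab_group_add) lie_data"
  assumes M: "lie_char2 M" and b: "basis5 v0 v1 v2 v3 v4"
    and \<phi>_def: "\<And>p. \<phi> p = c0 p *s v0 + c1 p *s v1 + c2 p *s v2 + c3 p *s v3 + c4 p *s v4"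
    and add: "\<And>p q. \<phi> (p + q) = \<phi> p + \<phi> q" and smul: "\<And>c p. \<phi> (smul M c p) = c *s \<phi> p"
    and inj: "\<And>p. p \<in> carr M \<Longrightarrow> c0 p = 0 \<Longrightarrow> c1 p = 0 \<Longrightarrow> c2 p = 0 \<Longrightarrow> c3 p = 0 \<Longrightarrow> c4 p = 0 \<Longrightarrow> p = 0"
    and surj: "\<And>r s t k l. \<exists>p\<in>carr M. c0 p = r \<and> c1 p = s \<and> c2 p = t \<and> c3 p = k \<and> c4 p = l"
    and brk: "\<And>p q. p \<in> carr M \<Longrightarrow> q \<in> carr M \<Longrightarrow> \<phi> (brk M p q) = \<phi> p \<bullet> \<phi> q"
  shows "L \<cong>\<^sub>L M"
proof -
  interpret M: lie_char2 M by (rule M)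
  have inV: "{v0, v1, v2, v3, v4} \<subseteq> V" using b unfolding basis5_def by blast
  have "bij_betw \<phi> (carr M) V"
    unfolding bij_betw_def
  proof
    show "inj_on \<phi> (carr M)"
    proof (rule inj_onI)
      fix p q assume pq: "p \<in> carr M" "q \<in> carr M" "\<phi> p = \<phi> q"
      then have "\<phi> (p + q) = 0" by (simp add: add)
      then have "p + q = 0" using b pq unfolding basis5_def \<phi>_def by (intro inj) auto
      then show "p = q" by (simp add: M.add_eq_0)
    qed
    show "\<phi> ` carr M = V"
    proof
      show "\<phi> ` carr M \<subseteq> V" unfolding \<phi>_def using inV by auto
      show "V \<subseteq> \<phi> ` carr M"
      proof
        fix x assume "x \<in> V"
        then obtain r s t k l where x: "x = r *s v0 + s *s v1 + t *s v2 + k *s v3 + l *s v4"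
          by (rule basis5_coordinates[OF b])
        obtain p where "p \<in> carr M" "c0 p = r \<and> c1 p = s \<and> c2 p = t \<and> c3 p = k \<and> c4 p = l"
          using surj by blast
        then show "x \<in> \<phi> ` carr M" unfolding x by (intro image_eqI[of _ _ p]) (simp_all add: \<phi>_def)
      qed
    qed
  qed
  then have "lie_iso \<phi> M L" unfolding lie_iso_def using add smul brk by blast
  then show ?thesis by (rule lie_iso_inverse[OF M.lie_algebra_axioms])
qed

lemma isomorphic_W_line:
  assumes fr: "W_line_frame \<delta> f h e y u"
  shows "L \<cong>\<^sub>L W_line \<delta>"
proof -
  have b: "basis5 f h e y u" and W: "W_triple e f h" and t: "y \<bullet> f = e" "y \<bullet> h = 0" "y \<bullet> e = 0"
     "u \<bullet> f = 0" "u \<bullet> h = 0" "u \<bullet> e = 0" "y \<bullet> u = \<delta> *s u" using fr unfolding W_line_frame_def by auto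
  have V: "f \<in> V" "h \<in> V" "e \<in> V" "y \<in> V" "u \<in> V" using b unfolding basis5_def by auto
  have t': "f \<bullet> y = e" "h \<bullet> y = 0" "e \<bullet> y = 0" "f \<bullet> u = 0" "h \<bullet> u = 0" "e \<bullet> u = 0"
    using t V brk_comm[of f y] brk_comm[of h y] brk_comm[of e y] brk_comm[of f u] brk_comm[of h u] brk_comm[of e u]
    by auto
  define \<phi> :: "(nat \<Rightarrow> 'k) \<times> 'k \<Rightarrow> 'v" where
    "\<phi> p = fst p 0 *s f + fst p 1 *s h + fst p 2 *s e + fst p 3 *s y + snd p *s u" for p
  show ?thesis
  proof (rule isomorphic_by_coordinates[OF lie_W_line b \<phi>_def])
    fix p q :: "(nat \<Rightarrow> 'k) \<times> 'k" and c
    show "\<phi> (p + q) = \<phi> p + \<phi> q" unfolding \<phi>_def by (simp add: scale_left_distrib ac_simps)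
    show "\<phi> (smul (W_line \<delta>) c p) = c *s \<phi> p"
      unfolding \<phi>_def by (cases p) (simp add: W_line_simps scale_right_distrib)
    assume p: "p \<in> carr (W_line \<delta>)"
    show "p = 0" if "fst p 0 = 0" "fst p 1 = 0" "fst p 2 = 0" "fst p 3 = 0" "snd p = 0"
    proof -
      have "fst p n = 0" for n
      proof -
        have "n = 0 \<or> n = 1 \<or> n = 2 \<or> n = 3 \<or> n \<ge> 4" by linarith
        then show ?thesis using that p by (auto simp: W_line_simps O12_def)
      qed
      then show ?thesis using that by (simp add: prod_eq_iff fun_eq_iff)
    qed
    assume q: "q \<in> carr (W_line \<delta>)"
    obtain g d where p': "p = (g, d)" by fastforce
    obtain g' d' where q': "q = (g', d')" by fastforce
    note pq = p' q'
    have O: "g \<in> O12" "g' \<in> O12" using p q unfolding pq by (simp_all add: W_line_simps)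
    show "\<phi> (brk (W_line \<delta>) p q) = \<phi> p \<bullet> \<phi> q"
      unfolding pq \<phi>_def W_line_simps fst_conv snd_conv brk_frame[OF V] brk_W12[OF O]
      using t t' W_tripleD[OF W] by (simp add: scale_left_distrib distrib_left ac_simps)
  next
    fix r s t k l :: 'k
    let ?g = "\<lambda>n::nat. if n = 0 then r else if n = 1 then s else if n = 2 then t else if n = 3 then k else 0"
    show "\<exists>p\<in>carr (W_line \<delta>). fst p 0 = r \<and> fst p 1 = s \<and> fst p 2 = t \<and> fst p 3 = k \<and> snd p = l"
      by (rule bexI[of _ "(?g, l)"]) (simp_all add: W_line_simps O12_def)
  qed
qed

lemma isomorphic_W'_plane:
  assumes fr: "W'_plane_frame \<delta> f h e y u"
  shows "L \<cong>\<^sub>L W'_plane \<delta>"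
proof -
  have b: "basis5 f h e y u" and W: "W_triple e f h" and t: "y \<bullet> f = 0" "y \<bullet> h = 0" "y \<bullet> e = 0"
     "u \<bullet> f = 0" "u \<bullet> h = 0" "u \<bullet> e = 0" "y \<bullet> u = \<delta> *s u" using fr unfolding W'_plane_frame_def by auto
  have V: "f \<in> V" "h \<in> V" "e \<in> V" "y \<in> V" "u \<in> V" using b unfolding basis5_def by auto
  have t': "f \<bullet> y = 0" "h \<bullet> y = 0" "e \<bullet> y = 0" "f \<bullet> u = 0" "h \<bullet> u = 0" "e \<bullet> u = 0"
    using t V brk_comm[of f y] brk_comm[of h y] brk_comm[of e y] brk_comm[of f u] brk_comm[of h u] brk_comm[of e u]
    by auto
  define \<phi> :: "(nat \<Rightarrow> 'k) \<times> ('k \<times> 'k) \<Rightarrow> 'v" where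
    "\<phi> p = fst p 0 *s f + fst p 1 *s h + fst p 2 *s e + fst (snd p) *s y + snd (snd p) *s u" for p
  show ?thesis
  proof (rule isomorphic_by_coordinates[OF lie_W'_plane b \<phi>_def])
    fix p q :: "(nat \<Rightarrow> 'k) \<times> ('k \<times> 'k)" and c
    obtain g d1 d2 where p': "p = (g, (d1, d2))" by (metis prod.exhaust)
    obtain g' d1' d2' where q': "q = (g', (d1', d2'))" by (metis prod.exhaust)
    note pq = p' q'
    show "\<phi> (p + q) = \<phi> p + \<phi> q" unfolding \<phi>_def by (simp add: scale_left_distrib ac_simps)
    show "\<phi> (smul (W'_plane \<delta>) c p) = c *s \<phi> p"
      unfolding \<phi>_def pq by (simp add: W'_plane_simps scale_right_distrib)
    assume p: "p \<in> carr (W'_plane \<delta>)"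
    show "p = 0" if "fst p 0 = 0" "fst p 1 = 0" "fst p 2 = 0" "fst (snd p) = 0" "snd (snd p) = 0"
    proof -
      have "fst p n = 0" for n
      proof -
        have "n = 0 \<or> n = 1 \<or> n = 2 \<or> n \<ge> 3" by linarith
        then show ?thesis using that p by (auto simp: W'_plane_simps carr_W12')
      qed
      then show ?thesis using that by (simp add: prod_eq_iff fun_eq_iff)
    qed
    assume q: "q \<in> carr (W'_plane \<delta>)"
    have g: "g \<in> carr W12'" "g' \<in> carr W12'" using p q unfolding pq by (simp_all add: W'_plane_simps)
    then have "g 3 = 0" "g' 3 = 0" by (simp_all add: carr_W12')
    then show "\<phi> (brk (W'_plane \<delta>) p q) = \<phi> p \<bullet> \<phi> q"
      unfolding pq \<phi>_def W'_plane_simps fst_conv snd_conv brk_frame[OF V] brk_W12[OF W12'_O12[OF g(1)] W12'_O12[OF g(2)]]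
      using t t' W_tripleD[OF W] by (simp add: scale_left_distrib ac_simps)
  next
    fix r s t k l :: 'k
    let ?g = "\<lambda>n::nat. if n = 0 then r else if n = 1 then s else if n = 2 then t else 0"
    show "\<exists>p\<in>carr (W'_plane \<delta>). fst p 0 = r \<and> fst p 1 = s \<and> fst p 2 = t \<and> fst (snd p) = k \<and> snd (snd p) = l"
      by (rule bexI[of _ "(?g, (k, l))"]) (simp_all add: W'_plane_simps carr_W12')
  qed
qed

text \<open>
  If the determinant is nonzero, \<open>y1\<close> and \<open>y2\<close> realise every outer derivation of the span of the
  triple, and an element of \<open>L\<close> that acts on it by zero is zero.
\<close>

lemma isomorphic_Der_W12':
  assumes W: "W_triple e f h" and ideal: "\<And>x. x \<in> V \<Longrightarrow> x \<bullet> e \<in> span {e, f, h} \<and> x \<bullet> f \<in> span {e, f, h}"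
    and b: "basis5 e f h y1 y2"
    and 1: "y1 \<bullet> h = 0" "y1 \<bullet> e = b1 *s f" "y1 \<bullet> f = a1 *s e"
    and 2: "y2 \<bullet> h = 0" "y2 \<bullet> e = b2 *s f" "y2 \<bullet> f = a2 *s e" and det: "b1 * a2 + b2 * a1 \<noteq> 0"
  shows "L \<cong>\<^sub>L Der (W12' :: ('k, nat \<Rightarrow> 'k) lie_data)"
proof -
  note [simp] = W_tripleD[OF W] 1 2
  have [simp]: "y1 \<in> V" "y2 \<in> V" using b unfolding basis5_def by auto
  let ?P = "span {e, f, h}"
  have PV: "?P \<subseteq> V" using span_minimal[of "{e, f, h}" V] subspace_carr by simp
  have gens: "e \<in> ?P" "f \<in> ?P" "h \<in> ?P" by (auto intro: span_base)
  have xh: "x \<bullet> h \<in> ?P" if "x \<in> V" for x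
  proof -
    have "(x \<bullet> e) \<bullet> f \<in> ?P" "(x \<bullet> f) \<bullet> e \<in> ?P" using ideal that by simp_all
    moreover have "x \<bullet> h = (x \<bullet> e) \<bullet> f + (x \<bullet> f) \<bullet> e"
      using jacobi_right[of x e f] that brk_comm[of e "x \<bullet> f"] by simp
    ultimately show ?thesis by (simp add: span_add)
  qed
  have P: "lie_ideal ?P L"
    unfolding lie_ideal_def
  proof (intro conjI ballI PV subspace_span)
    fix x p assume x: "x \<in> V" and "p \<in> ?P"
    then obtain \<alpha> \<beta> \<gamma> where p: "p = \<alpha> *s e + \<beta> *s f + \<gamma> *s h" using span_triple by blast
    show "x \<bullet> p \<in> ?P" unfolding p using x ideal xh by (simp add: span_add span_scale)
  qed
  interpret A: lie_char2 "W12' :: ('k, nat \<Rightarrow> 'k) lie_data" by (rule lie_W12')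
  define \<phi> :: "(nat \<Rightarrow> 'k) \<Rightarrow> 'v" where "\<phi> g = g 2 *s e + g 0 *s f + g 1 *s h" for g
  have add: "\<phi> (p + q) = \<phi> p + \<phi> q" for p q
    unfolding \<phi>_def by (simp add: scale_left_distrib ac_simps)
  have iso: "lie_iso \<phi> W12' (restrict_to L ?P)"
    unfolding lie_iso_def
  proof (intro conjI ballI allI)
    show "bij_betw \<phi> A.V (carr (restrict_to L ?P))"
      unfolding bij_betw_def restrict_to_def
    proof
      show "inj_on \<phi> A.V"
      proof (rule inj_onI)
        fix p q assume p: "p \<in> A.V" and q: "q \<in> A.V" and eq: "\<phi> p = \<phi> q"
        have g4: "\<forall>r\<ge>3. (p + q) r = 0" using A.add_in[OF p q] by (simp add: carr_W12')
        have "\<phi> (p + q) = 0" using add eq by simp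
        then have z: "(p + q) 0 = 0 \<and> (p + q) 1 = 0 \<and> (p + q) 2 = 0" unfolding \<phi>_def using W_triple_coordinates[OF W] by blast
        have "(p + q) n = 0" for n
        proof -
          have "n = 0 \<or> n = 1 \<or> n = 2 \<or> n \<ge> 3" by linarith
          then show ?thesis using z g4 by auto
        qed
        then have "p + q = 0" by (simp add: fun_eq_iff)
        then show "p = q" by (simp add: A.add_eq_0)
      qed
      have "x \<in> \<phi> ` A.V" if xP: "x \<in> ?P" for x
      proof -
        obtain r s t where x: "x = r *s e + s *s f + t *s h" using xP span_triple by blast
        define g where "g = (\<lambda>n::nat. if n = 0 then s else if n = 1 then t else if n = 2 then r else 0)"
        have "g \<in> A.V" "\<phi> g = x" unfolding x \<phi>_def by (simp_all add: carr_W12' g_def)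
        then show ?thesis by blast
      qed
      moreover have "\<phi> ` A.V \<subseteq> ?P" unfolding \<phi>_def using gens by (auto intro: span_add span_scale)
      ultimately show "\<phi> ` A.V = carr (L\<lparr>carr := ?P\<rparr>)" by auto
    qed
    fix p q c assume p: "p \<in> A.V"
    show "\<phi> (smul W12' c p) = smul (restrict_to L ?P) c (\<phi> p)"
      unfolding \<phi>_def by (simp add: restrict_to_def smul_W12' smul_W12 scale_right_distrib)
    assume q: "q \<in> A.V"
    show "\<phi> (p + q) = \<phi> p + \<phi> q" by (rule add)
    have "p 3 = 0" "q 3 = 0" using p q by (simp_all add: carr_W12')
    then show "\<phi> (brk W12' p q) = brk (restrict_to L ?P) (\<phi> p) (\<phi> q)"
      unfolding \<phi>_def brk_W12' brk_W12[OF W12'_O12[OF p] W12'_O12[OF q]]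
      by (simp add: restrict_to_def scale_left_distrib scale_right_distrib ac_simps)
  qed
  show ?thesis
  proof (rule isomorphic_Der_ideal[OF A.lie_algebra_axioms P iso])
    fix z assume z: "z \<in> V" "\<And>p. p \<in> ?P \<Longrightarrow> z \<bullet> p = 0"
    obtain \<alpha> \<beta> \<gamma> s t where x: "z = \<alpha> *s e + \<beta> *s f + \<gamma> *s h + s *s y1 + t *s y2"
      by (rule basis5_coordinates[OF b z(1)])
    have "z \<bullet> h = \<alpha> *s e + \<beta> *s f + 0 *s h" unfolding x by (simp add: ac_simps)
    then have c: "\<alpha> = 0" "\<beta> = 0" using z(2)[OF gens(3)] W_triple_coordinates[OF W, of \<alpha> \<beta> 0] by simp_all
    have "z \<bullet> e = \<gamma> *s e + (s * b1 + t * b2) *s f + 0 *s h" unfolding x using c by (simp add: scale_left_distrib ac_simps)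
    then have c2: "\<gamma> = 0" "s * b1 + t * b2 = 0"
      using z(2)[OF gens(1)] W_triple_coordinates[OF W, of \<gamma> "s * b1 + t * b2" 0] by simp_all
    have "z \<bullet> f = (s * a1 + t * a2) *s e + 0 *s f + 0 *s h" unfolding x using c c2 by (simp add: scale_left_distrib ac_simps)
    then have c3: "s * a1 + t * a2 = 0"
      using z(2)[OF gens(2)] W_triple_coordinates[OF W, of "s * a1 + t * a2" 0 0] by simp_all
    have e1: "(b1 * a2 + b2 * a1) * s = (s * b1 + t * b2) * a2 + (s * a1 + t * a2) * b2" by (simp add: algebra_simps)
    have e2: "(b1 * a2 + b2 * a1) * t = (s * b1 + t * b2) * a1 + (s * a1 + t * a2) * b1" by (simp add: algebra_simps)
    have "(b1 * a2 + b2 * a1) * s = 0" "(b1 * a2 + b2 * a1) * t = 0"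
      unfolding e1 e2 c2(2) c3 by simp_all
    then have "s = 0" "t = 0" using det by simp_all
    then show "z = 0" using x c c2 by simp
  next
    fix E assume E: "\<And>p. p \<in> ?P \<Longrightarrow> E p \<in> ?P" "\<And>p q. p \<in> ?P \<Longrightarrow> q \<in> ?P \<Longrightarrow> E (p + q) = E p + E q"
      "\<And>c p. p \<in> ?P \<Longrightarrow> E (c *s p) = c *s E p" "\<And>p q. p \<in> ?P \<Longrightarrow> q \<in> ?P \<Longrightarrow> E (p \<bullet> q) = E p \<bullet> q + p \<bullet> E q"
    have "E h = E e \<bullet> f + e \<bullet> E f" "E e = E h \<bullet> e + h \<bullet> E e"
      using E(4)[OF gens(1,2)] E(4)[OF gens(3,1)] by simp_all
    then obtain p a b where p: "p \<in> ?P" "E e = p \<bullet> e + b *s f" "E f = p \<bullet> f + a *s e" "E h = p \<bullet> h"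
      using W_triple_derivation[OF W E(1)[OF gens(1)] E(1)[OF gens(2)]] by blast
    have pV: "p \<in> V" using p(1) PV by blast
    \<comment> \<open>The coefficients \<open>s\<close> and \<open>t\<close> come from Cramer's rule.\<close>
    define d s t where "d = b1 * a2 + b2 * a1" and "s = (b * a2 + b2 * a) / d" and "t = (b1 * a + b * a1) / d"
    have "s * b1 + t * b2 = (b * (b1 * a2 + b2 * a1)) / d"
      unfolding s_def t_def times_divide_eq_left add_divide_distrib[symmetric]
      by (rule arg_cong[of _ _ "\<lambda>x. x / d"]) (simp add: algebra_simps)
    then have sb: "s * b1 + t * b2 = b" using det unfolding d_def by simp
    have "s * a1 + t * a2 = (a * (b1 * a2 + b2 * a1)) / d"
      unfolding s_def t_def times_divide_eq_left add_divide_distrib[symmetric]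
      by (rule arg_cong[of _ _ "\<lambda>x. x / d"]) (simp add: algebra_simps)
    then have sa: "s * a1 + t * a2 = a" using det unfolding d_def by simp
    define z where "z = p + s *s y1 + t *s y2"
    have zV: "z \<in> V" unfolding z_def using pV by simp
    have "z \<bullet> e = E e" "z \<bullet> f = E f" "z \<bullet> h = E h"
      unfolding p z_def sb[symmetric] sa[symmetric] using pV by (simp_all add: scale_left_distrib ac_simps)
    then have "E q = z \<bullet> q" if qP: "q \<in> ?P" for q
    proof -
      obtain \<alpha> \<beta> \<gamma> where q: "q = \<alpha> *s e + \<beta> *s f + \<gamma> *s h" using qP span_triple by blast
      have "E q = \<alpha> *s E e + \<beta> *s E f + \<gamma> *s E h"
        unfolding q using E(2,3) gens by (simp add: span_add span_scale)
      then show ?thesis unfolding q using zV \<open>z \<bullet> e = E e\<close> \<open>z \<bullet> f = E f\<close> \<open>z \<bullet> h = E h\<close> by simp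
    qed
    then show "\<exists>z\<in>V. \<forall>p\<in>?P. E p = z \<bullet> p" using zV by blast
  qed
qed

end

section \<open>The classification\<close>

lemma finite_span:
  fixes s :: "'k::{field,finite} \<Rightarrow> 'v::ab_group_add \<Rightarrow> 'v"
  assumes "vector_space s" "finite B"
  shows "finite (module.span s B)"
proof -
  interpret vector_space s by (rule assms(1))
  show ?thesis using assms(2)
  proof (induction B)
    case (insert b B)
    have "span (insert b B) \<subseteq> (\<lambda>(k, x). s k b + x) ` (UNIV \<times> span B)"
    proof
      fix x assume "x \<in> span (insert b B)"
      then obtain k where "x - s k b \<in> span B" unfolding span_insert by blast
      then have "(k, x - s k b) \<in> UNIV \<times> span B" "x = s k b + (x - s k b)" by simp_all
      then show "x \<in> (\<lambda>(k, x). s k b + x) ` (UNIV \<times> span B)" by (metis (mono_tags, lifting) case_prod_conv image_eqI)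
    qed
    then show ?case using insert by (auto intro: finite_subset)
  qed simp
qed

text \<open>
  Squaring is additive, hence injective, hence surjective on a finite field.
\<close>

lemma (in char2_field) sqrt_exists_finite:
  assumes "finite (UNIV :: 'k set)" shows "\<exists>s. s * s = (a::'k)"
proof -
  have "inj (\<lambda>s::'k. s * s)"
  proof (rule injI)
    fix s t :: 'k assume "s * s = t * t"
    then have "(s + t) * (s + t) = 0" by (simp add: algebra_simps)
    then show "s = t" by (simp add: field_add_eq_0)
  qed
  then have "surj (\<lambda>s::'k. s * s)" using assms by (rule finite_UNIV_inj_surj[rotated])
  then show ?thesis by (metis surjD)
qed

context lie_char2
begin

abbreviation derived_series :: "nat \<Rightarrow> 'v set" where
  "derived_series n \<equiv> carr ((derived_alg ^^ n) L)"

lemma derived_series_Suc: "derived_series (Suc n) = span {x \<bullet> y |x y. x \<in> derived_series n \<and> y \<in> derived_series n}"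
  by (simp add: derived_alg_def restrict_to_def brk_derived_funpow)

lemma derived_series_ideal: "lie_ideal (derived_series n) L"
proof (induction n)
  case 0 then show ?case by (simp add: lie_ideal_def subspace_carr)
next
  case (Suc n)
  let ?D = "derived_series n"
  have DV: "?D \<subseteq> V" and idl: "\<And>x y. x \<in> V \<Longrightarrow> y \<in> ?D \<Longrightarrow> x \<bullet> y \<in> ?D" using Suc unfolding lie_ideal_def by auto
  let ?S = "{x \<bullet> y |x y. x \<in> ?D \<and> y \<in> ?D}"
  have "?S \<subseteq> V" using DV by (auto intro: brk_closed)
  then have SV: "span ?S \<subseteq> V" by (rule span_minimal[OF _ subspace_carr])
  have "x \<bullet> z \<in> span ?S" if x: "x \<in> V" and z: "z \<in> span ?S" for x z
  proof -
    have "span ?S \<subseteq> {z \<in> V. x \<bullet> z \<in> span ?S}"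
    proof (rule span_minimal)
      show "subspace {z \<in> V. x \<bullet> z \<in> span ?S}"
        using x by (auto simp: subspace_def span_zero intro: span_add span_scale)
      show "?S \<subseteq> {z \<in> V. x \<bullet> z \<in> span ?S}"
      proof
        fix z assume "z \<in> ?S"
        then obtain u v where uv: "z = u \<bullet> v" "u \<in> ?D" "v \<in> ?D" by blast
        then have uvV: "u \<in> V" "v \<in> V" using DV by auto
        have "(x \<bullet> u) \<bullet> v \<in> span ?S" "u \<bullet> (x \<bullet> v) \<in> span ?S"
          using uv idl x by (auto intro!: span_base)
        then have "x \<bullet> z \<in> span ?S" unfolding uv(1) jacobi_right[OF x uvV] by (rule span_add)
        then show "z \<in> {z \<in> V. x \<bullet> z \<in> span ?S}" using uv uvV by simp
      qed
    qed
    then show ?thesis using z by blast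
  qed
  then show ?case unfolding lie_ideal_def derived_series_Suc using SV by simp
qed

lemma derived_series_decreasing: "derived_series (Suc n) \<subseteq> derived_series n"
proof -
  have "lie_ideal (derived_series n) L" by (rule derived_series_ideal)
  then show ?thesis unfolding derived_series_Suc lie_ideal_def by (intro span_minimal) auto
qed

lemma lie_ideal_restrict:
  assumes "lie_ideal P L" shows "lie_char2 (restrict_to L P)"
  using assms by (intro lie_subalgebra_lie_char2 lie_char2_axioms) (auto simp: lie_ideal_def lie_subalgebra_def)

text \<open>
  The derived series of a finite algebra becomes stationary.
\<close>

theorem exists_perfect_ideal:
  assumes fin: "finite V" and ns: "\<not> solvable L"
  obtains P where "lie_ideal P L" "P \<noteq> {0}" "lie_char2.perfect (restrict_to L P)"
proof -
  have "\<exists>n. derived_series (Suc n) = derived_series n"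
  proof (rule ccontr)
    assume *: "\<nexists>n. derived_series (Suc n) = derived_series n"
    have finD: "finite (derived_series n)" for n
      using derived_series_ideal[of n] fin unfolding lie_ideal_def by (meson finite_subset)
    define d where "d n = card (derived_series n)" for n
    have less: "d (Suc n) < d n" for n
    proof -
      have "derived_series (Suc n) \<subset> derived_series n"
        using * derived_series_decreasing[of n] by blast
      then show ?thesis unfolding d_def by (rule psubset_card_mono[OF finD])
    qed
    have "d n + n \<le> d 0" for n
    proof (induction n)
      case (Suc n)
      then show ?case using less[of n] by simp
    qed simp
    from this[of "Suc (d 0)"] show False by simp
  qed
  then obtain n where n: "derived_series (Suc n) = derived_series n" by blast
  note id = derived_series_ideal[of n]
  show ?thesis
  proof (rule that[OF id])
    show "derived_series n \<noteq> {0}" using ns unfolding solvable_def by blast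
    have "derived_series n \<subseteq> span {x \<bullet> y |x y. x \<in> derived_series n \<and> y \<in> derived_series n}"
      using n derived_series_Suc by blast
    then show "lie_char2.perfect (restrict_to L (derived_series n))"
      unfolding lie_char2.perfect_def[OF lie_ideal_restrict[OF id]] by (simp add: restrict_to_def)
  qed
qed

lemma perfect_dim_le_2:
  assumes perfect and "V \<subseteq> span {x, y}" "x \<in> V" "y \<in> V"
  shows "V = {0}"
proof -
  have "V \<subseteq> span {x \<bullet> y}"
  proof (rule perfect_induct[OF assms(1)])
    fix z z' assume "z \<in> V" "z' \<in> V"
    then have "z \<in> span {x, y}" "z' \<in> span {x, y}" using assms(2) by blast+
    then obtain r s r' s' where z: "z = r *s x + s *s y" "z' = r' *s x + s' *s y" unfolding span_pair by blast
    have "z \<bullet> z' = (r * s' + s * r') *s (x \<bullet> y)"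
      unfolding z using assms(3,4) by (simp add: brk_comm[of y x] scale_left_distrib ac_simps)
    then show "z \<bullet> z' \<in> span {x \<bullet> y}" by (simp add: span_scale span_base)
  qed simp
  then have line: "\<exists>c. z = c *s (x \<bullet> y)" if "z \<in> V" for z using that unfolding span_singleton by blast
  have "V \<subseteq> {0}"
  proof (rule perfect_induct[OF assms(1)])
    fix z z' assume "z \<in> V" "z' \<in> V"
    then obtain c d where "z = c *s (x \<bullet> y)" "z' = d *s (x \<bullet> y)" using line by meson
    then show "z \<bullet> z' \<in> {0}" using assms(3,4) by simp
  qed (simp add: subspace_0)
  then show ?thesis by auto
qed

end

context lie_perfect_field
begin

text \<open>
  Dimensions 1 and 2 are excluded because a single bracket spans the derived algebra, dimensions 4
  and 5 by \<open>not_perfect\<close>.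
\<close>

theorem perfect_dim_le_5:
  assumes perfect: perfect and fin: "finite V" and nz: "V \<noteq> {0}" and B: "V \<subseteq> span B" "finite B" "card B \<le> 5"
  obtains e f h where "W_triple e f h" "V \<subseteq> span {e, f, h}"
proof -
  obtain C where C: "C \<subseteq> V" "independent C" "V \<subseteq> span C" "finite C" "card C \<le> card B"
    by (rule independent_extend_card[OF B(1,2) empty_subsetI independent_empty])
  have sC: "span C = V" using C span_minimal[OF C(1) subspace_carr] by blast
  obtain b where b: "bij_betw b {..<card C} C" using ex_bij_betw_nat_finite[OF C(4)] by (auto simp: atLeast0LessThan)
  have "card C \<noteq> 4 \<and> card C \<noteq> 5"
  proof (rule ccontr)
    assume n: "\<not> (card C \<noteq> 4 \<and> card C \<noteq> 5)"
    interpret base_change L b "card C"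
      by unfold_locales (use b C sC in \<open>auto simp: bij_betw_def\<close>)
    show False using not_perfect[OF fin] n perfect by blast
  qed
  moreover have "card C \<noteq> 0" using C nz zero_in by auto
  moreover have "card C \<noteq> 1"
  proof
    assume "card C = 1"
    then obtain x where "C = {x}" by (rule card_1_singletonE)
    then show False using perfect_dim_le_2[OF perfect, of x x] C nz by auto
  qed
  moreover have "card C \<noteq> 2"
  proof
    assume "card C = 2"
    then obtain x y where "C = {x, y}" unfolding card_2_iff by blast
    then show False using perfect_dim_le_2[OF perfect, of x y] C nz by auto
  qed
  ultimately have "card C = 3" using C(5) B(3) by linarith
  then obtain x1 x2 x3 where c: "C = {x1, x2, x3}" unfolding card_3_iff by blast
  show ?thesis
    by (rule perfect_dim_3[of x1 x2 x3]) (use perfect C c \<open>card C = 3\<close> that in auto)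
qed

theorem classification:
  assumes fin: "finite V" and ns: "\<not> solvable L" and B: "independent B" "B \<subseteq> V" "card B = 5" "V \<subseteq> span B"
  shows "L \<cong>\<^sub>L Der (W12' :: ('k, nat \<Rightarrow> 'k) lie_data) \<or>
          (\<exists>\<delta>\<in>{0, 1}. L \<cong>\<^sub>L W_line \<delta>) \<or> (\<exists>\<delta>\<in>{0, 1}. L \<cong>\<^sub>L W'_plane \<delta>)"
proof -
  obtain P where P: "lie_ideal P L" "P \<noteq> {0}" "lie_char2.perfect (restrict_to L P)"
    by (rule exists_perfect_ideal[OF fin ns])
  have PV: "P \<subseteq> V" and idl: "\<And>x p. x \<in> V \<Longrightarrow> p \<in> P \<Longrightarrow> x \<bullet> p \<in> P" using P(1) unfolding lie_ideal_def by auto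
  have rs: "carr (restrict_to L P) = P" "smul (restrict_to L P) = smul L" "brk (restrict_to L P) = brk L"
    by (simp_all add: restrict_to_def)
  interpret P: lie_perfect_field "restrict_to L P"
    using lie_ideal_restrict[OF P(1)] sqrt_exists by (intro lie_perfect_field.intro lie_perfect_field_axioms.intro)
  have finB: "finite B" using B(3) card.infinite by fastforce
  obtain e f h where W: "P.W_triple e f h" "P \<subseteq> span {e, f, h}"
    by (rule P.perfect_dim_le_5[of B]) (use P fin finB B PV in \<open>auto simp: rs intro: finite_subset\<close>)
  have efh: "e \<in> P" "f \<in> P" "h \<in> P" and W': "W_triple e f h"
    using W(1) PV unfolding P.W_triple_def W_triple_def by (auto simp: rs)
  have ideal: "x \<bullet> e \<in> span {e, f, h} \<and> x \<bullet> f \<in> span {e, f, h}" if "x \<in> V" for x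
    using idl[OF that] efh W(2) by blast
  show ?thesis
    by (rule complement_cases[OF W' ideal B])
      (use isomorphic_Der_W12'[OF W' ideal] isomorphic_W_line isomorphic_W'_plane in blast)+
qed

end

theorem theorem4p2:
  assumes char2: "CHAR('k::{field,finite}) = 2"
  shows
    "(\<forall>L :: ('k, 'v::ab_group_add) lie_data.
        lie_algebra L \<and> lie_dim L = 5 \<and> \<not> solvable L \<longrightarrow>
          L \<cong>\<^sub>L Der (W12' :: ('k, nat \<Rightarrow> 'k) lie_data) \<or>
          (\<exists>\<delta>\<in>{0, 1}. L \<cong>\<^sub>L W_line \<delta>) \<or>
          (\<exists>\<delta>\<in>{0, 1}. L \<cong>\<^sub>L W'_plane \<delta>)) \<and>
     (\<forall>\<delta>\<in>{0, 1 :: 'k}. is_W_semidirect_rad \<delta> (W_line \<delta>) \<and> is_W'_direct_rad \<delta> (W'_plane \<delta>)) \<and>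
     (\<forall>\<delta>\<in>{0, 1 :: 'k}. \<not> Der W12' \<cong>\<^sub>L W_line \<delta>) \<and>
     (\<forall>\<delta>\<in>{0, 1 :: 'k}. \<not> Der W12' \<cong>\<^sub>L W'_plane \<delta>) \<and>
     (\<forall>\<delta>\<in>{0, 1 :: 'k}. \<forall>\<epsilon>\<in>{0, 1}. \<not> W_line \<delta> \<cong>\<^sub>L W'_plane \<epsilon>) \<and>
     \<not> W_line (0 :: 'k) \<cong>\<^sub>L W_line 1 \<and>
     \<not> W'_plane (0 :: 'k) \<cong>\<^sub>L W'_plane 1"
proof -
  have "of_nat CHAR('k) = (0 :: 'k)" by (rule of_nat_CHAR)
  then have c2: "(1::'k) + 1 = 0" unfolding char2 by simp
  interpret char2_field "TYPE('k)" by (rule char2_field.intro[OF c2])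
  interpret W': lie_char2 "W12' :: ('k, nat \<Rightarrow> 'k) lie_data" by (rule lie_W12')
  have q: "card (UNIV :: 'k set) \<ge> 2"
  proof -
    have "card {0, 1 :: 'k} \<le> card (UNIV :: 'k set)" by (rule card_mono) simp_all
    then show ?thesis by simp
  qed
  let ?c = "second_derived_centraliser"
  have cD: "card (?c (Der (W12' :: ('k, nat \<Rightarrow> 'k) lie_data))) \<le> 1"
    using card_mono[OF _ W'.second_derived_centraliser_Der[OF W_triple_W12' W12'_span]] by simp
  have cl: "card (?c (W_line \<delta>)) = card (UNIV :: 'k set)" for \<delta> :: 'k
    by (simp add: second_derived_centraliser_W_line card_cartesian_product)
  have cp: "card (?c (W'_plane \<delta>)) = card (UNIV :: 'k set) * card (UNIV :: 'k set)" for \<delta> :: 'k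
    unfolding second_derived_centraliser_W'_plane card_cartesian_product UNIV_Times_UNIV[symmetric] by simp

  have lW: "lie_algebra (W_line \<delta>)" and lP: "lie_algebra (W'_plane \<delta>)" for \<delta> :: 'k
    using lie_W_line lie_W'_plane by (simp_all add: lie_char2_def)
  have D0: "0 \<in> carr (Der (W12' :: ('k, nat \<Rightarrow> 'k) lie_data))"
    and Dbrk: "\<And>x y. x \<in> carr (Der (W12' :: ('k, nat \<Rightarrow> 'k) lie_data)) \<Longrightarrow> y \<in> carr (Der W12') \<Longrightarrow>
       brk (Der W12') x y \<in> carr (Der W12')"
    by (rule W'.Der_closed)+
  have cD_iso: "card (?c (Der (W12' :: ('k, nat \<Rightarrow> 'k) lie_data))) = card (?c M)"
    if "Der (W12' :: ('k, nat \<Rightarrow> 'k) lie_data) \<cong>\<^sub>L M" for M :: "('k, 'w::ab_group_add) lie_data"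
    using that second_derived_centraliser_iso[OF D0 Dbrk, THEN bij_betw_same_card] unfolding isomorphic_def by blast
  have c_iso: "card (?c L) = card (?c M)"
    if "lie_algebra L" "L \<cong>\<^sub>L M" for L :: "('k, 'u::ab_group_add) lie_data" and M :: "('k, 'w::ab_group_add) lie_data"
    using that(2) second_derived_centraliser_iso[OF lie_algebra_closed[OF that(1)], THEN bij_betw_same_card] unfolding isomorphic_def by blast
  have part1: "L \<cong>\<^sub>L Der (W12' :: ('k, nat \<Rightarrow> 'k) lie_data) \<or>
          (\<exists>\<delta>\<in>{0, 1}. L \<cong>\<^sub>L W_line \<delta>) \<or> (\<exists>\<delta>\<in>{0, 1}. L \<cong>\<^sub>L W'_plane \<delta>)"
    if L: "lie_algebra L" and dim: "lie_dim L = 5" and ns: "\<not> solvable L" for L :: "('k, 'v) lie_data"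
  proof -
    interpret L: lie_algebra L by (rule L)
    interpret L: lie_perfect_field L
      by unfold_locales (use c2 sqrt_exists_finite in simp_all)
    obtain B where B: "B \<subseteq> carr L" "L.independent B" "carr L \<subseteq> L.span B" "card B = L.dim (carr L)"
      using L.basis_exists by blast
    have cB: "card B = 5" using B(4) dim unfolding lie_dim_def by simp
    then have "finite B" using card.infinite by fastforce
    then have "finite (carr L)" using finite_span[OF L.vector_space_axioms] B(3) by (meson finite_subset)
    then show ?thesis by (rule L.classification[OF _ ns B(2,1) cB B(3)])
  qed
  have iso0: False if iso: "W_line (0 :: 'k) \<cong>\<^sub>L W_line 1"
  proof -
    obtain \<phi> where \<phi>: "lie_iso \<phi> (W_line (0 :: 'k)) (W_line 1)" using iso unfolding isomorphic_def by blast
    have "\<forall>z\<in>?c (W_line (0::'k)). \<forall>x\<in>carr (W_line 0). brk (W_line 0) z x = 0"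
      by (auto simp: second_derived_centraliser_W_line W_line_simps brk_W12_0 zero_prod_def)
    note central = second_derived_centraliser_central_iso[OF lW \<phi> this]
    have "brk (W_line 1) (0, 1) (dp 3, 0) = (0 :: (nat \<Rightarrow> 'k) \<times> 'k)"
      by (rule central[rule_format]) (simp_all add: second_derived_centraliser_W_line W_line_simps)
    then show False by (simp add: W_line_simps zero_prod_def dp_def)
  qed
  have iso1: False if iso: "W'_plane (0 :: 'k) \<cong>\<^sub>L W'_plane 1"
  proof -
    obtain \<phi> where \<phi>: "lie_iso \<phi> (W'_plane (0 :: 'k)) (W'_plane 1)" using iso unfolding isomorphic_def by blast
    have "\<forall>z\<in>?c (W'_plane (0::'k)). \<forall>x\<in>carr (W'_plane 0). brk (W'_plane 0) z x = 0"
      by (auto simp: second_derived_centraliser_W'_plane W'_plane_simps brk_W12_0 W12'_O12 zero_prod_def)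
    note central = second_derived_centraliser_central_iso[OF lP \<phi> this]
    have "brk (W'_plane 1) (0, (1, 0)) (0, (0, 1)) = (0 :: (nat \<Rightarrow> 'k) \<times> 'k \<times> 'k)"
      by (rule central[rule_format]) (simp_all add: second_derived_centraliser_W'_plane W'_plane_simps carr_W12')
    then show False by (simp add: W'_plane_simps zero_prod_def)
  qed
  have qq: "card (UNIV :: 'k set) \<noteq> card (UNIV :: 'k set) * card (UNIV :: 'k set)" "\<not> card (UNIV :: 'k set) \<le> 1" "\<not> card (UNIV :: 'k set) * card (UNIV :: 'k set) \<le> 1"
    using q mult_le_mono[OF q q] by auto
  show ?thesis
  proof (intro conjI allI ballI impI notI)
    fix L :: "('k, 'v) lie_data"
    assume "lie_algebra L \<and> lie_dim L = 5 \<and> \<not> solvable L"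
    then show "L \<cong>\<^sub>L Der (W12' :: ('k, nat \<Rightarrow> 'k) lie_data) \<or>
          (\<exists>\<delta>\<in>{0, 1}. L \<cong>\<^sub>L W_line \<delta>) \<or> (\<exists>\<delta>\<in>{0, 1}. L \<cong>\<^sub>L W'_plane \<delta>)"
      using part1 by blast
  next
    fix \<delta> :: 'k
    show "is_W_semidirect_rad \<delta> (W_line \<delta>)" by (rule W_line_description)
    show "is_W'_direct_rad \<delta> (W'_plane \<delta>)" by (rule W'_plane_description)
    show False if "Der W12' \<cong>\<^sub>L W_line \<delta>" using cD_iso[OF that] cD cl qq by simp
    show False if "Der W12' \<cong>\<^sub>L W'_plane \<delta>" using cD_iso[OF that] cD cp qq by simp
    show False if "W_line \<delta> \<cong>\<^sub>L W'_plane \<epsilon>" for \<epsilon> using c_iso[OF lW that] cl cp qq by simp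
  qed (fact iso0 iso1)+
qed

end
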